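(* Let $1<p<\infty$, $p\ne2$, and $\max\{1,p-1\}<q<\infty$ with $\frac{pq}2\ge1$. Assume that $|F|\in L^{\frac{pq}2}_{\mathrm{loc}}(\Omega_T)$ and that $u\in L^{\frac{pq}2}_{\mathrm{loc}}(0,T;W^{1,\frac{pq}2}_{\mathrm{loc}}(\Omega;\mathbb{R}^N))$ satisfies $$\iint_{\Omega_T}\bigl(-u\cdot\varphi_t+\mathcal{A}(z,\nabla u)\cdot\nabla\varphi\bigr)\,dz=\iint_{\Omega_T}|F|^{p-2}F\cdot\nabla\varphi\,dz$$ for every $\varphi\in C_0^\infty(\Omega_T;\mathbb{R}^N)$. For a parabolic cylinder $Q=Q_r$ with $2Q\Subset\Omega_T$ let $$g(x,t)=\begin{cases}\Bigl(M^*\bigl((|\nabla u|+|F|)1_{2Q}\bigr)(x,t)+1\Bigr)^{\frac p2},&1<p<2,\\[1ex]\Bigl(M^*\Bigl(\bigl(\tfrac{|u|}r+|\nabla u|+|F|\bigr)^{p-1}1_{2Q}\Bigr)(x,t)+1\Bigr)^{\frac p{2(p-1)}},&2<p<\infty.\end{cases}$$ (i) If $1<q<2$, then for $1<q\le q^*<\frac{2q}{2-q}$ there exists a constant $c=c(n,p,q,q^*,L)$ such that $$\left(\frac1{|I|}\int_{I}\frac{|u(x,t)-u_{I}(x)|^{q^*}}{|I|^{\frac{q^*}2}}\,dt\right)^{\frac1{q^*}}\le c\left(\frac1{|I|}\int_{I}g(x,t)^q\,dt\right)^{\frac1q}$$ for every parabolic cylinder $Q=Q_r=B\times I$ such that $2Q\Subset\Omega_T$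 and for almost every $x\in B$. (ii) If $q=2$, then there exists a constant $c=c(n,p,L)$ such that $$\frac1{|I|}\int_I\exp\left(\left(\frac{|u(x,t)-u_{I}(x)|}{c|I|^{\frac12}\left(\frac1{|I|}\int_{I}g(x,t)^{2}\,dt\right)^{\frac12}}\right)^{2}\right)dt\le c$$ for every parabolic cylinder $Q=Q_r=B\times I$ such that $2Q\Subset\Omega_T$ and for almost every $x\in B$. (iii) If $q>2$, then there exists a constant $c=c(n,p,q,L)$ such that $$\operatorname*{ess\,sup}_{t\in I}\frac{|u(x,t)-u_{I}(x)|}{|I|^{\frac12}}\le c\left(\frac1{|I|}\int_{I}g(x,t)^q\,dt\right)^{\frac1q}$$ for every parabolic cylinder $Q=Q_r=B\times I$ such that $2Q\Subset\Omega_T$ and for almost every $x\in B$.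
   Context: $\Omega\subset\mathbb{R}^n$, $n\ge1$, is a bounded open domain, $T>0$, $\Omega_T=\Omega\times(0,T)$, $N\ge1$, $0<\nu<L<\infty$. $\mathcal{A}:\Omega_T\times\mathbb{R}^{Nn}\to\mathbb{R}^{Nn}$ is a Carathéodory vector field ($\mathcal{A}(\cdot,\xi)$ measurable for every $\xi$, $\mathcal{A}(z,\cdot)$ continuous for a.e. $z$) with $\nu|\xi|^p\le\mathcal{A}(z,\xi)\cdot\xi$ and $|\mathcal{A}(z,\xi)|\le L|\xi|^{p-1}$ for a.e. $z\in\Omega_T$ and every $\xi\in\mathbb{R}^{Nn}$. $F:\Omega_T\to\mathbb{R}^{Nn}$ is measurable. We write $z=(x,t)$, $dz=dx\,dt$, and $\nabla$ is the gradient in $x$. For $1\le m<\infty$, $u\in L^m_{\mathrm{loc}}(0,T;W^{1,m}_{\mathrm{loc}}(\Omega;\mathbb{R}^N))$ means that for all $\Omega'\Subset\Omega$ and $0<t_1<t_2<T$ one has $u(\cdot,t)\in W^{1,m}(\Omega';\mathbb{R}^N)$ for a.e. $t\in(t_1,t_2)$ and $\int_{t_1}^{t_2}\int_{\Omega'}(|u|^m+|\nabla u|^m)\,dx\,dt<\infty$. Parabolic cylinders: $Q_r=B\times I$ with $B=B_r(x_0)$, $I=(t_0-r^2,t_0+r^2)$, and $2Q_r=B_{2r}(x_0)\times(t_0-(2r)^2,t_0+(2r)^2)$. $2Q\Subset\Omega_T$ means that the closure of $2Q$ is a compact subset of $\Omega_T$. $u_I(x)=\frac1{|I|}\int_I u(x,t)\,dt$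 (componentwise). Functions multiplied by $1_{2Q}$ are extended by zero outside $2Q$. The strong maximal function of $f\in L^1_{\mathrm{loc}}(\mathbb{R}^{n+1})$ is $M^*f(z)=\sup\frac1{|B'\times I'|}\iint_{B'\times I'}|f|\,d\zeta$, the supremum taken over all cylinders $B'\times I'\ni z$ with $B'\subset\mathbb{R}^n$ an open ball and $I'\subset\mathbb{R}$ a bounded open interval (radius and length independent of each other). *)

theory Defs
  imports "HOL-Analysis.Analysis" "HOL-Probability.Essential_Supremum"
begin

(* The constants of the theorem must not depend on N, so N is a natural number and not a type.
   A vector of R^N is a sequence of reals vanishing from index N on; a vector of R^(Nn) is a
   sequence of vectors of real^'n vanishing from index N on (the i-th entry is the i-th row).
   On these carriers the product topology and the product sigma-algebra of nat => 'a agree with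
   the Euclidean ones. The spatial dimension n is CARD('n), space-time points are pairs (x, t),
   and measurability is Lebesgue measurability. *)

definition vecs :: "nat \<Rightarrow> (nat \<Rightarrow> 'a::zero) set" where
  "vecs N = {v. \<forall>i\<ge>N. v i = 0}"

definition vinner :: "nat \<Rightarrow> (nat \<Rightarrow> 'a::real_inner) \<Rightarrow> (nat \<Rightarrow> 'a) \<Rightarrow> real" where
  "vinner N v w = (\<Sum>i<N. v i \<bullet> w i)"

definition vnorm :: "nat \<Rightarrow> (nat \<Rightarrow> 'a::real_normed_vector) \<Rightarrow> real" where
  "vnorm N v = L2_set (\<lambda>i. norm (v i)) {..<N}"

primrec k_times_cont_diff :: "nat \<Rightarrow> ('a::euclidean_space \<Rightarrow> real) \<Rightarrow> bool" where
  "k_times_cont_diff 0 f \<longleftrightarrow> continuous_on UNIV f"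
| "k_times_cont_diff (Suc k) f \<longleftrightarrow> (\<forall>x. f differentiable (at x)) \<and>
     (\<forall>e\<in>Basis. k_times_cont_diff k (\<lambda>x. frechet_derivative f (at x) e))"

definition compactly_contained :: "'a::topological_space set \<Rightarrow> 'a set \<Rightarrow> bool" where
  "compactly_contained S U \<longleftrightarrow> compact (closure S) \<and> closure S \<subseteq> U"

(* C_0^infinity(S), as functions on the whole space *)
definition test_functions :: "'a::euclidean_space set \<Rightarrow> ('a \<Rightarrow> real) set" where
  "test_functions S =
     {\<phi>. (\<forall>k. k_times_cont_diff k \<phi>) \<and> compactly_contained {x. \<phi> x \<noteq> 0} S}"

definition vec_test_functions ::
    "nat \<Rightarrow> 'a::euclidean_space set \<Rightarrow> ('a \<Rightarrow> nat \<Rightarrow> real) set" where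
  "vec_test_functions N S =
     {\<phi>. (\<forall>z. \<phi> z \<in> vecs N) \<and> (\<forall>i<N. (\<lambda>z. \<phi> z i) \<in> test_functions S)}"

definition time_deriv ::
    "((real^'n) \<times> real \<Rightarrow> nat \<Rightarrow> real) \<Rightarrow> (real^'n) \<times> real \<Rightarrow> nat \<Rightarrow> real" where
  "time_deriv \<phi> z = (\<lambda>i. frechet_derivative (\<lambda>z. \<phi> z i) (at z) (0, 1))"

definition space_grad ::
    "((real^'n) \<times> real \<Rightarrow> nat \<Rightarrow> real) \<Rightarrow> (real^'n) \<times> real \<Rightarrow> nat \<Rightarrow> real^'n" where
  "space_grad \<phi> z =
     (\<lambda>i. \<chi> j. frechet_derivative (\<lambda>z. \<phi> z i) (at z) (axis j 1, 0))"

(* V is the weak gradient of the scalar function v on S *)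
definition weak_gradient_on ::
    "(real^'n) set \<Rightarrow> (real^'n \<Rightarrow> real) \<Rightarrow> (real^'n \<Rightarrow> real^'n) \<Rightarrow> bool" where
  "weak_gradient_on S v V \<longleftrightarrow>
     (\<forall>\<phi>\<in>test_functions S. \<forall>j.
        (LINT x:S|lebesgue. v x * frechet_derivative \<phi> (at x) (axis j 1))
          = - (LINT x:S|lebesgue. V x $ j * \<phi> x))"

(* v belongs to W^(1,m)(S; R^N) and V is its weak gradient *)
definition sobolev_W1 ::
    "nat \<Rightarrow> real \<Rightarrow> (real^'n) set \<Rightarrow> (real^'n \<Rightarrow> nat \<Rightarrow> real) \<Rightarrow> (real^'n \<Rightarrow> nat \<Rightarrow> real^'n) \<Rightarrow> bool" where
  "sobolev_W1 N m S v V \<longleftrightarrow>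
     v \<in> borel_measurable (lebesgue_on S) \<and> V \<in> borel_measurable (lebesgue_on S) \<and>
     (\<integral>\<^sup>+x\<in>S. ennreal (vnorm N (v x) powr m + vnorm N (V x) powr m) \<partial>lebesgue) < \<infinity> \<and>
     (\<forall>i<N. weak_gradient_on S (\<lambda>x. v x i) (\<lambda>x. V x i))"

abbreviation space_time :: "(real^'n) set \<Rightarrow> real \<Rightarrow> ((real^'n) \<times> real) set" where
  "space_time \<Omega> T \<equiv> \<Omega> \<times> {0<..<T}"

(* u belongs to L^m_loc(0,T; W^(1,m)_loc(Omega; R^N)) and Du is (a representative of) its
   spatial weak gradient *)
definition Lm_loc_W1m_loc ::
    "nat \<Rightarrow> real \<Rightarrow> (real^'n) set \<Rightarrow> real \<Rightarrow> ((real^'n) \<times> real \<Rightarrow> nat \<Rightarrow> real)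
      \<Rightarrow> ((real^'n) \<times> real \<Rightarrow> nat \<Rightarrow> real^'n) \<Rightarrow> bool" where
  "Lm_loc_W1m_loc N m \<Omega> T u Du \<longleftrightarrow>
     u \<in> borel_measurable (lebesgue_on (space_time \<Omega> T)) \<and>
     Du \<in> borel_measurable (lebesgue_on (space_time \<Omega> T)) \<and>
     (\<forall>z\<in>space_time \<Omega> T. u z \<in> vecs N \<and> Du z \<in> vecs N) \<and>
     (\<forall>\<Omega>' t1 t2. open \<Omega>' \<and> compactly_contained \<Omega>' \<Omega> \<and> 0 < t1 \<and> t1 < t2 \<and> t2 < T \<longrightarrow>
        (AE t\<in>{t1<..<t2} in lebesgue. sobolev_W1 N m \<Omega>' (\<lambda>x. u (x, t)) (\<lambda>x. Du (x, t))) \<and>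
        (\<integral>\<^sup>+z\<in>\<Omega>' \<times> {t1<..<t2}. ennreal (vnorm N (u z) powr m + vnorm N (Du z) powr m)
            \<partial>lebesgue) < \<infinity>)"

definition Lm_loc :: "nat \<Rightarrow> real \<Rightarrow> ((real^'n) \<times> real) set
      \<Rightarrow> ((real^'n) \<times> real \<Rightarrow> nat \<Rightarrow> real^'n) \<Rightarrow> bool" where
  "Lm_loc N m U F \<longleftrightarrow>
     (\<forall>K. compact K \<and> K \<subseteq> U \<longrightarrow>
        (\<integral>\<^sup>+z\<in>K. ennreal (vnorm N (F z) powr m) \<partial>lebesgue) < \<infinity>)"

(* Caratheodory vector field with p-coercivity and (p-1)-growth *)
definition p_structure ::
    "nat \<Rightarrow> real \<Rightarrow> real \<Rightarrow> real \<Rightarrow> ((real^'n) \<times> real) set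
      \<Rightarrow> ((real^'n) \<times> real \<Rightarrow> (nat \<Rightarrow> real^'n) \<Rightarrow> nat \<Rightarrow> real^'n) \<Rightarrow> bool" where
  "p_structure N p \<nu> L U A \<longleftrightarrow>
     (\<forall>z\<in>U. \<forall>\<xi>\<in>vecs N. A z \<xi> \<in> vecs N) \<and>
     (\<forall>\<xi>\<in>vecs N. (\<lambda>z. A z \<xi>) \<in> borel_measurable (lebesgue_on U)) \<and>
     (AE z\<in>U in lebesgue. continuous_on (vecs N) (A z)) \<and>
     (AE z\<in>U in lebesgue. \<forall>\<xi>\<in>vecs N.
        \<nu> * vnorm N \<xi> powr p \<le> vinner N (A z \<xi>) \<xi> \<and>
        vnorm N (A z \<xi>) \<le> L * vnorm N \<xi> powr (p - 1))"

(* u, with spatial gradient Du, solves u_t - div A(z, Du) = - div (|F|^(p-2) F) in the sense of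
   distributions; 0 powr a = 0 gives |F|^(p-2) F = 0 where F = 0, also for p < 2 *)
definition distributional_solution ::
    "nat \<Rightarrow> real \<Rightarrow> ((real^'n) \<times> real) set
      \<Rightarrow> ((real^'n) \<times> real \<Rightarrow> (nat \<Rightarrow> real^'n) \<Rightarrow> nat \<Rightarrow> real^'n)
      \<Rightarrow> ((real^'n) \<times> real \<Rightarrow> nat \<Rightarrow> real^'n)
      \<Rightarrow> ((real^'n) \<times> real \<Rightarrow> nat \<Rightarrow> real) \<Rightarrow> ((real^'n) \<times> real \<Rightarrow> nat \<Rightarrow> real^'n) \<Rightarrow> bool" where
  "distributional_solution N p U A F u Du \<longleftrightarrow>
     (\<forall>\<phi>\<in>vec_test_functions N U.
        (LINT z:U|lebesgue. - vinner N (u z) (time_deriv \<phi> z)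
                            + vinner N (A z (Du z)) (space_grad \<phi> z))
        = (LINT z:U|lebesgue.
             vinner N (\<lambda>i. vnorm N (F z) powr (p - 2) *\<^sub>R F z i) (space_grad \<phi> z)))"

definition parabolic_system ::
    "real \<Rightarrow> real \<Rightarrow> real \<Rightarrow> (real^'n) set \<Rightarrow> real \<Rightarrow> nat \<Rightarrow> real
      \<Rightarrow> ((real^'n) \<times> real \<Rightarrow> (nat \<Rightarrow> real^'n) \<Rightarrow> nat \<Rightarrow> real^'n)
      \<Rightarrow> ((real^'n) \<times> real \<Rightarrow> nat \<Rightarrow> real^'n)
      \<Rightarrow> ((real^'n) \<times> real \<Rightarrow> nat \<Rightarrow> real) \<Rightarrow> ((real^'n) \<times> real \<Rightarrow> nat \<Rightarrow> real^'n) \<Rightarrow> bool" where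
  "parabolic_system p q L \<Omega> T N \<nu> A F u Du \<longleftrightarrow>
     open \<Omega> \<and> connected \<Omega> \<and> bounded \<Omega> \<and> 0 < T \<and> 1 \<le> N \<and> 0 < \<nu> \<and> \<nu> < L \<and>
     p_structure N p \<nu> L (space_time \<Omega> T) A \<and>
     F \<in> borel_measurable (lebesgue_on (space_time \<Omega> T)) \<and>
     (\<forall>z\<in>space_time \<Omega> T. F z \<in> vecs N) \<and>
     Lm_loc N (p * q / 2) (space_time \<Omega> T) F \<and>
     Lm_loc_W1m_loc N (p * q / 2) \<Omega> T u Du \<and>
     distributional_solution N p (space_time \<Omega> T) A F u Du"

abbreviation time_interval :: "real \<Rightarrow> real \<Rightarrow> real set" where
  "time_interval t0 r \<equiv> {t0 - r\<^sup>2<..<t0 + r\<^sup>2}"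

definition par_cyl :: "real^'n \<Rightarrow> real \<Rightarrow> real \<Rightarrow> ((real^'n) \<times> real) set" where
  "par_cyl x0 t0 r = ball x0 r \<times> time_interval t0 r"

(* x powr a on [0, infinity], for a > 0 *)
definition epowr :: "ennreal \<Rightarrow> real \<Rightarrow> ennreal" where
  "epowr x a = (if x = \<infinity> then \<infinity> else ennreal (enn2real x powr a))"

definition strong_maximal ::
    "((real^'n) \<times> real \<Rightarrow> real) \<Rightarrow> (real^'n) \<times> real \<Rightarrow> ennreal" where
  "strong_maximal f z =
     (SUP (y, \<rho>, a, b) \<in> {(y, \<rho>, a, b). z \<in> ball y \<rho> \<times> {a<..<b}}.
        (\<integral>\<^sup>+\<zeta>\<in>ball y \<rho> \<times> {a<..<b}. ennreal \<bar>f \<zeta>\<bar> \<partial>lebesgue)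
          / emeasure lebesgue (ball y \<rho> \<times> {a<..<b}))"

(* the function g attached to the cylinder with centre (x0, t0) and radius r *)
definition max_control ::
    "nat \<Rightarrow> real \<Rightarrow> ((real^'n) \<times> real \<Rightarrow> nat \<Rightarrow> real) \<Rightarrow> ((real^'n) \<times> real \<Rightarrow> nat \<Rightarrow> real^'n)
      \<Rightarrow> ((real^'n) \<times> real \<Rightarrow> nat \<Rightarrow> real^'n) \<Rightarrow> real^'n \<Rightarrow> real \<Rightarrow> real
      \<Rightarrow> (real^'n) \<times> real \<Rightarrow> ennreal" where
  "max_control N p u Du F x0 t0 r z =
     (if p < 2 then
        epowr (strong_maximal
          (\<lambda>\<zeta>. (vnorm N (Du \<zeta>) + vnorm N (F \<zeta>)) * indicator (par_cyl x0 t0 (2 * r)) \<zeta>) z + 1)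
          (p / 2)
      else
        epowr (strong_maximal
          (\<lambda>\<zeta>. (vnorm N (u \<zeta>) / r + vnorm N (Du \<zeta>) + vnorm N (F \<zeta>)) powr (p - 1)
                * indicator (par_cyl x0 t0 (2 * r)) \<zeta>) z + 1)
          (p / (2 * (p - 1))))"

definition time_mean ::
    "real set \<Rightarrow> ((real^'n) \<times> real \<Rightarrow> nat \<Rightarrow> real) \<Rightarrow> real^'n \<Rightarrow> nat \<Rightarrow> real" where
  "time_mean I u x = (\<lambda>i. (LINT t:I|lebesgue. u (x, t) i) / measure lebesgue I)"

(* |u(x,t) - u_I(x)| *)
definition time_osc ::
    "nat \<Rightarrow> real set \<Rightarrow> ((real^'n) \<times> real \<Rightarrow> nat \<Rightarrow> real) \<Rightarrow> real^'n \<Rightarrow> real \<Rightarrow> real" where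
  "time_osc N I u x t = vnorm N (\<lambda>i. u (x, t) i - time_mean I u x i)"

definition nn_average :: "real set \<Rightarrow> (real \<Rightarrow> ennreal) \<Rightarrow> ennreal" where
  "nn_average I f = (\<integral>\<^sup>+t\<in>I. f t \<partial>lebesgue) / emeasure lebesgue I"

end

theory Submission
  imports Defs
begin

text \<open>
  The system controls the time derivative of \<open>u\<close> only in a negative norm, while the gradient
  controls oscillations in space. Playing one against the other yields, for almost all points
  \<open>(x,t)\<close> and \<open>(x,s)\<close> on a common vertical line, the pointwise bound
  \<open>|u(x,t) - u(x,s)| \<le> K |t - s|^(1/2) (g(x,t) + g(x,s))\<close>, a Hajlasz inequality of order 1/2 in time
  (\<open>pointwise_hajlasz\<close>). The theorem is then the one-dimensional Sobolev embedding of order 1/2, with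
  its subcritical, critical and supercritical ranges \<open>q < 2\<close>, \<open>q = 2\<close>, \<open>q > 2\<close>.

  For the pointwise bound, fix a unit vector \<open>e\<close> and average \<open>e \<bullet> u\<close> with a smooth kernel at scale
  \<open>\<rho>\<close> in space and \<open>\<delta>\<close> in time. Let \<open>M\<close> bound the averages of \<open>|\<nabla>u|\<close> and \<open>M^(p-1)\<close> those of
  \<open>(|\<nabla>u| + |F|)^(p-1)\<close> over all cylinders through either of the two points. Passing from the scale \<open>\<delta>\<close> to the
  scale \<open>\<rho>\<close> in space costs \<open>\<rho> M\<close>, because the derivative of the dilated kernel in the scale is a
  divergence (\<open>kernel_average_scale_change\<close>). Passing from time \<open>s\<close> to time \<open>t\<close> at scale \<open>\<rho>\<close> costs
  \<open>(t - s) M^(p-1) / \<rho>\<close>, by testing the system with the kernel times a cut-off of \<open>[s,t]\<close>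
  (\<open>kernel_average_time_change\<close>). As \<open>\<delta>\<close> tends to 0 the averages tend to the values at almost every
  point (\<open>AE_lebesgue_point_kernel\<close>). The choice \<open>\<rho>\<^sup>2 = (t - s) M^(p-2) / 2\<close> balances the two costs
  and gives \<open>(t - s)^(1/2) M^(p/2)\<close>. If \<open>p < 2\<close> this radius is admissible since \<open>M \<ge> 1\<close>; if \<open>p > 2\<close>
  it may exceed \<open>r\<close>, but then the trivial bound \<open>|u| \<le> c r M\<close>, for which \<open>|u| / r\<close> is part of the
  maximal function, is good enough. Jensen's inequality moves between the powers 1 and \<open>p - 1\<close>. The vector \<open>e\<close> is
  chosen after the two points, so no constant depends on \<open>N\<close>.

  For the embedding, normalise \<open>g\<close> to have \<open>q\<close>-th mean 1. A point with \<open>g \<le> 2^(k+1)\<close> has, within a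
  distance comparable to the measure of \<open>{g > 2^k}\<close>, a point with \<open>g \<le> 2^k\<close>; chaining down to \<open>k = 0\<close>
  bounds the oscillation by a sum of \<open>2^k |{g > 2^k}|^(1/2)\<close> (\<open>hajlasz_chain\<close>). By Chebyshev this is a
  geometric sum for \<open>q \<noteq> 2\<close>, increasing in the subcritical and decreasing in the supercritical case. For
  \<open>q = 2\<close> its terms are square summable, so by Cauchy-Schwarz a sum of \<open>k\<close> terms is of order \<open>k^(1/2)\<close>,
  and \<open>k\<close> is at most of order \<open>ln g\<close>: this is the exponential square integrability.
\<close>

section \<open>Smooth functions\<close>

definition smooth :: "('a::euclidean_space \<Rightarrow> real) \<Rightarrow> bool" where
  "smooth f \<longleftrightarrow> (\<forall>k. k_times_cont_diff k f)"

lemma k_times_cont_diff_continuous: "k_times_cont_diff k f \<Longrightarrow> continuous_on UNIV f"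
  by (cases k) (auto simp: continuous_on_eq_continuous_within differentiable_imp_continuous_within)

lemma k_times_cont_diff_SucD: "k_times_cont_diff (Suc k) f \<Longrightarrow> k_times_cont_diff k f"
proof (induction k arbitrary: f)
  case 0
  then show ?case using k_times_cont_diff_continuous[of "Suc 0" f] by simp
next
  case (Suc k)
  show ?case unfolding k_times_cont_diff.simps(2)[of k f]
    using Suc.prems Suc.IH unfolding k_times_cont_diff.simps(2)[of "Suc k" f] by blast
qed

lemma smooth_continuous: "smooth f \<Longrightarrow> continuous_on UNIV f"
  unfolding smooth_def using k_times_cont_diff_continuous by blast

lemma smooth_differentiable: "smooth f \<Longrightarrow> f differentiable (at x)"
  unfolding smooth_def by (metis k_times_cont_diff.simps(2))

lemma smooth_partial: "smooth f \<Longrightarrow> e \<in> Basis \<Longrightarrow> smooth (\<lambda>x. frechet_derivative f (at x) e)"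
  unfolding smooth_def by (metis k_times_cont_diff.simps(2))

text \<open>A class closed under partial derivatives consists of smooth functions, by induction on the order. This
replaces formulas for the higher derivatives.\<close>
lemma smooth_if_derivative_closed:
  assumes "\<And>f. f \<in> F \<Longrightarrow> (\<forall>x. f differentiable (at x)) \<and>
             (\<forall>e\<in>Basis. (\<lambda>x. frechet_derivative f (at x) e) \<in> F)"
    and "f \<in> F"
  shows "smooth f"
proof -
  have "k_times_cont_diff k f" if "f \<in> F" for k f
    using that
  proof (induction k arbitrary: f)
    case 0
    then show ?case using assms(1)[of f]
      by (auto simp: continuous_on_eq_continuous_within differentiable_imp_continuous_within)
  next
    case (Suc k)
    then show ?case using assms(1)[of f] by auto
  qed
  then show ?thesis using assms(2) by (simp add: smooth_def)
qed

lemma k_times_cont_diff_const: "k_times_cont_diff k (\<lambda>x. c)"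
  by (induction k arbitrary: c) (auto simp: frechet_derivative_const)

lemma smooth_const [intro]: "smooth (\<lambda>x. c)"
  by (simp add: smooth_def k_times_cont_diff_const)

lemma smooth_linear:
  assumes "bounded_linear f" shows "smooth f"
  unfolding smooth_def
proof
  fix k show "k_times_cont_diff k f"
  proof (cases k)
    case 0
    then show ?thesis using assms by (simp add: linear_continuous_on)
  next
    case (Suc m)
    then show ?thesis using bounded_linear_imp_differentiable[OF assms]
        frechet_derivative_at[OF bounded_linear_imp_has_derivative[OF assms], symmetric]
      by (auto simp: k_times_cont_diff_const)
  qed
qed

lemma frechet_derivative_add_real:
  fixes f g :: "'a::euclidean_space \<Rightarrow> real"
  assumes "f differentiable (at x)" "g differentiable (at x)"
  shows "frechet_derivative (\<lambda>x. f x + g x) (at x) e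
    = frechet_derivative f (at x) e + frechet_derivative g (at x) e"
proof -
  have "((\<lambda>x. f x + g x) has_derivative
     (\<lambda>e. frechet_derivative f (at x) e + frechet_derivative g (at x) e)) (at x)"
    using assms by (intro has_derivative_add) (auto simp: frechet_derivative_works)
  from frechet_derivative_at[OF this, symmetric] show ?thesis by simp
qed

lemma frechet_derivative_mult_real:
  fixes f g :: "'a::euclidean_space \<Rightarrow> real"
  assumes "f differentiable (at x)" "g differentiable (at x)"
  shows "frechet_derivative (\<lambda>x. f x * g x) (at x) e
    = f x * frechet_derivative g (at x) e + frechet_derivative f (at x) e * g x"
proof -
  have "((\<lambda>x. f x * g x) has_derivative
     (\<lambda>e. f x * frechet_derivative g (at x) e + frechet_derivative f (at x) e * g x)) (at x)"
    using assms by (intro has_derivative_mult) (auto simp: frechet_derivative_works)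
  from frechet_derivative_at[OF this, symmetric] show ?thesis by simp
qed

lemma frechet_derivative_compose_real:
  fixes f :: "'b::euclidean_space \<Rightarrow> real" and h :: "'a::euclidean_space \<Rightarrow> 'b"
  assumes "f differentiable (at (h x))" "(h has_derivative h') (at x)"
  shows "frechet_derivative (\<lambda>x. f (h x)) (at x) e = frechet_derivative f (at (h x)) (h' e)"
proof -
  have "((\<lambda>x. f (h x)) has_derivative (\<lambda>e. frechet_derivative f (at (h x)) (h' e))) (at x)"
    using has_derivative_compose[OF assms(2), of f "frechet_derivative f (at (h x))"] assms(1)
    by (auto simp: frechet_derivative_works)
  from frechet_derivative_at[OF this, symmetric] show ?thesis by simp
qed

lemma k_times_cont_diff_add:
  "k_times_cont_diff k f \<Longrightarrow> k_times_cont_diff k g \<Longrightarrow> k_times_cont_diff k (\<lambda>x. f x + g x)"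
proof (induction k arbitrary: f g)
  case 0
  then show ?case by (auto intro: continuous_on_add)
next
  case (Suc k)
  then show ?case by (auto simp: frechet_derivative_add_real intro!: derivative_intros)
qed

lemma k_times_cont_diff_mult:
  "k_times_cont_diff k f \<Longrightarrow> k_times_cont_diff k g \<Longrightarrow> k_times_cont_diff k (\<lambda>x. f x * g x)"
proof (induction k arbitrary: f g)
  case 0
  then show ?case by (auto intro: continuous_on_mult)
next
  case (Suc k)
  have d: "\<forall>x. f differentiable (at x)" "\<forall>x. g differentiable (at x)"
    using Suc.prems by auto
  have "k_times_cont_diff k (\<lambda>x. frechet_derivative (\<lambda>x. f x * g x) (at x) e)"
    if "e \<in> Basis" for e
    using that Suc d k_times_cont_diff_SucD[OF Suc.prems(1)] k_times_cont_diff_SucD[OF Suc.prems(2)]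
    by (simp add: frechet_derivative_mult_real k_times_cont_diff_add)
  then show ?case using d by (auto intro!: derivative_intros)
qed

lemma smooth_add [intro]: "smooth f \<Longrightarrow> smooth g \<Longrightarrow> smooth (\<lambda>x. f x + g x)"
  by (simp add: smooth_def k_times_cont_diff_add)

lemma smooth_mult [intro]: "smooth f \<Longrightarrow> smooth g \<Longrightarrow> smooth (\<lambda>x. f x * g x)"
  by (simp add: smooth_def k_times_cont_diff_mult)

lemma smooth_diff: "smooth f \<Longrightarrow> smooth g \<Longrightarrow> smooth (\<lambda>x. f x - g x)"
  using smooth_add[of f "\<lambda>x. (-1) * g x"] smooth_mult[OF smooth_const] by fastforce

lemma smooth_divide: "smooth f \<Longrightarrow> smooth (\<lambda>x. f x / c)"
  using smooth_mult[OF _ smooth_const, of f "1 / c"] by simp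

lemma smooth_sum: "(\<And>i. i \<in> A \<Longrightarrow> smooth (f i)) \<Longrightarrow> smooth (\<lambda>x. \<Sum>i\<in>A. f i x)"
  by (induction A rule: infinite_finite_induct) auto

lemma k_times_cont_diff_sum:
  "(\<And>i. i \<in> A \<Longrightarrow> k_times_cont_diff k (f i)) \<Longrightarrow> k_times_cont_diff k (\<lambda>x. \<Sum>i\<in>A. f i x)"
  by (induction A rule: infinite_finite_induct)
     (auto intro: k_times_cont_diff_const k_times_cont_diff_add)

lemma frechet_derivative_expand:
  fixes f :: "'a::euclidean_space \<Rightarrow> real"
  assumes "f differentiable (at x)"
  shows "frechet_derivative f (at x) v = (\<Sum>b\<in>Basis. (v \<bullet> b) * frechet_derivative f (at x) b)"
proof -
  have lin: "linear (frechet_derivative f (at x))"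
    using assms by (simp add: linear_frechet_derivative)
  have "frechet_derivative f (at x) v = frechet_derivative f (at x) (\<Sum>b\<in>Basis. (v \<bullet> b) *\<^sub>R b)"
    by (simp add: euclidean_representation)
  also have "\<dots> = (\<Sum>b\<in>Basis. (v \<bullet> b) * frechet_derivative f (at x) b)"
    using lin by (simp add: linear_sum linear_cmul)
  finally show ?thesis .
qed

lemma k_times_cont_diff_affine:
  fixes f :: "'b::euclidean_space \<Rightarrow> real" and A :: "'a::euclidean_space \<Rightarrow> 'b"
  assumes A: "bounded_linear A"
  shows "k_times_cont_diff k f \<Longrightarrow> k_times_cont_diff k (\<lambda>x. f (A x + c))"
proof (induction k arbitrary: f)
  case 0
  have "continuous_on UNIV (\<lambda>x. A x + c)"
    using A by (intro continuous_intros linear_continuous_on)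
  then show ?case using 0 continuous_on_compose2[of UNIV f UNIV "\<lambda>x. A x + c"] by auto
next
  case (Suc k)
  have d: "\<And>x. f differentiable (at x)" using Suc.prems by auto
  have h: "((\<lambda>x. A x + c) has_derivative A) (at x)" for x
    using bounded_linear_imp_has_derivative[OF A] has_derivative_add_const by blast
  have "(\<lambda>x. frechet_derivative (\<lambda>x. f (A x + c)) (at x) e)
      = (\<lambda>x. \<Sum>b\<in>Basis. (A e \<bullet> b) * frechet_derivative f (at (A x + c)) b)" for e
    by (subst frechet_derivative_compose_real[OF d h], subst frechet_derivative_expand[OF d]) simp
  moreover have "(\<lambda>x. f (A x + c)) differentiable at x" for x
    using differentiable_compose[OF d differentiableI[OF h]] by simp
  moreover have "k_times_cont_diff k (\<lambda>x. frechet_derivative f (at (A x + c)) b)"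
    if "b \<in> Basis" for b
    using Suc.IH[of "\<lambda>y. frechet_derivative f (at y) b"] Suc.prems that by auto
  ultimately show ?case
    by (auto intro!: k_times_cont_diff_sum k_times_cont_diff_mult k_times_cont_diff_const)
qed

lemma smooth_affine:
  "smooth f \<Longrightarrow> bounded_linear A \<Longrightarrow> smooth (\<lambda>x. f (A x + c))"
  by (simp add: smooth_def k_times_cont_diff_affine)

lemma k_times_cont_diff_compose:
  fixes \<psi> :: "real \<Rightarrow> real" and f :: "'a::euclidean_space \<Rightarrow> real"
  shows "k_times_cont_diff k \<psi> \<Longrightarrow> k_times_cont_diff k f \<Longrightarrow> k_times_cont_diff k (\<lambda>x. \<psi> (f x))"
proof (induction k arbitrary: \<psi> f)
  case 0
  then show ?case using continuous_on_compose2[of UNIV \<psi> UNIV f] by auto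
next
  case (Suc k)
  have d: "\<And>x. \<psi> differentiable (at x)" "\<And>x. f differentiable (at x)" using Suc.prems by auto
  have "(\<lambda>x. frechet_derivative (\<lambda>x. \<psi> (f x)) (at x) e)
      = (\<lambda>x. frechet_derivative f (at x) e * frechet_derivative \<psi> (at (f x)) 1)" for e
  proof
    fix x
    show "frechet_derivative (\<lambda>x. \<psi> (f x)) (at x) e
      = frechet_derivative f (at x) e * frechet_derivative \<psi> (at (f x)) 1"
      using frechet_derivative_compose_real[OF d(1) d(2)[unfolded frechet_derivative_works], of x e]
        frechet_derivative_expand[OF d(1), of "f x" "frechet_derivative f (at x) e"] by simp
  qed
  moreover have "(\<lambda>x. \<psi> (f x)) differentiable at x" for x
    using differentiable_compose[OF d] by simp
  ultimately show ?case using Suc.prems Suc.IH k_times_cont_diff_SucD[OF Suc.prems(2)]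
    by (auto intro!: k_times_cont_diff_mult)
qed

lemma smooth_compose: "smooth \<psi> \<Longrightarrow> smooth f \<Longrightarrow> smooth (\<lambda>x. \<psi> (f x))"
  by (simp add: smooth_def k_times_cont_diff_compose)

lemma frechet_derivative_real:
  fixes f :: "real \<Rightarrow> real"
  assumes "(f has_real_derivative d) (at x)"
  shows "frechet_derivative f (at x) e = d * e"
  using frechet_derivative_at[OF assms[unfolded has_field_derivative_def], symmetric] by simp

text \<open>The derivatives of \<open>exp (- 1 / x)\<close> are polynomials in \<open>1 / x\<close> times \<open>exp (- 1 / x)\<close>. Carrying the
polynomial along makes the family closed under differentiation.\<close>
definition flat_exp :: "real poly \<Rightarrow> real \<Rightarrow> real" where
  "flat_exp P x = (if x \<le> 0 then 0 else poly P (1 / x) * exp (- (1 / x)))"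

lemma poly_exp_tendsto_0: "((\<lambda>y. poly P y * exp (- y)) \<longlongrightarrow> 0) at_top" for P :: "real poly"
proof -
  have "((\<lambda>y. \<Sum>i\<le>degree P. coeff P i * (y ^ i / exp y)) \<longlongrightarrow> (\<Sum>i\<le>degree P. coeff P i * 0)) at_top"
    by (intro tendsto_intros tendsto_power_div_exp_0)
  then show ?thesis
    by (simp add: poly_altdef exp_minus divide_inverse sum_distrib_right mult.assoc)
qed

text \<open>Away from 0 this is the product rule; at 0 the difference quotient vanishes because \<open>exp (- y)\<close> beats every
polynomial in \<open>y = 1 / x\<close>.\<close>
lemma flat_exp_derivative:
  "(flat_exp P has_real_derivative flat_exp ([:0,0,1:] * (P - pderiv P)) x) (at x)"
proof -
  consider "x < 0" | "x > 0" | "x = 0" by linarith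
  then show ?thesis
  proof cases
    case 1
    have "(flat_exp P has_real_derivative 0) (at x)"
      by (rule has_field_derivative_transform_within_open[of "\<lambda>_. 0" _ _ "{..<0}"])
         (use 1 in \<open>auto simp: flat_exp_def\<close>)
    then show ?thesis using 1 by (simp add: flat_exp_def)
  next
    case 2
    have "((\<lambda>x. poly P (1 / x) * exp (- (1 / x))) has_real_derivative
        flat_exp ([:0,0,1:] * (P - pderiv P)) x) (at x)"
      using 2 by (auto intro!: derivative_eq_intros poly_DERIV[THEN DERIV_chain2]
          simp: flat_exp_def field_simps power2_eq_square)
    then show ?thesis
      by (rule has_field_derivative_transform_within_open[of _ _ _ "{0<..}"])
         (use 2 in \<open>auto simp: flat_exp_def\<close>)
  next
    case 3
    have "((\<lambda>h. poly ([:0,1:] * P) (1 / h) * exp (- (1 / h))) \<longlongrightarrow> 0) (at_right (0::real))"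
      using poly_exp_tendsto_0[of "[:0,1:] * P"] filterlim_inverse_at_top_right
      by (auto simp: filterlim_compose inverse_eq_divide dest: filterlim_compose)
    then have r: "((\<lambda>h. (flat_exp P (x + h) - flat_exp P x) / h) \<longlongrightarrow> 0) (at_right 0)"
      by (rule Lim_transform_eventually)
         (use 3 in \<open>auto simp: flat_exp_def eventually_at_right_less intro!: eventually_at_rightI[of 0 1]\<close>)
    have l: "((\<lambda>h. (flat_exp P (x + h) - flat_exp P x) / h) \<longlongrightarrow> 0) (at_left 0)"
      by (rule Lim_transform_eventually[OF tendsto_const])
         (use 3 in \<open>auto simp: flat_exp_def intro!: eventually_at_leftI[of "-1" 0]\<close>)
    show ?thesis unfolding DERIV_def using filterlim_split_at[OF l r] 3 by (simp add: flat_exp_def)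
  qed
qed

lemma smooth_flat_exp: "smooth (flat_exp P)"
proof (rule smooth_if_derivative_closed[where F = "range flat_exp"])
  fix f assume "f \<in> range flat_exp"
  then obtain Q where Q: "f = flat_exp Q" by auto
  have "(\<lambda>x. frechet_derivative f (at x) 1) = flat_exp ([:0,0,1:] * (Q - pderiv Q))"
    unfolding Q by (subst frechet_derivative_real[OF flat_exp_derivative]) simp
  moreover have "f differentiable at x" for x
    unfolding Q using flat_exp_derivative real_differentiable_def by blast
  ultimately show "(\<forall>x. f differentiable at x) \<and>
      (\<forall>e\<in>Basis. (\<lambda>x. frechet_derivative f (at x) e) \<in> range flat_exp)" by auto
qed auto

section \<open>A bump function and a smooth step\<close>

lemma smooth_real_antiderivative:
  assumes "\<And>x. (f has_real_derivative f' x) (at x)" "smooth f'"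
  shows "smooth f"
  unfolding smooth_def
proof
  fix k
  have d: "f differentiable at x" for x using assms(1) real_differentiable_def by blast
  have e: "(\<lambda>x. frechet_derivative f (at x) 1) = f'"
    using frechet_derivative_real[OF assms(1)] by auto
  show "k_times_cont_diff k f"
  proof (cases k)
    case 0
    then show ?thesis
      using d by (auto simp: continuous_on_eq_continuous_within differentiable_imp_continuous_within)
  next
    case (Suc m)
    then show ?thesis using d e assms(2) by (auto simp: smooth_def)
  qed
qed

lemma test_functionsI:
  assumes "smooth f" "\<And>x. f x \<noteq> 0 \<Longrightarrow> x \<in> K" "compact K" "K \<subseteq> S"
  shows "f \<in> test_functions S"
proof -
  have "closure {x. f x \<noteq> 0} \<subseteq> K"
    using assms(2,3) by (intro closure_minimal) (auto intro: compact_imp_closed)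
  moreover have "compact (closure {x. f x \<noteq> 0})"
    using compact_Int_closed[OF assms(3) closed_closure] calculation by (metis inf.absorb2 closed_closure)
  ultimately show ?thesis
    using assms by (auto simp: test_functions_def compactly_contained_def smooth_def)
qed

text \<open>The bump lives on a ball of this radius inside the unit cube with corner 0, because Lebesgue points will
be taken along cubes having the point as a corner. The radius is so small that this ball also lies in the unit
ball about 0, which gives the comparison with averages over balls.\<close>
definition bump_rad :: "'a::euclidean_space itself \<Rightarrow> real" where
  "bump_rad _ = 1 / (real DIM('a) + 1)"

definition bump_raw :: "'a::euclidean_space \<Rightarrow> real" where
  "bump_raw y = flat_exp 1 ((bump_rad TYPE('a))\<^sup>2
     - (y - bump_rad TYPE('a) *\<^sub>R One) \<bullet> (y - bump_rad TYPE('a) *\<^sub>R One))"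

definition bump :: "'a::euclidean_space \<Rightarrow> real" where
  "bump y = bump_raw y / (LINT x|lborel. bump_raw (x::'a))"

lemma bump_rad: "0 < bump_rad TYPE('a::euclidean_space)" "2 * bump_rad TYPE('a) \<le> 1"
  using DIM_positive[where 'a='a] by (auto simp: bump_rad_def field_simps Suc_le_eq)

lemma smooth_inner_self: "smooth (\<lambda>y::'a::euclidean_space. y \<bullet> y)"
proof -
  have "smooth (\<lambda>y::'a. \<Sum>b\<in>Basis. (y \<bullet> b) * (y \<bullet> b))"
    by (intro smooth_sum smooth_mult smooth_linear bounded_linear_inner_left)
  then show ?thesis by (simp flip: euclidean_inner)
qed

lemma smooth_bump_raw: "smooth (bump_raw :: 'a::euclidean_space \<Rightarrow> real)"
proof -
  have "smooth (\<lambda>y::'a. (bump_rad TYPE('a))\<^sup>2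
     - (y + - bump_rad TYPE('a) *\<^sub>R One) \<bullet> (y + - bump_rad TYPE('a) *\<^sub>R One))"
    by (intro smooth_diff smooth_const smooth_affine[where f = "\<lambda>y. y \<bullet> y"] smooth_inner_self
        bounded_linear_ident)
  from smooth_compose[OF smooth_flat_exp this, of 1] show ?thesis
    by (simp add: bump_raw_def[abs_def])
qed

lemma bump_raw_nonneg: "0 \<le> bump_raw y"
  by (simp add: bump_raw_def flat_exp_def)

lemma bump_raw_nonzero_iff:
  "bump_raw (y::'a::euclidean_space) \<noteq> 0 \<longleftrightarrow> dist y (bump_rad TYPE('a) *\<^sub>R One) < bump_rad TYPE('a)"
proof -
  have "dist y (bump_rad TYPE('a) *\<^sub>R One) < bump_rad TYPE('a)
     \<longleftrightarrow> (dist y (bump_rad TYPE('a) *\<^sub>R One))\<^sup>2 < (bump_rad TYPE('a))\<^sup>2"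
    using bump_rad(1)[where 'a='a] by (auto intro: power_strict_mono dest: power2_less_imp_less)
  then show ?thesis
    by (auto simp: bump_raw_def flat_exp_def dist_norm power2_norm_eq_inner)
qed

lemma bump_raw_support:
  assumes "bump_raw (y::'a::euclidean_space) \<noteq> 0"
  shows "norm y < 1" "y \<in> box 0 One"
proof -
  define s where "s = bump_rad TYPE('a)"
  have s: "dist y (s *\<^sub>R One) < s" "0 < s" "2 * s \<le> 1"
    using assms bump_rad[where 'a='a] by (auto simp: bump_raw_nonzero_iff s_def)
  have "norm (One::'a) \<le> (\<Sum>b\<in>(Basis::'a set). norm b)" by (rule norm_sum)
  then have "norm (One::'a) \<le> DIM('a)" by simp
  then have "norm y < s + s * DIM('a)"
    using s norm_triangle_sub[of y "s *\<^sub>R One"] mult_left_mono[of "norm (One::'a)" "DIM('a)" s]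
    unfolding dist_norm norm_scaleR by linarith
  also have "\<dots> = 1" by (simp add: s_def bump_rad_def field_simps)
  finally show "norm y < 1" .
  show "y \<in> box 0 One"
    unfolding mem_box
  proof
    fix b :: 'a assume b: "b \<in> Basis"
    have "\<bar>(y - s *\<^sub>R One) \<bullet> b\<bar> < s"
      using s Basis_le_norm[OF b, of "y - s *\<^sub>R One"] by (simp add: dist_norm)
    then show "0 \<bullet> b < y \<bullet> b \<and> y \<bullet> b < One \<bullet> b" using b s by (auto simp: inner_diff_left)
  qed
qed

lemma continuous_bounded_if_supported:
  fixes f :: "'a::euclidean_space \<Rightarrow> real"
  assumes "continuous_on UNIV f" "\<And>y. y \<notin> cball 0 1 \<Longrightarrow> f y = 0"
  obtains C where "0 < C" "\<And>y. \<bar>f y\<bar> \<le> C"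
proof -
  have "compact (f ` cball 0 1)"
    using assms(1) continuous_on_subset by (intro compact_continuous_image) auto
  then obtain C where "0 < C" "\<forall>y\<in>cball 0 1. norm (f y) \<le> C"
    using compact_imp_bounded bounded_pos by (metis (no_types, lifting) imageI)
  then have "\<bar>f y\<bar> \<le> C" for y using assms(2)[of y] by (cases "y \<in> cball 0 1") auto
  then show ?thesis using that \<open>0 < C\<close> by blast
qed

lemma integrable_bump_raw: "integrable lborel (bump_raw :: 'a::euclidean_space \<Rightarrow> real)"
proof -
  have c: "continuous_on UNIV (bump_raw :: 'a \<Rightarrow> real)" using smooth_bump_raw smooth_continuous by blast
  have "set_integrable lborel (cball (0::'a) 1) bump_raw"
    using c continuous_on_subset by (intro borel_integrable_compact[unfolded set_integrable_def[symmetric]]) auto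
  then show ?thesis
    unfolding set_integrable_def
    by (rule back_subst[of "integrable lborel"])
       (use bump_raw_support(1) in \<open>fastforce simp: indicator_def fun_eq_iff\<close>)
qed

lemma integral_bump_raw_pos: "0 < (LINT x|lborel. bump_raw (x::'a::euclidean_space))"
proof -
  have "(LINT x|lborel. bump_raw (x::'a)) \<noteq> 0"
  proof
    assume "(LINT x|lborel. bump_raw (x::'a)) = 0"
    then have "AE x in lborel. bump_raw (x::'a) = 0"
      using integral_nonneg_eq_0_iff_AE[OF integrable_bump_raw] by (auto simp: bump_raw_nonneg)
    then have "AE x in lborel. x \<notin> ball (bump_rad TYPE('a) *\<^sub>R (One::'a)) (bump_rad TYPE('a))"
      by eventually_elim (use bump_raw_nonzero_iff in \<open>auto simp: dist_commute\<close>)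
    then have "ball (bump_rad TYPE('a) *\<^sub>R (One::'a)) (bump_rad TYPE('a)) \<in> null_sets lborel"
      by (subst (asm) AE_iff_null_sets[symmetric]) auto
    then have "measure lborel (ball (bump_rad TYPE('a) *\<^sub>R (One::'a)) (bump_rad TYPE('a))) = 0"
      by (simp add: measure_eq_0_null_sets)
    then show False using content_ball_pos[OF bump_rad(1)[where 'a='a], of "bump_rad TYPE('a) *\<^sub>R (One::'a)"]
      by simp
  qed
  moreover have "0 \<le> (LINT x|lborel. bump_raw (x::'a))" by (simp add: bump_raw_nonneg)
  ultimately show ?thesis by linarith
qed

lemma smooth_bump: "smooth (bump :: 'a::euclidean_space \<Rightarrow> real)"
  unfolding bump_def[abs_def] by (intro smooth_divide smooth_bump_raw)

lemma bump_nonneg: "0 \<le> bump y"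
  by (simp add: bump_def bump_raw_nonneg)

lemma bump_support:
  assumes "bump (y::'a::euclidean_space) \<noteq> 0"
  shows "norm y < 1" "y \<in> box 0 One"
  using assms bump_raw_support[of y] by (auto simp: bump_def)

lemma has_integral_bump: "has_bochner_integral lborel (bump :: 'a::euclidean_space \<Rightarrow> real) 1"
  unfolding bump_def[abs_def]
  using integral_bump_raw_pos[where 'a='a] integrable_bump_raw[where 'a='a]
  by (simp add: has_bochner_integral_iff)

text \<open>Outside the unit ball the nonnegative bump attains its minimum 0.\<close>
lemma bump_derivative_support:
  assumes "1 \<le> norm (y::'a::euclidean_space)"
  shows "frechet_derivative bump (at y) = (\<lambda>v. 0)"
proof (rule has_derivative_local_min)
  show "(bump has_derivative frechet_derivative bump (at y)) (at y)"
    using smooth_differentiable[OF smooth_bump] by (simp add: frechet_derivative_works)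
  show "\<forall>\<^sub>F z in at y. bump y \<le> bump z"
    using assms bump_support(1)[of y] bump_nonneg by (intro always_eventually) force
qed

lemma bump_bounds:
  obtains C where "0 < C" "\<And>y::'a::euclidean_space. bump y \<le> C"
    "\<And>(y::'a) (v::'a). \<bar>frechet_derivative bump (at y) v\<bar> \<le> C * norm v"
proof -
  have "bump y = 0" if "y \<notin> cball 0 1" for y :: 'a
    using that bump_support(1)[of y] by force
  then obtain C0 where C0: "0 < C0" "\<And>y::'a. \<bar>bump y\<bar> \<le> C0"
    by (rule continuous_bounded_if_supported[OF smooth_continuous[OF smooth_bump]]) blast+
  have "\<exists>C>0. \<forall>y::'a. \<bar>frechet_derivative bump (at y) b\<bar> \<le> C" if b: "b \<in> Basis" for b
  proof -
    have "frechet_derivative bump (at y) b = 0" if "y \<notin> cball 0 1" for y :: 'a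
      using that by (simp add: bump_derivative_support)
    then obtain C where "0 < C" "\<And>y::'a. \<bar>frechet_derivative bump (at y) b\<bar> \<le> C"
      by (rule continuous_bounded_if_supported[OF smooth_continuous[OF smooth_partial[OF smooth_bump b]]]) blast+
    then show ?thesis by blast
  qed
  then obtain C1 where C1: "\<And>b. b \<in> Basis \<Longrightarrow> 0 < C1 b"
    "\<And>b y. b \<in> Basis \<Longrightarrow> \<bar>frechet_derivative bump (at (y::'a)) b\<bar> \<le> C1 b" by metis
  have D: "\<bar>frechet_derivative bump (at y) v\<bar> \<le> (\<Sum>b\<in>Basis. C1 b) * norm v" for y v :: 'a
  proof -
    have "\<bar>frechet_derivative bump (at y) v\<bar> = \<bar>\<Sum>b\<in>Basis. (v \<bullet> b) * frechet_derivative bump (at y) b\<bar>"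
      by (subst frechet_derivative_expand[OF smooth_differentiable[OF smooth_bump]]) (rule refl)
    also have "\<dots> \<le> (\<Sum>b\<in>Basis. \<bar>v \<bullet> b\<bar> * \<bar>frechet_derivative bump (at y) b\<bar>)"
      by (rule order_trans[OF sum_abs]) (simp add: abs_mult)
    also have "\<dots> \<le> (\<Sum>b\<in>Basis. norm v * C1 b)"
      using C1(2) by (intro sum_mono mult_mono) (auto simp: Basis_le_norm)
    finally show ?thesis by (simp add: sum_distrib_left mult.commute)
  qed
  have s: "0 \<le> (\<Sum>b\<in>Basis. C1 b)" using C1(1) by (intro sum_nonneg less_imp_le) blast
  show ?thesis
  proof (rule that[of "C0 + (\<Sum>b\<in>Basis. C1 b)"])
    show "0 < C0 + (\<Sum>b\<in>Basis. C1 b)" using C0(1) s by linarith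
    show "bump y \<le> C0 + (\<Sum>b\<in>Basis. C1 b)" for y :: 'a using C0(2)[of y] s by linarith
    show "\<bar>frechet_derivative bump (at y) v\<bar> \<le> (C0 + (\<Sum>b\<in>Basis. C1 b)) * norm v" for y v :: 'a
      using D[of y v] mult_nonneg_nonneg[OF less_imp_le[OF C0(1)] norm_ge_zero[of v]]
      unfolding distrib_right by linarith
  qed
qed

text \<open>The integral starts at \<open>-1\<close> to make 0, where the support of the bump begins, an interior point of the interval in
the fundamental theorem of calculus.\<close>
definition smooth_step :: "real \<Rightarrow> real" where
  "smooth_step \<tau> = integral {-1..\<tau>} bump"

lemma bump_real_zero: "\<tau> \<le> 0 \<or> 1 \<le> \<tau> \<Longrightarrow> bump (\<tau>::real) = 0"
  using bump_support(2)[of \<tau>] by force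

lemma smooth_step_le_0: "\<tau> \<le> 0 \<Longrightarrow> smooth_step \<tau> = 0"
  unfolding smooth_step_def
  by (subst integral_cong[of _ _ "\<lambda>_. 0"]) (auto intro: bump_real_zero)

lemma smooth_step_derivative: "(smooth_step has_real_derivative bump \<tau>) (at \<tau>)"
proof (cases "\<tau> < 0")
  case True
  have "(smooth_step has_real_derivative 0) (at \<tau>)"
    by (rule has_field_derivative_transform_within_open[of "\<lambda>_. 0" _ _ "{..<0}"])
       (use True in \<open>auto simp: smooth_step_le_0\<close>)
  then show ?thesis using True by (simp add: bump_real_zero)
next
  case False
  have "continuous_on {-1..\<tau>+1} (bump :: real \<Rightarrow> real)"
    using smooth_continuous[OF smooth_bump] continuous_on_subset by blast
  then have "(smooth_step has_real_derivative bump \<tau>) (at \<tau> within {-1..\<tau>+1})"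
    unfolding smooth_step_def[abs_def]
    using False by (intro integral_has_real_derivative) auto
  then show ?thesis using False by (subst (asm) at_within_interior) auto
qed

lemma smooth_smooth_step: "smooth smooth_step"
  by (rule smooth_real_antiderivative[OF smooth_step_derivative smooth_bump])

lemma smooth_step_bounds: "0 \<le> smooth_step \<tau>" "smooth_step \<tau> \<le> 1"
  and smooth_step_ge_1: "1 \<le> \<tau> \<Longrightarrow> smooth_step \<tau> = 1"
proof -
  have i: "((bump :: real \<Rightarrow> real) has_integral 1) UNIV"
    using has_integral_integral_lborel[of "bump :: real \<Rightarrow> real"] has_integral_bump[where 'a=real]
    by (simp add: has_bochner_integral_iff)
  have S: "(bump has_integral smooth_step s) {-1..s}" for s
    unfolding smooth_step_def
    by (intro integrable_integral integrable_continuous_real continuous_on_subset[OF smooth_continuous[OF smooth_bump]]) auto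
  show "0 \<le> smooth_step \<tau>" using has_integral_nonneg[OF S] bump_nonneg by blast
  show "smooth_step \<tau> \<le> 1" using has_integral_subset_le[OF _ S i, of \<tau>] bump_nonneg by auto
  show "smooth_step \<tau> = 1" if "1 \<le> \<tau>"
  proof -
    have "((bump :: real \<Rightarrow> real) has_integral smooth_step \<tau>) UNIV"
      by (rule has_integral_on_superset[OF S[of \<tau>]]) (use that in \<open>auto intro: bump_real_zero\<close>)
    then show ?thesis using i has_integral_unique by blast
  qed
qed

section \<open>Kernel averages and their dependence on the scale\<close>

lemma integrable_mult_bounded:
  fixes v :: "'z \<Rightarrow> real"
  assumes "integrable M v" "h \<in> borel_measurable M" "\<And>z. \<bar>h z\<bar> \<le> C"
  shows "integrable M (\<lambda>z. v z * h z)"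
proof (rule Bochner_Integration.integrable_bound)
  show "integrable M (\<lambda>z. C * v z)" using assms(1) by simp
  show "(\<lambda>z. v z * h z) \<in> borel_measurable M" using assms(1,2) by measurable
  have "\<bar>v z * h z\<bar> \<le> \<bar>C * v z\<bar>" for z
    using mult_left_mono[OF order_trans[OF assms(3) abs_ge_self], of "\<bar>v z\<bar>" z]
    by (simp add: abs_mult mult.commute)
  then show "AE z in M. norm (v z * h z) \<le> norm (C * v z)" by simp
qed

text \<open>By the mean value theorem the difference quotients are bounded by \<open>C\<close>, so dominated convergence applies.\<close>
lemma has_derivative_integral_bounded:
  fixes h h' :: "real \<Rightarrow> 'z \<Rightarrow> real"
  assumes v: "integrable M v"
    and hm: "\<And>\<rho>. h \<rho> \<in> borel_measurable M" "h' \<rho>0 \<in> borel_measurable M"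
    and hi: "\<And>\<rho>. l < \<rho> \<Longrightarrow> \<rho> < u \<Longrightarrow> integrable M (\<lambda>z. v z * h \<rho> z)"
    and d: "\<And>\<rho> z. l < \<rho> \<Longrightarrow> \<rho> < u \<Longrightarrow> ((\<lambda>\<rho>. h \<rho> z) has_real_derivative h' \<rho> z) (at \<rho>)"
    and C: "\<And>\<rho> z. l < \<rho> \<Longrightarrow> \<rho> < u \<Longrightarrow> \<bar>h' \<rho> z\<bar> \<le> C"
    and \<rho>0: "l < \<rho>0" "\<rho>0 < u"
  shows "((\<lambda>\<rho>. LINT z|M. v z * h \<rho> z) has_real_derivative (LINT z|M. v z * h' \<rho>0 z)) (at \<rho>0)"
  unfolding DERIV_def tendsto_at_iff_sequentially comp_def
proof (intro allI impI)
  fix X :: "nat \<Rightarrow> real"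
  assume X: "\<forall>i. X i \<in> UNIV - {0}" "X \<longlonglongrightarrow> 0"
  have v_meas[measurable]: "v \<in> borel_measurable M" using v by simp
  note hm[measurable]
  have "(\<lambda>i. \<rho>0 + X i) \<longlonglongrightarrow> \<rho>0 + 0" by (intro tendsto_intros X)
  then have "\<forall>\<^sub>F i in sequentially. \<rho>0 + X i \<in> {l<..<u}"
    by (rule topological_tendstoD) (use \<rho>0 in auto)
  then have "\<exists>N. \<forall>i\<ge>N. l < \<rho>0 + X i \<and> \<rho>0 + X i < u"
    by (simp add: eventually_sequentially)
  then obtain N where N: "\<forall>i\<ge>N. l < \<rho>0 + X i \<and> \<rho>0 + X i < u" ..
  let ?q = "\<lambda>i z. v z * ((h (\<rho>0 + X i) z - h \<rho>0 z) / X i)"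
  have lip: "\<bar>h a z - h b z\<bar> \<le> C * \<bar>a - b\<bar>" if "a \<in> {l<..<u}" "b \<in> {l<..<u}" for a b z
  proof -
    have "norm (h a z - h b z) \<le> C * norm (a - b)"
      by (rule field_differentiable_bound[of "{l<..<u}" "\<lambda>\<rho>. h \<rho> z" "\<lambda>\<rho>. h' \<rho> z"])
         (use that C in \<open>auto intro: has_field_derivative_at_within[OF d]\<close>)
    then show ?thesis by simp
  qed
  have "(\<lambda>i. LINT z|M. ?q (i + N) z) \<longlonglongrightarrow> (LINT z|M. v z * h' \<rho>0 z)"
  proof (rule integral_dominated_convergence)
    show "integrable M (\<lambda>z. \<bar>C\<bar> * \<bar>v z\<bar>)" using v by simp
    show "AE z in M. (\<lambda>i. ?q (i + N) z) \<longlonglongrightarrow> v z * h' \<rho>0 z"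
    proof (intro always_eventually allI)
      fix z
      have "((\<lambda>k. (h (\<rho>0 + k) z - h \<rho>0 z) / k) \<longlongrightarrow> h' \<rho>0 z) (at 0)"
        using d[OF \<rho>0, of z] unfolding DERIV_def .
      then have "(\<lambda>i. (h (\<rho>0 + X i) z - h \<rho>0 z) / X i) \<longlonglongrightarrow> h' \<rho>0 z"
        using X unfolding tendsto_at_iff_sequentially comp_def by blast
      then have "(\<lambda>i. ?q i z) \<longlonglongrightarrow> v z * h' \<rho>0 z" by (intro tendsto_intros)
      then show "(\<lambda>i. ?q (i + N) z) \<longlonglongrightarrow> v z * h' \<rho>0 z" by (rule LIMSEQ_ignore_initial_segment)
    qed
    show "AE z in M. norm (?q (i + N) z) \<le> \<bar>C\<bar> * \<bar>v z\<bar>" for i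
    proof (intro always_eventually allI)
      fix z
      have "X (i + N) \<noteq> 0" using X(1) by auto
      moreover have "\<bar>h (\<rho>0 + X (i + N)) z - h \<rho>0 z\<bar> \<le> C * \<bar>X (i + N)\<bar>"
        using lip[of "\<rho>0 + X (i + N)" \<rho>0 z] N[rule_format, of "i + N"] \<rho>0 by simp
      ultimately have "\<bar>(h (\<rho>0 + X (i + N)) z - h \<rho>0 z) / X (i + N)\<bar> \<le> C"
        by (simp add: divide_le_eq)
      then have "\<bar>v z\<bar> * \<bar>(h (\<rho>0 + X (i + N)) z - h \<rho>0 z) / X (i + N)\<bar> \<le> \<bar>v z\<bar> * \<bar>C\<bar>"
        by (intro mult_left_mono) auto
      then show "norm (?q (i + N) z) \<le> \<bar>C\<bar> * \<bar>v z\<bar>" by (simp add: abs_mult mult.commute)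
    qed
  qed measurable
  moreover have e: "(LINT z|M. ?q (i + N) z)
      = ((LINT z|M. v z * h (\<rho>0 + X (i + N)) z) - (LINT z|M. v z * h \<rho>0 z)) / X (i + N)" for i
    using N[rule_format, of "i + N"] \<rho>0 hi
    by (simp add: right_diff_distrib diff_divide_distrib)
  ultimately have "(\<lambda>i. ((LINT z|M. v z * h (\<rho>0 + X (i + N)) z) - (LINT z|M. v z * h \<rho>0 z)) / X (i + N))
      \<longlonglongrightarrow> (LINT z|M. v z * h' \<rho>0 z)"
    by (simp only: e)
  then show "(\<lambda>i. ((LINT z|M. v z * h (\<rho>0 + X i) z) - (LINT z|M. v z * h \<rho>0 z)) / X i)
      \<longlonglongrightarrow> (LINT z|M. v z * h' \<rho>0 z)"
    by (rule LIMSEQ_offset)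
qed

definition kern :: "'a::euclidean_space \<Rightarrow> real \<Rightarrow> 'a \<Rightarrow> real" where
  "kern x \<rho> y = bump ((1 / \<rho>) *\<^sub>R (y - x)) / \<rho> ^ DIM('a)"

lemma smooth_kern: "smooth (kern x \<rho>)"
proof -
  have "smooth (\<lambda>y. bump ((1 / \<rho>) *\<^sub>R y + (1 / \<rho>) *\<^sub>R (- x)) / \<rho> ^ DIM('a))"
    by (intro smooth_divide smooth_affine smooth_bump bounded_linear_scaleR_right)
  then show ?thesis by (simp add: kern_def[abs_def] scaleR_right_diff_distrib)
qed

lemma kern_nonneg: "0 < \<rho> \<Longrightarrow> 0 \<le> kern x \<rho> y"
  by (simp add: kern_def bump_nonneg)

lemma kern_support:
  assumes "kern x \<rho> (y::'a::euclidean_space) \<noteq> 0" "0 < \<rho>"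
  shows "y \<in> ball x \<rho>" "y \<in> box x (x + \<rho> *\<^sub>R One)"
proof -
  have b: "bump ((1 / \<rho>) *\<^sub>R (y - x)) \<noteq> 0" using assms by (auto simp: kern_def)
  show "y \<in> ball x \<rho>"
    using bump_support(1)[OF b] assms(2) by (simp add: dist_norm norm_minus_commute)
  show "y \<in> box x (x + \<rho> *\<^sub>R One)"
    using bump_support(2)[OF b] assms(2) by (auto simp: mem_box inner_simps field_simps)
qed

lemma kern_derivative:
  assumes "\<rho> \<noteq> 0"
  shows "(kern x \<rho> has_derivative
     (\<lambda>v. frechet_derivative bump (at ((1 / \<rho>) *\<^sub>R (y - x))) v / \<rho> ^ (DIM('a) + 1))) (at (y::'a::euclidean_space))"
proof -
  let ?D = "frechet_derivative bump (at ((1 / \<rho>) *\<^sub>R (y - x)))"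
  have D: "(bump has_derivative ?D) (at ((1 / \<rho>) *\<^sub>R (y - x)))"
    using smooth_differentiable[OF smooth_bump] by (simp add: frechet_derivative_works)
  have "((\<lambda>y. (1 / \<rho>) *\<^sub>R (y - x)) has_derivative (\<lambda>v. (1 / \<rho>) *\<^sub>R v)) (at y)"
    by (auto intro!: derivative_eq_intros)
  from has_derivative_compose[OF this D]
  have "((\<lambda>y. bump ((1 / \<rho>) *\<^sub>R (y - x))) has_derivative (\<lambda>v. ?D ((1 / \<rho>) *\<^sub>R v))) (at y)" .
  then have "((\<lambda>y. bump ((1 / \<rho>) *\<^sub>R (y - x)) / \<rho> ^ DIM('a)) has_derivative
      (\<lambda>v. ?D ((1 / \<rho>) *\<^sub>R v) / \<rho> ^ DIM('a))) (at y)"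
    using assms by (auto intro!: derivative_eq_intros simp: divide_inverse)
  moreover have "?D ((1 / \<rho>) *\<^sub>R v) / \<rho> ^ DIM('a) = ?D v / \<rho> ^ (DIM('a) + 1)" for v
    using linear_cmul[OF has_derivative_linear[OF D], of "1 / \<rho>" v] assms by (simp add: field_simps)
  ultimately show ?thesis by (simp add: kern_def[abs_def])
qed

lemma kern_frechet:
  "\<rho> \<noteq> 0 \<Longrightarrow> frechet_derivative (kern x \<rho>) (at (y::'a::euclidean_space)) v
    = frechet_derivative bump (at ((1 / \<rho>) *\<^sub>R (y - x))) v / \<rho> ^ (DIM('a) + 1)"
  using frechet_derivative_at[OF kern_derivative[of \<rho> x y], symmetric] by simp

lemma kern_test_function:
  assumes "0 < \<rho>" "cball x \<rho> \<subseteq> S" shows "kern x \<rho> \<in> test_functions S"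
proof (rule test_functionsI[OF smooth_kern _ compact_cball assms(2)])
  show "y \<in> cball x \<rho>" if "kern x \<rho> y \<noteq> 0" for y
    using kern_support(1)[OF that assms(1)] by auto
qed

lemma borel_measurable_smooth: "smooth f \<Longrightarrow> f \<in> borel_measurable borel"
  by (simp add: borel_measurable_continuous_onI smooth_continuous)

lemma borel_measurable_kern [measurable]: "kern x \<rho> \<in> borel_measurable borel"
  by (rule borel_measurable_smooth[OF smooth_kern])

lemma nn_integral_kern:
  assumes "0 < \<rho>"
  shows "(\<integral>\<^sup>+y. ennreal (kern x \<rho> (y::'a::euclidean_space)) \<partial>lborel) = 1"
proof -
  have [measurable]: "(bump :: 'a \<Rightarrow> real) \<in> borel_measurable borel"
    by (rule borel_measurable_smooth[OF smooth_bump])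
  have 1: "(\<integral>\<^sup>+y. ennreal (bump (y::'a)) \<partial>lborel) = 1"
    using has_integral_bump[where 'a='a] nn_integral_eq_integral[of lborel "bump :: 'a \<Rightarrow> real"]
    by (simp add: has_bochner_integral_iff bump_nonneg)
  have "(\<integral>\<^sup>+y. ennreal (kern x \<rho> y) \<partial>lborel)
      = (\<integral>\<^sup>+y. ennreal (\<bar>\<rho>\<bar> ^ DIM('a)) * ennreal (kern x \<rho> (x + \<rho> *\<^sub>R y)) \<partial>lborel)"
    using assms by (subst lborel_affine[of \<rho> x]) (simp_all add: nn_integral_density nn_integral_distr)
  also have "\<dots> = (\<integral>\<^sup>+y. ennreal (bump (y::'a)) \<partial>lborel)"
    using assms by (intro nn_integral_cong) (simp add: kern_def bump_nonneg flip: ennreal_mult)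
  finally show ?thesis using 1 by simp
qed

lemma borel_measurable_lebesgueI: "f \<in> borel_measurable borel \<Longrightarrow> f \<in> borel_measurable lebesgue"
  by (simp add: measurable_completion)

lemma has_integral_kern_product:
  fixes x :: "'a::euclidean_space" and t :: real
  assumes "0 < \<rho>" "0 < \<delta>"
  shows "has_bochner_integral lebesgue (\<lambda>z. kern x \<rho> (fst z) * kern t \<delta> (snd z)) 1"
proof (rule has_bochner_integral_nn_integral)
  have m[measurable]: "(\<lambda>z. kern x \<rho> (fst z) * kern t \<delta> (snd z)) \<in> borel_measurable (lborel \<Otimes>\<^sub>M lborel)"
    by measurable
  then show "(\<lambda>z. kern x \<rho> (fst z) * kern t \<delta> (snd z)) \<in> borel_measurable lebesgue"
    by (simp add: lborel_prod borel_measurable_lebesgueI)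
  show "AE z in lebesgue. 0 \<le> kern x \<rho> (fst z) * kern t \<delta> (snd z)"
    using assms by (simp add: kern_nonneg)
  have "(\<integral>\<^sup>+z. ennreal (kern x \<rho> (fst z) * kern t \<delta> (snd z)) \<partial>lebesgue)
      = (\<integral>\<^sup>+z. ennreal (kern x \<rho> (fst z) * kern t \<delta> (snd z)) \<partial>(lborel \<Otimes>\<^sub>M lborel))"
    by (simp add: nn_integral_completion lborel_prod)
  also have "\<dots> = (\<integral>\<^sup>+y. \<integral>\<^sup>+\<tau>. ennreal (kern x \<rho> y) * ennreal (kern t \<delta> \<tau>) \<partial>lborel \<partial>lborel)"
    using assms by (subst lborel.nn_integral_fst[symmetric]) (simp_all add: ennreal_mult kern_nonneg)
  also have "\<dots> = 1" using assms by (simp add: nn_integral_cmult nn_integral_kern)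
  finally show "(\<integral>\<^sup>+z. ennreal (kern x \<rho> (fst z) * kern t \<delta> (snd z)) \<partial>lebesgue) = ennreal 1" by simp
qed simp

lemma kern_le:
  assumes "0 < \<rho>" "\<And>y::'a::euclidean_space. bump y \<le> C" "0 < C"
  shows "kern x \<rho> (y::'a) \<le> C / \<rho> ^ DIM('a) * indicator (ball x \<rho>) y"
proof (cases "kern x \<rho> y = 0")
  case True
  then show ?thesis using assms by simp
next
  case False
  then show ?thesis
    using kern_support(1)[OF False assms(1)] assms by (simp add: kern_def divide_right_mono)
qed

lemma kern_scale_derivative:
  fixes x y :: "'a::euclidean_space"
  assumes "0 < \<rho>"
  defines "w \<equiv> (1 / \<rho>) *\<^sub>R (y - x)"
  shows "((\<lambda>\<rho>. kern x \<rho> y) has_real_derivative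
     - ((frechet_derivative bump (at w) w + DIM('a) * bump w) / \<rho> ^ (DIM('a) + 1))) (at \<rho>)"
proof -
  let ?D = "frechet_derivative bump (at w)"
  have D: "(bump has_derivative ?D) (at w)"
    using smooth_differentiable[OF smooth_bump] by (simp add: frechet_derivative_works)
  have "((\<lambda>\<rho>. (1 / \<rho>) *\<^sub>R (y - x)) has_derivative (\<lambda>h. (- h / \<rho>) *\<^sub>R w)) (at \<rho>)"
    using assms(1) by (auto intro!: derivative_eq_intros simp: w_def field_simps)
  from has_derivative_compose[OF this D[unfolded w_def]]
  have "((\<lambda>\<rho>. bump ((1 / \<rho>) *\<^sub>R (y - x))) has_derivative (\<lambda>h. ?D ((- h / \<rho>) *\<^sub>R w))) (at \<rho>)"
    by (simp add: w_def)
  moreover have "(\<lambda>h. ?D ((- h / \<rho>) *\<^sub>R w)) = (*) (- ?D w / \<rho>)"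
  proof
    show "?D ((- h / \<rho>) *\<^sub>R w) = (- ?D w / \<rho>) * h" for h
      unfolding linear_cmul[OF has_derivative_linear[OF D]] by simp
  qed
  ultimately have "((\<lambda>\<rho>. bump ((1 / \<rho>) *\<^sub>R (y - x))) has_real_derivative - ?D w / \<rho>) (at \<rho>)"
    by (simp add: has_field_derivative_def)
  then have "((\<lambda>\<rho>. bump ((1 / \<rho>) *\<^sub>R (y - x)) / \<rho> ^ DIM('a)) has_real_derivative
      (- ?D w / \<rho> * \<rho> ^ DIM('a) - bump w * (DIM('a) * \<rho> ^ (DIM('a) - 1))) / (\<rho> ^ DIM('a) * \<rho> ^ DIM('a))) (at \<rho>)"
    using assms(1) by (auto intro!: derivative_eq_intros simp: w_def)
  moreover have "(- ?D w / \<rho> * \<rho> ^ DIM('a) - bump w * (DIM('a) * \<rho> ^ (DIM('a) - 1))) / (\<rho> ^ DIM('a) * \<rho> ^ DIM('a))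
      = - ((?D w + DIM('a) * bump w) / \<rho> ^ (DIM('a) + 1))"
  proof -
    obtain m where m: "DIM('a) = Suc m" using DIM_positive[where 'a='a] gr0_conv_Suc by blast
    show ?thesis using assms(1) unfolding m by (simp add: field_simps)
  qed
  ultimately show ?thesis by (simp add: kern_def[abs_def])
qed

text \<open>The component in direction \<open>b\<close> of the vector field whose divergence is minus the derivative of
\<open>kern x \<rho>\<close> with respect to \<open>\<rho>\<close>.\<close>
definition kern_field :: "'a::euclidean_space \<Rightarrow> real \<Rightarrow> 'a \<Rightarrow> 'a \<Rightarrow> real" where
  "kern_field x \<rho> b y = ((y - x) \<bullet> b / \<rho>) * kern x \<rho> y"

lemma smooth_coordinate: "smooth (\<lambda>y::'a::euclidean_space. (y - x) \<bullet> b / \<rho>)"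
proof -
  have "smooth (\<lambda>y. (y + (- x)) \<bullet> b / \<rho>)"
    by (intro smooth_divide smooth_affine[where f = "\<lambda>y. y \<bullet> b"] smooth_linear
        bounded_linear_inner_left bounded_linear_ident)
  then show ?thesis by simp
qed

lemma smooth_kern_field: "smooth (kern_field x \<rho> b)"
  unfolding kern_field_def[abs_def] by (intro smooth_mult smooth_coordinate smooth_kern)

lemma kern_field_test_function:
  assumes "0 < \<rho>" "cball x \<rho> \<subseteq> S" shows "kern_field x \<rho> b \<in> test_functions S"
proof (rule test_functionsI[OF smooth_kern_field _ compact_cball assms(2)])
  show "y \<in> cball x \<rho>" if "kern_field x \<rho> b y \<noteq> 0" for y
    using kern_support(1)[of x \<rho> y] that assms(1) by (auto simp: kern_field_def)
qed

text \<open>Together with \<open>kern_scale_derivative\<close> this exhibits the derivative in the scale as a divergence; it reflects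
that the kernels all have the same integral.\<close>
lemma kern_scale_divergence:
  fixes x y :: "'a::euclidean_space"
  assumes "0 < \<rho>"
  defines "w \<equiv> (1 / \<rho>) *\<^sub>R (y - x)"
  shows "(\<Sum>b\<in>Basis. frechet_derivative (kern_field x \<rho> b) (at y) b)
    = (frechet_derivative bump (at w) w + DIM('a) * bump w) / \<rho> ^ (DIM('a) + 1)"
proof -
  let ?D = "frechet_derivative bump (at w)"
  have c: "frechet_derivative (\<lambda>y. (y - x) \<bullet> b / \<rho>) (at y) b = 1 / \<rho>" if "b \<in> Basis" for b
  proof -
    have "((\<lambda>y. (y - x) \<bullet> b / \<rho>) has_derivative (\<lambda>v. v \<bullet> b / \<rho>)) (at y)"
      using assms(1) by (auto intro!: derivative_eq_intros simp: divide_inverse)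
    from frechet_derivative_at[OF this, symmetric] show ?thesis using that by simp
  qed
  have "frechet_derivative (kern_field x \<rho> b) (at y) b
      = ((w \<bullet> b) * ?D b + bump w) / \<rho> ^ (DIM('a) + 1)" if b: "b \<in> Basis" for b
  proof -
    have "frechet_derivative (kern_field x \<rho> b) (at y) b
      = ((y - x) \<bullet> b / \<rho>) * frechet_derivative (kern x \<rho>) (at y) b + 1 / \<rho> * kern x \<rho> y"
      unfolding kern_field_def[abs_def]
      by (subst frechet_derivative_mult_real)
         (auto simp: c[OF b] intro: smooth_differentiable smooth_kern smooth_coordinate)
    also have "\<dots> = ((w \<bullet> b) * ?D b + bump w) / \<rho> ^ (DIM('a) + 1)"
    proof -
      have "(y - x) \<bullet> b / \<rho> = w \<bullet> b" by (simp add: w_def)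
      moreover have "frechet_derivative (kern x \<rho>) (at y) b = ?D b / \<rho> ^ (DIM('a) + 1)"
        using assms(1) by (subst kern_frechet) (simp_all add: w_def)
      moreover have "kern x \<rho> y = bump w / \<rho> ^ DIM('a)" by (simp add: w_def kern_def)
      ultimately show ?thesis using assms(1) by (simp add: add_divide_distrib)
    qed
    finally show ?thesis .
  qed
  then have "(\<Sum>b\<in>Basis. frechet_derivative (kern_field x \<rho> b) (at y) b)
      = ((\<Sum>b\<in>Basis. (w \<bullet> b) * ?D b) + DIM('a) * bump w) / \<rho> ^ (DIM('a) + 1)"
    by (simp add: sum.distrib flip: sum_divide_distrib)
  then show ?thesis
    using frechet_derivative_expand[OF smooth_differentiable[OF smooth_bump], of w w] by simp
qed

lemma borel_fst: "f \<in> borel_measurable borel \<Longrightarrow> (\<lambda>z. f (fst z)) \<in> borel_measurable lebesgue"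
  and borel_snd: "g \<in> borel_measurable borel \<Longrightarrow> (\<lambda>z. g (snd z)) \<in> borel_measurable lebesgue"
  for f :: "'a::euclidean_space \<Rightarrow> real" and g :: "real \<Rightarrow> real"
  by (rule borel_measurable_lebesgueI, rule measurable_compose[rotated], assumption,
      rule borel_measurable_continuous_onI, intro continuous_intros)+

text \<open>The derivative of the average with respect to the scale is the average of \<open>v\<close> against a divergence, hence,
by the definition of the weak gradient, an average of \<open>V\<close> against \<open>kern_field\<close>. The latter is at most the
kernel itself in size, so the derivative is bounded by \<open>C * M\<close>.\<close>
lemma kernel_average_scale_change:
  fixes v :: "'a::euclidean_space \<times> real \<Rightarrow> real" and V :: "'a \<times> real \<Rightarrow> 'a"
  assumes v: "integrable lebesgue v" and V: "integrable lebesgue V"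
    and weak: "\<And>\<eta> b. \<eta> \<in> test_functions B \<Longrightarrow> b \<in> Basis \<Longrightarrow>
      (LINT z|lebesgue. v z * (frechet_derivative \<eta> (at (fst z)) b * \<theta> (snd z)))
        = - (LINT z|lebesgue. (V z \<bullet> b) * (\<eta> (fst z) * \<theta> (snd z)))"
    and \<theta>: "\<theta> \<in> borel_measurable borel" "\<And>\<tau>. \<bar>\<theta> \<tau>\<bar> \<le> c"
    and ball: "cball x R \<subseteq> B" "0 < r" "r \<le> R"
    and C: "\<And>y::'a. bump y \<le> C" "0 < C" "\<And>(y::'a) (v::'a). \<bar>frechet_derivative bump (at y) v\<bar> \<le> C * norm v"
    and M: "\<And>\<rho>. r \<le> \<rho> \<Longrightarrow> \<rho> \<le> R \<Longrightarrow>
      (LINT z|lebesgue. norm (V z) * (indicator (ball x \<rho>) (fst z) * \<bar>\<theta> (snd z)\<bar>)) \<le> M * \<rho> ^ DIM('a)"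
  shows "\<bar>(LINT z|lebesgue. v z * (kern x R (fst z) * \<theta> (snd z)))
      - (LINT z|lebesgue. v z * (kern x r (fst z) * \<theta> (snd z)))\<bar> \<le> C * M * (R - r)"
proof -
  let ?n = "DIM('a)"
  define k' where "k' \<rho> y = - (\<Sum>b\<in>Basis. frechet_derivative (kern_field x \<rho> b) (at y) b)" for \<rho> y
  have k'_smooth: "smooth (k' \<rho>)" for \<rho>
  proof -
    have "smooth (\<lambda>y. (-1) * (\<Sum>b\<in>Basis. frechet_derivative (kern_field x \<rho> b) (at y) b))"
      by (intro smooth_mult smooth_const smooth_sum smooth_partial smooth_kern_field)
    then show ?thesis by (simp add: k'_def[abs_def])
  qed
  have k'_le: "\<bar>k' \<rho> y\<bar> \<le> (C + ?n * C) / l ^ (?n + 1)" if "0 < l" "l < \<rho>" for l \<rho> y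
  proof -
    let ?w = "(1 / \<rho>) *\<^sub>R (y - x)"
    have "\<bar>frechet_derivative bump (at ?w) ?w\<bar> \<le> C"
    proof (cases "norm ?w < 1")
      case True
      then show ?thesis using C(3)[of ?w ?w] C(2) mult_left_mono[of "norm ?w" 1 C] by linarith
    next
      case False
      then have "frechet_derivative bump (at ?w) = (\<lambda>v. 0)"
        by (intro bump_derivative_support) simp
      then show ?thesis using C(2) by simp
    qed
    moreover have "\<bar>bump ?w\<bar> \<le> C" using C(1)[of ?w] bump_nonneg[of ?w] by simp
    ultimately have "\<bar>frechet_derivative bump (at ?w) ?w + ?n * bump ?w\<bar> \<le> C + ?n * C"
      by (intro order_trans[OF abs_triangle_ineq] add_mono) (auto simp: abs_mult intro: mult_left_mono)
    then have "\<bar>k' \<rho> y\<bar> \<le> (C + ?n * C) / \<rho> ^ (?n + 1)"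
      using that kern_scale_divergence[of \<rho> x y] by (simp add: k'_def divide_right_mono)
    also have "\<dots> \<le> (C + ?n * C) / l ^ (?n + 1)"
      using that C(2) by (intro divide_left_mono power_mono) auto
    finally show ?thesis .
  qed
  have int_h: "integrable lebesgue (\<lambda>z. u z * (f (fst z) * \<theta> (snd z)))"
    if "integrable lebesgue u" "smooth f" "\<And>y. \<bar>f y\<bar> \<le> D" for u :: "'a \<times> real \<Rightarrow> real" and f D
  proof (rule integrable_mult_bounded[OF that(1)])
    show "(\<lambda>z. f (fst z) * \<theta> (snd z)) \<in> borel_measurable lebesgue"
      using borel_fst[OF borel_measurable_smooth[OF that(2)]] borel_snd[OF \<theta>(1)] by measurable
    show "\<bar>f (fst z) * \<theta> (snd z)\<bar> \<le> D * c" for z :: "'a \<times> real"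
      unfolding abs_mult using that(3) \<theta>(2) by (intro mult_mono) (auto intro: order_trans[OF abs_ge_zero])
  qed
  have k_bd: "\<bar>kern x \<rho> y\<bar> \<le> C / \<rho> ^ ?n" if "0 < \<rho>" for \<rho> y
    using that kern_le[OF that C(1,2), of x y] kern_nonneg[OF that, of x y] C(2)
    by (cases "y \<in> ball x \<rho>") auto
  define F where "F \<rho> = (LINT z|lebesgue. v z * (kern x \<rho> (fst z) * \<theta> (snd z)))" for \<rho>
  define F' where "F' \<rho> = (LINT z|lebesgue. v z * (k' \<rho> (fst z) * \<theta> (snd z)))" for \<rho>
  \<comment> \<open>Scales near \<open>\<rho>\<close> stay above \<open>\<rho> / 2\<close>, so the derivative of the kernel in the scale is uniformly bounded there.\<close>
  have dF: "(F has_real_derivative F' \<rho>) (at \<rho>)" if "0 < \<rho>" for \<rho>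
    unfolding F_def[abs_def] F'_def
  proof (rule has_derivative_integral_bounded[OF v, where l = "\<rho> / 2" and u = "2 * \<rho>"
        and h' = "\<lambda>\<rho> z. k' \<rho> (fst z) * \<theta> (snd z)" and C = "(C + ?n * C) / (\<rho> / 2) ^ (?n + 1) * c"])
    show "(\<lambda>z. kern x \<rho>' (fst z) * \<theta> (snd z)) \<in> borel_measurable lebesgue" for \<rho>'
      using borel_fst[OF borel_measurable_smooth[OF smooth_kern]] borel_snd[OF \<theta>(1)] by measurable
    show "(\<lambda>z. k' \<rho> (fst z) * \<theta> (snd z)) \<in> borel_measurable lebesgue"
      using borel_fst[OF borel_measurable_smooth[OF k'_smooth]] borel_snd[OF \<theta>(1)] by measurable
    show "integrable lebesgue (\<lambda>z. v z * (kern x \<rho>' (fst z) * \<theta> (snd z)))" if "\<rho> / 2 < \<rho>'" for \<rho>'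
      using \<open>0 < \<rho>\<close> that by (intro int_h[OF v smooth_kern, of _ _ "C / \<rho>' ^ ?n"] k_bd) auto
    show "((\<lambda>\<rho>. kern x \<rho> (fst z) * \<theta> (snd z)) has_real_derivative k' \<rho>' (fst z) * \<theta> (snd z)) (at \<rho>')"
      if "\<rho> / 2 < \<rho>'" for \<rho>' z
    proof -
      have "0 < \<rho>'" using that \<open>0 < \<rho>\<close> by simp
      then show ?thesis
        unfolding k'_def kern_scale_divergence[OF \<open>0 < \<rho>'\<close>]
        by (intro DERIV_cmult_right kern_scale_derivative)
    qed
    show "\<bar>k' \<rho>' (fst z) * \<theta> (snd z)\<bar> \<le> (C + ?n * C) / (\<rho> / 2) ^ (?n + 1) * c"
      if "\<rho> / 2 < \<rho>'" for \<rho>' and z :: "'a \<times> real"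
      unfolding abs_mult using k'_le[of "\<rho> / 2" \<rho>' "fst z"] that \<theta>(2) \<open>0 < \<rho>\<close>
      by (intro mult_mono) (auto intro: order_trans[OF abs_ge_zero])
  qed (use that in auto)
  have F'_le: "\<bar>F' \<rho>\<bar> \<le> C * M" if \<rho>: "r \<le> \<rho>" "\<rho> \<le> R" for \<rho>
  proof -
    have pos: "0 < \<rho>" using \<rho> ball by simp
    have sub: "cball x \<rho> \<subseteq> B" using \<rho> ball by force
    let ?G = "\<lambda>z. \<Sum>b\<in>Basis. (V z \<bullet> b) * (kern_field x \<rho> b (fst z) * \<theta> (snd z))"
    have kf_bd: "\<bar>kern_field x \<rho> b y\<bar> \<le> C / \<rho> ^ ?n" if "b \<in> Basis" for b y
    proof (cases "kern x \<rho> y = 0")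
      case False
      then have "\<bar>(y - x) \<bullet> b\<bar> \<le> \<rho>"
        using kern_support(1)[OF False pos] Basis_le_norm[OF that, of "y - x"]
        by (simp add: dist_norm norm_minus_commute)
      then have "\<bar>(y - x) \<bullet> b / \<rho>\<bar> \<le> 1" using pos by (simp add: divide_le_eq)
      then have "\<bar>(y - x) \<bullet> b / \<rho>\<bar> * \<bar>kern x \<rho> y\<bar> \<le> 1 * (C / \<rho> ^ ?n)"
        using k_bd[OF pos, of y] by (intro mult_mono) auto
      then show ?thesis unfolding kern_field_def abs_mult by simp
    qed (use pos C in \<open>simp add: kern_field_def\<close>)
    have iD: "integrable lebesgue (\<lambda>z. v z * (frechet_derivative (kern_field x \<rho> b) (at (fst z)) b * \<theta> (snd z)))"
      if b: "b \<in> Basis" for b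
    proof -
      have "frechet_derivative (kern_field x \<rho> b) (at y) b = 0" if "y \<notin> cball x \<rho>" for y
      proof -
        have "((\<lambda>_. 0) has_derivative (\<lambda>_. 0)) (at y)" by simp
        then have "(kern_field x \<rho> b has_derivative (\<lambda>_. 0)) (at y)"
        proof (rule has_derivative_transform_within_open[of _ _ _ _ "- cball x \<rho>"])
          show "0 = kern_field x \<rho> b y'" if "y' \<in> - cball x \<rho>" for y'
            using kern_support(1)[of x \<rho> y'] pos that by (auto simp: kern_field_def)
        qed (use that in auto)
        from frechet_derivative_at[OF this, symmetric] show ?thesis by simp
      qed
      moreover have "compact ((\<lambda>y. frechet_derivative (kern_field x \<rho> b) (at y) b) ` cball x \<rho>)"
        by (intro compact_continuous_image continuous_on_subset[OF smooth_continuous[OF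
              smooth_partial[OF smooth_kern_field b]]]) auto
      then obtain D where D: "0 < D" "\<forall>y\<in>(\<lambda>y. frechet_derivative (kern_field x \<rho> b) (at y) b) ` cball x \<rho>. norm y \<le> D"
        using compact_imp_bounded bounded_pos by blast
      ultimately have "\<bar>frechet_derivative (kern_field x \<rho> b) (at y) b\<bar> \<le> D" for y
        by (cases "y \<in> cball x \<rho>") auto
      then show ?thesis by (rule int_h[OF v smooth_partial[OF smooth_kern_field b]])
    qed
    have iV: "integrable lebesgue (\<lambda>z. (V z \<bullet> b) * (kern_field x \<rho> b (fst z) * \<theta> (snd z)))"
      if b: "b \<in> Basis" for b
      by (rule int_h[OF _ smooth_kern_field kf_bd[OF b]]) (use V in simp)
    have "F' \<rho> = (LINT z|lebesgue. - (\<Sum>b\<in>Basis. v z * (frechet_derivative (kern_field x \<rho> b) (at (fst z)) b * \<theta> (snd z))))"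
      unfolding F'_def k'_def
      by (intro Bochner_Integration.integral_cong refl) (simp add: sum_distrib_left sum_distrib_right)
    also have "\<dots> = - (\<Sum>b\<in>Basis. LINT z|lebesgue. v z * (frechet_derivative (kern_field x \<rho> b) (at (fst z)) b * \<theta> (snd z)))"
      using iD by simp
    also have "\<dots> = (\<Sum>b\<in>Basis. LINT z|lebesgue. (V z \<bullet> b) * (kern_field x \<rho> b (fst z) * \<theta> (snd z)))"
      using weak[OF kern_field_test_function[OF pos sub]] by (simp add: sum_negf)
    also have "\<dots> = (LINT z|lebesgue. ?G z)"
      using iV by simp
    finally have F'_eq: "F' \<rho> = (LINT z|lebesgue. ?G z)" .
    have "\<bar>F' \<rho>\<bar> \<le> (LINT z|lebesgue. C / \<rho> ^ ?n * (norm (V z) * (indicator (ball x \<rho>) (fst z) * \<bar>\<theta> (snd z)\<bar>)))"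
      unfolding F'_eq
    proof (rule order_trans[OF integral_abs_bound], rule integral_mono)
      show "integrable lebesgue (\<lambda>z. \<bar>?G z\<bar>)" using iV by auto
      have "integrable lebesgue (\<lambda>z. norm (V z) * (indicator (ball x \<rho>) (fst z) * \<bar>\<theta> (snd z)\<bar>))"
      proof (rule integrable_mult_bounded[where C = c])
        have "(indicator (ball x \<rho>) :: 'a \<Rightarrow> real) \<in> borel_measurable borel"
          by (intro borel_measurable_indicator borel_open open_ball)
        from borel_fst[OF this] show "(\<lambda>z. indicator (ball x \<rho>) (fst z) * \<bar>\<theta> (snd z)\<bar>) \<in> borel_measurable lebesgue"
          using borel_snd[OF \<theta>(1)] by measurable
        show "\<bar>indicator (ball x \<rho>) (fst z) * \<bar>\<theta> (snd z)\<bar>\<bar> \<le> c" for z :: "'a \<times> real"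
          using \<theta>(2)[of "snd z"] by (auto simp: indicator_def intro: order_trans[OF abs_ge_zero])
      qed (use V in simp)
      then show "integrable lebesgue (\<lambda>z. C / \<rho> ^ ?n * (norm (V z) * (indicator (ball x \<rho>) (fst z) * \<bar>\<theta> (snd z)\<bar>)))"
        by simp
      show "\<bar>?G z\<bar> \<le> C / \<rho> ^ ?n * (norm (V z) * (indicator (ball x \<rho>) (fst z) * \<bar>\<theta> (snd z)\<bar>))" for z
      proof -
        have "?G z = (V z \<bullet> ((1 / \<rho>) *\<^sub>R (fst z - x))) * kern x \<rho> (fst z) * \<theta> (snd z)"
          by (subst (2) euclidean_inner) (simp add: kern_field_def sum_distrib_right sum_distrib_left mult_ac)
        then have "\<bar>?G z\<bar> \<le> norm (V z) * norm ((1 / \<rho>) *\<^sub>R (fst z - x)) * \<bar>kern x \<rho> (fst z)\<bar> * \<bar>\<theta> (snd z)\<bar>"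
          by (simp add: abs_mult mult_right_mono Cauchy_Schwarz_ineq2 del: norm_scaleR inner_scaleR_right)
        also have "\<dots> \<le> norm (V z) * (C / \<rho> ^ ?n * indicator (ball x \<rho>) (fst z)) * \<bar>\<theta> (snd z)\<bar>"
        proof (cases "kern x \<rho> (fst z) = 0")
          case False
          have "norm ((1 / \<rho>) *\<^sub>R (fst z - x)) \<le> 1"
            using kern_support(1)[OF False pos] pos by (simp add: dist_norm norm_minus_commute divide_le_eq)
          moreover have "\<bar>kern x \<rho> (fst z)\<bar> \<le> C / \<rho> ^ ?n * indicator (ball x \<rho>) (fst z)"
            using kern_le[OF pos C(1,2), of x "fst z"] kern_nonneg[OF pos, of x "fst z"] by simp
          ultimately have "norm ((1 / \<rho>) *\<^sub>R (fst z - x)) * \<bar>kern x \<rho> (fst z)\<bar>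
              \<le> 1 * (C / \<rho> ^ ?n * indicator (ball x \<rho>) (fst z))"
            by (intro mult_mono) auto
          then show ?thesis
            unfolding mult.assoc[of "norm (V z)"] by (intro mult_right_mono mult_left_mono) auto
        qed (use C pos in \<open>simp add: zero_le_mult_iff\<close>)
        finally show ?thesis by (simp add: mult_ac)
      qed
    qed
    also have "\<dots> = C / \<rho> ^ ?n * (LINT z|lebesgue. norm (V z) * (indicator (ball x \<rho>) (fst z) * \<bar>\<theta> (snd z)\<bar>))"
      by (rule integral_mult_right_zero)
    also have "\<dots> \<le> C / \<rho> ^ ?n * (M * \<rho> ^ ?n)"
      using M[OF \<rho>] C pos by (intro mult_left_mono) auto
    also have "\<dots> = C * M" using pos by simp
    finally show ?thesis .
  qed
  have "norm (F R - F r) \<le> C * M * norm (R - r)"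
    by (rule field_differentiable_bound[of "{r..R}" F F'])
       (use ball F'_le in \<open>auto intro: has_field_derivative_at_within[OF dF]\<close>)
  then show ?thesis using ball by (simp add: F_def)
qed

section \<open>Kernel averages and the equation; Lebesgue points\<close>

lemma integrable_flux_pairing:
  fixes G :: "'a::euclidean_space \<times> real \<Rightarrow> 'a"
  assumes "integrable lebesgue G" "A \<in> sets lebesgue"
  shows "integrable lebesgue (\<lambda>z. norm (G z) * indicator A z)"
  by (rule integrable_mult_bounded[where C = 1])
     (use assms in \<open>auto simp: indicator_def intro: borel_measurable_indicator\<close>)

text \<open>The difference of the two time kernels is the derivative of a difference of smooth steps, which is between 0 and 1
and supported in \<open>[s, t + \<delta>]\<close>. Testing the equation with it turns the difference of averages into an
integral of the flux \<open>G\<close> against the gradient of the space kernel.\<close>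
lemma kernel_average_time_change:
  fixes v :: "'a::euclidean_space \<times> real \<Rightarrow> real" and G :: "'a \<times> real \<Rightarrow> 'a"
  assumes G: "integrable lebesgue G"
    and eq: "\<And>\<eta> \<zeta>. \<eta> \<in> test_functions B \<Longrightarrow> \<zeta> \<in> test_functions J \<Longrightarrow>
      (LINT z|lebesgue. v z * (\<eta> (fst z) * frechet_derivative \<zeta> (at (snd z)) 1))
        = (LINT z|lebesgue. frechet_derivative \<eta> (at (fst z)) (G z) * \<zeta> (snd z))"
    and st: "s < t" "0 < \<delta>" "{s..t + \<delta>} \<subseteq> J"
    and ball: "0 < \<rho>" "cball x \<rho> \<subseteq> B"
    and C: "0 < C" "\<And>(y::'a) (v::'a). \<bar>frechet_derivative bump (at y) v\<bar> \<le> C * norm v"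
  shows "\<bar>LINT z|lebesgue. v z * (kern x \<rho> (fst z) * (kern s \<delta> (snd z) - kern t \<delta> (snd z)))\<bar>
    \<le> C / \<rho> ^ (DIM('a) + 1) * (LINT z|lebesgue. norm (G z) * indicator (ball x \<rho> \<times> {s<..<t + \<delta>}) z)"
proof -
  define \<zeta> where "\<zeta> \<tau> = smooth_step ((1 / \<delta>) *\<^sub>R \<tau> + (1 / \<delta>) *\<^sub>R (- s))
      - smooth_step ((1 / \<delta>) *\<^sub>R \<tau> + (1 / \<delta>) *\<^sub>R (- t))" for \<tau>
  have \<zeta>_smooth: "smooth \<zeta>"
    unfolding \<zeta>_def[abs_def]
    by (intro smooth_diff smooth_affine smooth_smooth_step bounded_linear_scaleR_right)
  have \<zeta>_eq: "\<zeta> \<tau> = smooth_step ((\<tau> - s) / \<delta>) - smooth_step ((\<tau> - t) / \<delta>)" for \<tau>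
    by (simp add: \<zeta>_def diff_divide_distrib)
  have \<zeta>_deriv: "(\<zeta> has_real_derivative kern s \<delta> \<tau> - kern t \<delta> \<tau>) (at \<tau>)" for \<tau>
    unfolding \<zeta>_eq[abs_def] kern_def using st
    by (auto intro!: derivative_eq_intros smooth_step_derivative[THEN DERIV_chain2])
  have \<zeta>_frechet: "frechet_derivative \<zeta> (at \<tau>) 1 = kern s \<delta> \<tau> - kern t \<delta> \<tau>" for \<tau>
    using frechet_derivative_real[OF \<zeta>_deriv, of \<tau> 1] by simp
  have \<zeta>_zero: "\<zeta> \<tau> = 0" if "\<tau> \<notin> {s<..<t + \<delta>}" for \<tau>
  proof (cases "\<tau> \<le> s")
    case True
    then show ?thesis using st by (simp add: \<zeta>_eq smooth_step_le_0 divide_le_0_iff)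
  next
    case False
    then have "1 \<le> (\<tau> - t) / \<delta>" "1 \<le> (\<tau> - s) / \<delta>" using that st by (auto simp: le_divide_eq)
    then show ?thesis by (simp add: \<zeta>_eq smooth_step_ge_1)
  qed
  have \<zeta>_le: "\<bar>\<zeta> \<tau>\<bar> \<le> indicator {s<..<t + \<delta>} \<tau>" for \<tau>
    using \<zeta>_zero[of \<tau>] smooth_step_bounds[of "(\<tau> - s) / \<delta>"] smooth_step_bounds[of "(\<tau> - t) / \<delta>"]
    by (cases "\<tau> \<in> {s<..<t + \<delta>}") (auto simp: \<zeta>_eq)
  have \<zeta>_test: "\<zeta> \<in> test_functions J"
  proof (rule test_functionsI[OF \<zeta>_smooth _ compact_Icc st(3)])
    show "\<tau> \<in> {s..t + \<delta>}" if "\<zeta> \<tau> \<noteq> 0" for \<tau>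
      using \<zeta>_zero[of \<tau>] that by force
  qed
  have D_le: "\<bar>frechet_derivative (kern x \<rho>) (at y) w\<bar> \<le> C / \<rho> ^ (DIM('a) + 1) * (norm w * indicator (ball x \<rho>) y)" for y w
  proof (cases "y \<in> ball x \<rho>")
    case True
    then show ?thesis
      using ball(1) C(2)[of "(1 / \<rho>) *\<^sub>R (y - x)" w]
      by (subst kern_frechet) (simp_all add: divide_right_mono)
  next
    case False
    then have "1 \<le> norm ((1 / \<rho>) *\<^sub>R (y - x))"
      using ball(1) by (simp add: dist_norm norm_minus_commute le_divide_eq)
    from bump_derivative_support[OF this] show ?thesis
      using ball(1) False by (subst kern_frechet) simp_all
  qed
  have "ball x \<rho> \<times> {s<..<t + \<delta>} \<in> sets borel"
    by (intro borel_open open_Times open_ball open_greaterThanLessThan)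
  then have A: "ball x \<rho> \<times> {s<..<t + \<delta>} \<in> sets lebesgue" by auto
  let ?P = "\<lambda>z. frechet_derivative (kern x \<rho>) (at (fst z)) (G z) * \<zeta> (snd z)"
  have P_le: "\<bar>?P z\<bar> \<le> C / \<rho> ^ (DIM('a) + 1) * (norm (G z) * indicator (ball x \<rho> \<times> {s<..<t + \<delta>}) z)" for z
  proof -
    have "\<bar>?P z\<bar> \<le> C / \<rho> ^ (DIM('a) + 1) * (norm (G z) * indicator (ball x \<rho>) (fst z)) * indicator {s<..<t + \<delta>} (snd z)"
      unfolding abs_mult using D_le \<zeta>_le C(1) ball(1) by (intro mult_mono) auto
    then show ?thesis by (cases z) (simp add: indicator_times mult_ac)
  qed
  have "(LINT z|lebesgue. v z * (kern x \<rho> (fst z) * (kern s \<delta> (snd z) - kern t \<delta> (snd z))))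
      = (LINT z|lebesgue. ?P z)"
    using eq[OF kern_test_function[OF ball] \<zeta>_test] by (simp add: \<zeta>_frechet)
  also have "\<bar>\<dots>\<bar> \<le> (LINT z|lebesgue. \<bar>?P z\<bar>)"
    by (rule integral_abs_bound)
  also have "\<dots> \<le> (LINT z|lebesgue. C / \<rho> ^ (DIM('a) + 1) * (norm (G z) * indicator (ball x \<rho> \<times> {s<..<t + \<delta>}) z))"
  proof (rule integral_mono')
    show "integrable lebesgue (\<lambda>z. C / \<rho> ^ (DIM('a) + 1) * (norm (G z) * indicator (ball x \<rho> \<times> {s<..<t + \<delta>}) z))"
      using integrable_flux_pairing[OF G A] by simp
  qed (use P_le C(1) ball(1) in auto)
  finally show ?thesis by simp
qed

text \<open>Differentiation of integrals along one-sided cubes is applied to \<open>|v - q|\<close> for every rational \<open>q\<close>: outside a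
null set, the average of \<open>|v - q|\<close> over small cubes at \<open>z\<close> is close to \<open>|v z - q|\<close>, which is small for
suitable \<open>q\<close>, and the kernels are dominated by normalised indicators of these cubes.\<close>
lemma AE_lebesgue_point_kernel:
  fixes v :: "'a::euclidean_space \<times> real \<Rightarrow> real"
  assumes v: "integrable lebesgue v"
  shows "AE z in lebesgue. ((\<lambda>\<delta>. LINT \<zeta>|lebesgue. v \<zeta> * (kern (fst z) \<delta> (fst \<zeta>) * kern (snd z) \<delta> (snd \<zeta>)))
    \<longlongrightarrow> v z) (at_right 0)"
proof -
  have abs_int: "(\<lambda>\<zeta>. \<bar>v \<zeta> - q\<bar>) absolutely_integrable_on cbox a b" for q a b
  proof -
    have "v absolutely_integrable_on cbox a b"
      unfolding set_integrable_def by (rule integrable_mult_indicator[OF _ v]) simp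
    then have "(\<lambda>\<zeta>. v \<zeta> - q) absolutely_integrable_on cbox a b"
      by (intro set_integral_diff(1)) (auto intro: absolutely_integrable_on_const)
    then show ?thesis using absolutely_integrable_abs by (simp add: set_integrable_abs)
  qed
  have "\<exists>N. negligible N \<and> (\<forall>x e. x \<notin> N \<and> 0 < e \<longrightarrow> (\<exists>d>0. \<forall>h. 0 < h \<and> h < d \<longrightarrow>
      norm (integral (cbox x (x + h *\<^sub>R One)) (\<lambda>\<zeta>. \<bar>v \<zeta> - q\<bar>) /\<^sub>R h ^ DIM('a \<times> real) - \<bar>v x - q\<bar>) < e))" for q
    by (rule integrable_ccontinuous_explicit[of "\<lambda>\<zeta>. \<bar>v \<zeta> - q\<bar>"])
       (use abs_int in \<open>auto intro: set_lebesgue_integral_eq_integral(1)\<close>)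
  then obtain N where N: "\<And>q. negligible (N q)"
    "\<And>q x e. x \<notin> N q \<Longrightarrow> 0 < e \<Longrightarrow> \<exists>d>0. \<forall>h. 0 < h \<and> h < d \<longrightarrow>
      norm (integral (cbox x (x + h *\<^sub>R One)) (\<lambda>\<zeta>. \<bar>v \<zeta> - q\<bar>) /\<^sub>R h ^ DIM('a \<times> real) - \<bar>v x - q\<bar>) < e"
    by metis
  obtain C where C: "0 < C" "\<And>y::'a. bump y \<le> C"
    "\<And>(y::'a) (w::'a). \<bar>frechet_derivative bump (at y) w\<bar> \<le> C * norm w" by (rule bump_bounds[where 'a='a]) blast
  obtain C' where C': "0 < C'" "\<And>y::real. bump y \<le> C'"
    "\<And>(y::real) (w::real). \<bar>frechet_derivative bump (at y) w\<bar> \<le> C' * norm w" by (rule bump_bounds[where 'a=real]) blast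
  have "negligible (\<Union>q\<in>\<rat>. N q)"
    by (rule negligible_countable_Union[of "N ` \<rat>", simplified]) (use N(1) countable_rat in auto)
  then have "AE z in lebesgue. z \<notin> (\<Union>q\<in>\<rat>. N q)"
    unfolding negligible_iff_null_sets by (rule AE_not_in)
  then show ?thesis
  proof eventually_elim
    case (elim z)
    show ?case
    proof (rule tendstoI)
      fix e :: real assume e: "0 < e"
      \<comment> \<open>The kernels are at most \<open>C * C'\<close> times the normalised indicator of the cube; \<open>e'\<close> absorbs this factor.\<close>
      define e' where "e' = min (e / 2) (e / (4 * (C * C')))"
      have e': "0 < e'" "C * C' * (2 * e') \<le> e / 2"
      proof -
        show "0 < e'" using e C(1,2) C'(1,2) by (simp add: e'_def)
        have "C * C' * (2 * e') \<le> C * C' * (2 * (e / (4 * (C * C'))))"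
          using C(1,2) C'(1,2) by (intro mult_left_mono) (auto simp: e'_def)
        then show "C * C' * (2 * e') \<le> e / 2" using C(1,2) C'(1,2) by simp
      qed
      obtain q where q: "q \<in> \<rat>" "\<bar>v z - q\<bar> < e'"
        using Rats_dense_in_real[of "v z" "v z + e'"] e' by force
      then obtain d where d: "d > 0" "\<And>h. 0 < h \<Longrightarrow> h < d \<Longrightarrow>
          norm (integral (cbox z (z + h *\<^sub>R One)) (\<lambda>\<zeta>. \<bar>v \<zeta> - q\<bar>) /\<^sub>R h ^ DIM('a \<times> real) - \<bar>v z - q\<bar>) < e'"
        using N(2)[of z q e'] elim e' by blast
      have "dist (LINT \<zeta>|lebesgue. v \<zeta> * (kern (fst z) \<delta> (fst \<zeta>) * kern (snd z) \<delta> (snd \<zeta>))) (v z) < e"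
        if \<delta>: "0 < \<delta>" "\<delta> < d" for \<delta>
      proof -
        let ?k = "\<lambda>\<zeta>. kern (fst z) \<delta> (fst \<zeta>) * kern (snd z) \<delta> (snd \<zeta>)"
        let ?Q = "cbox z (z + \<delta> *\<^sub>R One)"
        have k: "integrable lebesgue ?k" "(LINT \<zeta>|lebesgue. ?k \<zeta>) = 1"
          using has_integral_kern_product[OF \<delta>(1) \<delta>(1), of "fst z" "snd z"]
          by (auto simp: has_bochner_integral_iff)
        have k_le: "0 \<le> ?k \<zeta>" "?k \<zeta> \<le> C * C' / \<delta> ^ DIM('a \<times> real) * indicator ?Q \<zeta>" for \<zeta>
        proof -
          show "0 \<le> ?k \<zeta>" using \<delta> by (simp add: kern_nonneg)
          show "?k \<zeta> \<le> C * C' / \<delta> ^ DIM('a \<times> real) * indicator ?Q \<zeta>"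
          proof (cases "?k \<zeta> = 0")
            case True
            have "0 \<le> C * C' / \<delta> ^ DIM('a \<times> real) * indicator ?Q \<zeta>"
              using C(1) C'(1) \<delta> by (intro mult_nonneg_nonneg) auto
            then show ?thesis using True by linarith
          next
            case False
            then have "kern (fst z) \<delta> (fst \<zeta>) \<noteq> 0" "kern (snd z) \<delta> (snd \<zeta>) \<noteq> 0" by auto
            from kern_support(2)[OF this(1) \<delta>(1)] kern_support(2)[OF this(2) \<delta>(1)]
            have box: "fst \<zeta> \<in> box (fst z) (fst z + \<delta> *\<^sub>R One)" "snd \<zeta> \<in> box (snd z) (snd z + \<delta> *\<^sub>R One)" .
            have "\<zeta> \<in> ?Q"
              unfolding mem_box
            proof
              fix b :: "'a \<times> real" assume b: "b \<in> Basis"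
              then have "z \<bullet> b \<le> \<zeta> \<bullet> b \<and> \<zeta> \<bullet> b \<le> z \<bullet> b + \<delta>"
                using box by (auto simp: Basis_prod_def mem_box inner_prod_def inner_add_left less_imp_le)
              then show "z \<bullet> b \<le> \<zeta> \<bullet> b \<and> \<zeta> \<bullet> b \<le> (z + \<delta> *\<^sub>R One) \<bullet> b"
                using b by (simp add: inner_add_left)
            qed
            moreover have "?k \<zeta> \<le> (C / \<delta> ^ DIM('a)) * (C' / \<delta>)"
              using \<delta> C(1,2) C'(1,2) by (intro mult_mono) (auto simp: kern_def bump_nonneg divide_right_mono)
            ultimately show ?thesis by (simp add: mult.commute)
          qed
        qed
        have k_abs: "\<bar>?k \<zeta>\<bar> \<le> C * C' / \<delta> ^ DIM('a \<times> real)" for \<zeta>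
          using k_le[of \<zeta>] C(1,2) C'(1,2) \<delta> by (cases "\<zeta> \<in> ?Q") auto
        have vk: "integrable lebesgue (\<lambda>\<zeta>. v \<zeta> * ?k \<zeta>)"
          using k(1) by (intro integrable_mult_bounded[OF v _ k_abs]) auto
        have absQ: "set_integrable lebesgue ?Q (\<lambda>\<zeta>. \<bar>v \<zeta> - q\<bar>)" by (rule abs_int)
        have eq: "(LINT \<zeta>|lebesgue. v \<zeta> * ?k \<zeta>) - q = (LINT \<zeta>|lebesgue. v \<zeta> * ?k \<zeta> - q * ?k \<zeta>)"
          using vk k by simp
        have "\<bar>(LINT \<zeta>|lebesgue. v \<zeta> * ?k \<zeta>) - q\<bar> \<le> (LINT \<zeta>|lebesgue. \<bar>v \<zeta> * ?k \<zeta> - q * ?k \<zeta>\<bar>)"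
          unfolding eq by (rule integral_abs_bound)
        also have "\<dots> \<le> (LINT \<zeta>|lebesgue. C * C' / \<delta> ^ DIM('a \<times> real) * (indicator ?Q \<zeta> *\<^sub>R \<bar>v \<zeta> - q\<bar>))"
        proof (rule integral_mono')
          show "integrable lebesgue (\<lambda>\<zeta>. C * C' / \<delta> ^ DIM('a \<times> real) * (indicator ?Q \<zeta> *\<^sub>R \<bar>v \<zeta> - q\<bar>))"
            using absQ unfolding set_integrable_def by (rule integrable_mult_right)
          show "\<bar>v \<zeta> * ?k \<zeta> - q * ?k \<zeta>\<bar> \<le> C * C' / \<delta> ^ DIM('a \<times> real) * (indicator ?Q \<zeta> *\<^sub>R \<bar>v \<zeta> - q\<bar>)" for \<zeta>
          proof -
            have "\<bar>v \<zeta> * ?k \<zeta> - q * ?k \<zeta>\<bar> = \<bar>v \<zeta> - q\<bar> * ?k \<zeta>"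
              using k_le(1)[of \<zeta>] abs_mult[of "v \<zeta> - q" "?k \<zeta>"] by (simp only: left_diff_distrib abs_of_nonneg)
            also have "\<dots> \<le> \<bar>v \<zeta> - q\<bar> * (C * C' / \<delta> ^ DIM('a \<times> real) * indicator ?Q \<zeta>)"
              using k_le(2)[of \<zeta>] by (intro mult_left_mono) auto
            finally show ?thesis by (simp add: mult_ac)
          qed
        qed (use C(1,2) C'(1,2) \<delta> in auto)
        also have "\<dots> = C * C' / \<delta> ^ DIM('a \<times> real) * (LINT \<zeta>:?Q|lebesgue. \<bar>v \<zeta> - q\<bar>)"
          unfolding set_lebesgue_integral_def by (rule integral_mult_right_zero)
        also have "\<dots> = C * C' * (integral ?Q (\<lambda>\<zeta>. \<bar>v \<zeta> - q\<bar>) /\<^sub>R \<delta> ^ DIM('a \<times> real))"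
          by (simp add: set_lebesgue_integral_eq_integral(2)[OF absQ] divide_inverse)
        also have "\<dots> \<le> C * C' * (2 * e')"
        proof (rule mult_left_mono)
          show "integral ?Q (\<lambda>\<zeta>. \<bar>v \<zeta> - q\<bar>) /\<^sub>R \<delta> ^ DIM('a \<times> real) \<le> 2 * e'"
            using d(2)[OF \<delta>] q(2) unfolding real_norm_def by linarith
        qed (use C(1) C'(1) in simp)
        finally have "\<bar>(LINT \<zeta>|lebesgue. v \<zeta> * ?k \<zeta>) - q\<bar> \<le> e / 2"
          using e'(2) by simp
        moreover have "\<bar>v z - q\<bar> < e / 2" using q(2) e by (simp add: e'_def)
        ultimately show ?thesis unfolding dist_real_def by linarith
      qed
      then show "\<forall>\<^sub>F \<delta> in at_right 0. dist (LINT \<zeta>|lebesgue. v \<zeta> * (kern (fst z) \<delta> (fst \<zeta>) * kern (snd z) \<delta> (snd \<zeta>))) (v z) < e"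
        using d(1) by (intro eventually_at_rightI[of 0 d]) auto
    qed
  qed
qed

section \<open>Time differences at points of kernel convergence\<close>

text \<open>A bound for all averages of \<open>f\<close> over cylinders centred at \<open>x\<close> in space whose time interval contains \<open>t\<close>. The
volume of the unit ball is absorbed into \<open>M\<close>. The cylinders are not restricted in size since the bound is
applied to functions vanishing outside a fixed cylinder.\<close>
definition cyl_avg_le :: "('a::euclidean_space \<times> real \<Rightarrow> real) \<Rightarrow> 'a \<Rightarrow> real \<Rightarrow> real \<Rightarrow> bool" where
  "cyl_avg_le f x t M \<longleftrightarrow> (\<forall>\<rho> a b. 0 < \<rho> \<and> a < t \<and> t < b \<longrightarrow>
     (LINT z|lebesgue. f z * indicator (ball x \<rho> \<times> {a<..<b}) z) \<le> M * (\<rho> ^ DIM('a) * (b - a)))"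

lemma cyl_avg_leD:
  fixes x :: "'a::euclidean_space"
  assumes "cyl_avg_le f x t M" "0 < \<rho>" "a < t" "t < b"
  shows "(LINT z|lebesgue. f z * indicator (ball x \<rho> \<times> {a<..<b}) z) \<le> M * (\<rho> ^ DIM('a) * (b - a))"
  using assms unfolding cyl_avg_le_def by blast

lemma cyl_avg_le_nonneg:
  assumes "cyl_avg_le f x t M" "\<And>z. 0 \<le> f z"
  shows "0 \<le> M"
proof -
  have "0 \<le> (LINT z|lebesgue. f z * indicator (ball x 1 \<times> {t-1<..<t+1}) z)"
    using assms(2) by (intro Bochner_Integration.integral_nonneg) simp
  also have "\<dots> \<le> M * (1 ^ DIM('a) * ((t + 1) - (t - 1)))"
    by (rule cyl_avg_leD[OF assms(1)]) simp_all
  finally show ?thesis by simp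
qed

lemma cylinder_sets: "ball (x::'a::euclidean_space) \<rho> \<times> {a<..<b::real} \<in> sets lebesgue"
proof -
  have "ball x \<rho> \<times> {a<..<b} \<in> sets borel"
    by (intro borel_open open_Times open_ball open_greaterThanLessThan)
  then show ?thesis by auto
qed

text \<open>The time kernel at \<open>t\<close> is supported in \<open>(t, t + \<delta>)\<close>, which does not contain \<open>t\<close>; it is dominated by the
symmetric interval, at the price of a factor 2.\<close>
lemma cyl_avg_le_kern_time:
  fixes f :: "'a::euclidean_space \<times> real \<Rightarrow> real"
  assumes f: "integrable lebesgue f" "\<And>z. 0 \<le> f z"
    and M: "cyl_avg_le f x t M" and "0 < \<rho>" "0 < \<delta>"
    and C': "\<And>y::real. bump y \<le> C'" "0 < C'"
  shows "(LINT z|lebesgue. f z * (indicator (ball x \<rho>) (fst z) * \<bar>kern t \<delta> (snd z)\<bar>)) \<le> 2 * C' * M * \<rho> ^ DIM('a)"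
proof -
  have i: "integrable lebesgue (\<lambda>z. f z * indicator (ball x \<rho> \<times> {t-\<delta><..<t+\<delta>}) z)"
    by (rule integrable_mult_bounded[OF f(1) borel_measurable_indicator[OF cylinder_sets], where C = 1])
       (simp add: indicator_def)
  have "(LINT z|lebesgue. f z * (indicator (ball x \<rho>) (fst z) * \<bar>kern t \<delta> (snd z)\<bar>))
    \<le> (LINT z|lebesgue. C' / \<delta> * (f z * indicator (ball x \<rho> \<times> {t-\<delta><..<t+\<delta>}) z))"
  proof (rule integral_mono')
    show "integrable lebesgue (\<lambda>z. C' / \<delta> * (f z * indicator (ball x \<rho> \<times> {t-\<delta><..<t+\<delta>}) z))"
      using i by simp
    show "f z * (indicator (ball x \<rho>) (fst z) * \<bar>kern t \<delta> (snd z)\<bar>)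
      \<le> C' / \<delta> * (f z * indicator (ball x \<rho> \<times> {t-\<delta><..<t+\<delta>}) z)" for z
    proof -
      have "ball t \<delta> = {t-\<delta><..<t+\<delta>}" by (auto simp: dist_real_def)
      then have "\<bar>kern t \<delta> (snd z)\<bar> \<le> C' / \<delta> * indicator {t-\<delta><..<t+\<delta>} (snd z)"
        using kern_le[OF \<open>0 < \<delta>\<close> C', of t "snd z"] kern_nonneg[OF \<open>0 < \<delta>\<close>, of t "snd z"] by simp
      then have "f z * (indicator (ball x \<rho>) (fst z) * \<bar>kern t \<delta> (snd z)\<bar>)
        \<le> f z * (indicator (ball x \<rho>) (fst z) * (C' / \<delta> * indicator {t-\<delta><..<t+\<delta>} (snd z)))"
        using f(2)[of z] by (intro mult_left_mono) auto
      also have "\<dots> = C' / \<delta> * (f z * indicator (ball x \<rho> \<times> {t-\<delta><..<t+\<delta>}) z)"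
        by (cases z) (simp add: indicator_times mult_ac)
      finally show ?thesis .
    qed
  qed (use f(2) C' \<open>0 < \<delta>\<close> in auto)
  also have "\<dots> = C' / \<delta> * (LINT z|lebesgue. f z * indicator (ball x \<rho> \<times> {t-\<delta><..<t+\<delta>}) z)"
    by (rule integral_mult_right_zero)
  also have "\<dots> \<le> C' / \<delta> * (M * (\<rho> ^ DIM('a) * ((t + \<delta>) - (t - \<delta>))))"
  proof (rule mult_left_mono)
    show "(LINT z|lebesgue. f z * indicator (ball x \<rho> \<times> {t-\<delta><..<t+\<delta>}) z)
        \<le> M * (\<rho> ^ DIM('a) * ((t + \<delta>) - (t - \<delta>)))"
      using assms(4,5) by (intro cyl_avg_leD[OF M]) simp_all
  qed (use C' \<open>0 < \<delta>\<close> in simp)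
  also have "\<dots> = 2 * C' * M * \<rho> ^ DIM('a)"
    using \<open>0 < \<delta>\<close> by (simp add: field_simps)
  finally show ?thesis .
qed

abbreviation kern_avg :: "('a::euclidean_space \<times> real \<Rightarrow> real) \<Rightarrow> 'a \<Rightarrow> real \<Rightarrow> real \<Rightarrow> real \<Rightarrow> real" where
  "kern_avg v x t \<rho> \<delta> \<equiv> LINT z|lebesgue. v z * (kern x \<rho> (fst z) * kern t \<delta> (snd z))"

text \<open>The kernel at \<open>(x, t)\<close> is evaluated at equal scales in space and time, in accordance with cubes shrinking to the
point.\<close>
definition kernel_point :: "('a::euclidean_space \<times> real \<Rightarrow> real) \<Rightarrow> 'a \<Rightarrow> real \<Rightarrow> bool" where
  "kernel_point v x t \<longleftrightarrow> ((\<lambda>\<delta>. kern_avg v x t \<delta> \<delta>) \<longlongrightarrow> v (x, t)) (at_right 0)"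

lemma integrable_kern_product:
  fixes v :: "'a::euclidean_space \<times> real \<Rightarrow> real"
  assumes "integrable lebesgue v" "0 < \<rho>" "0 < \<delta>"
  shows "integrable lebesgue (\<lambda>z. v z * (kern x \<rho> (fst z) * kern t \<delta> (snd z)))"
proof -
  obtain C where C: "0 < C" "\<And>y::'a. bump y \<le> C"
    "\<And>(y::'a) (w::'a). \<bar>frechet_derivative bump (at y) w\<bar> \<le> C * norm w" by (rule bump_bounds[where 'a='a]) blast
  obtain C' where C': "0 < C'" "\<And>y::real. bump y \<le> C'"
    "\<And>(y::real) (w::real). \<bar>frechet_derivative bump (at y) w\<bar> \<le> C' * norm w" by (rule bump_bounds[where 'a=real]) blast
  show ?thesis
  proof (rule integrable_mult_bounded[OF assms(1)])
    show "(\<lambda>z. kern x \<rho> (fst z) * kern t \<delta> (snd z)) \<in> borel_measurable lebesgue"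
      using borel_fst[OF borel_measurable_kern] borel_snd[OF borel_measurable_kern] by measurable
    show "\<bar>kern x \<rho> (fst z) * kern t \<delta> (snd z)\<bar> \<le> (C / \<rho> ^ DIM('a)) * (C' / \<delta>)" for z :: "'a \<times> real"
      unfolding abs_mult using assms(2,3) C(1,2) C'(1,2)
      by (intro mult_mono) (auto simp: kern_def bump_nonneg divide_right_mono)
  qed
qed

lemma kernel_point_bound:
  fixes v :: "'a::euclidean_space \<times> real \<Rightarrow> real"
  assumes v: "integrable lebesgue v"
    and M: "cyl_avg_le (\<lambda>z. \<bar>v z\<bar>) x t M" and pt: "kernel_point v x t"
    and C: "\<And>y::'a. bump y \<le> C" "0 < C"
    and C': "\<And>y::real. bump y \<le> C'" "0 < C'"
  shows "\<bar>v (x, t)\<bar> \<le> 2 * C * C' * M"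
proof -
  have "\<bar>kern_avg v x t \<delta> \<delta>\<bar> \<le> 2 * C * C' * M" if "0 < \<delta>" for \<delta>
  proof -
    have le: "\<bar>v z * (kern x \<delta> (fst z) * kern t \<delta> (snd z))\<bar>
      \<le> C / \<delta> ^ DIM('a) * (\<bar>v z\<bar> * (indicator (ball x \<delta>) (fst z) * \<bar>kern t \<delta> (snd z)\<bar>))" for z
    proof -
      have "\<bar>kern x \<delta> (fst z)\<bar> \<le> C / \<delta> ^ DIM('a) * indicator (ball x \<delta>) (fst z)"
        using kern_le[OF that C, of x "fst z"] kern_nonneg[OF that, of x "fst z"] by simp
      then have "\<bar>v z\<bar> * (\<bar>kern x \<delta> (fst z)\<bar> * \<bar>kern t \<delta> (snd z)\<bar>)
        \<le> \<bar>v z\<bar> * ((C / \<delta> ^ DIM('a) * indicator (ball x \<delta>) (fst z)) * \<bar>kern t \<delta> (snd z)\<bar>)"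
        by (intro mult_left_mono mult_right_mono) auto
      then show ?thesis by (simp add: abs_mult mult_ac)
    qed
    have i: "integrable lebesgue (\<lambda>z. \<bar>v z\<bar> * (indicator (ball x \<delta>) (fst z) * \<bar>kern t \<delta> (snd z)\<bar>))"
    proof (rule integrable_mult_bounded[where C = "C' / \<delta>"])
      have "(indicator (ball x \<delta>) :: 'a \<Rightarrow> real) \<in> borel_measurable borel"
        by (intro borel_measurable_indicator borel_open open_ball)
      from borel_fst[OF this] borel_snd[OF borel_measurable_kern[of t \<delta>]]
      show "(\<lambda>z. indicator (ball x \<delta>) (fst z) * \<bar>kern t \<delta> (snd z)\<bar>) \<in> borel_measurable lebesgue" by measurable
      show "\<bar>indicator (ball x \<delta>) (fst z) * \<bar>kern t \<delta> (snd z)\<bar>\<bar> \<le> C' / \<delta>" for z :: "'a \<times> real"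
        using C' that kern_nonneg[OF that, of t "snd z"]
        by (auto simp: indicator_def kern_def divide_right_mono bump_nonneg)
    qed (use v in simp)
    have "\<bar>kern_avg v x t \<delta> \<delta>\<bar> \<le> (LINT z|lebesgue. \<bar>v z * (kern x \<delta> (fst z) * kern t \<delta> (snd z))\<bar>)"
      by (rule integral_abs_bound)
    also have "\<dots> \<le> (LINT z|lebesgue. C / \<delta> ^ DIM('a) * (\<bar>v z\<bar> * (indicator (ball x \<delta>) (fst z) * \<bar>kern t \<delta> (snd z)\<bar>)))"
    proof (rule integral_mono')
      show "integrable lebesgue (\<lambda>z. C / \<delta> ^ DIM('a) * (\<bar>v z\<bar> * (indicator (ball x \<delta>) (fst z) * \<bar>kern t \<delta> (snd z)\<bar>)))"
        using i by (rule integrable_mult_right)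
    qed (use le C that in auto)
    also have "\<dots> = C / \<delta> ^ DIM('a) * (LINT z|lebesgue. \<bar>v z\<bar> * (indicator (ball x \<delta>) (fst z) * \<bar>kern t \<delta> (snd z)\<bar>))"
      by (rule integral_mult_right_zero)
    also have "\<dots> \<le> C / \<delta> ^ DIM('a) * (2 * C' * M * \<delta> ^ DIM('a))"
    proof (rule mult_left_mono)
      show "(LINT z|lebesgue. \<bar>v z\<bar> * (indicator (ball x \<delta>) (fst z) * \<bar>kern t \<delta> (snd z)\<bar>)) \<le> 2 * C' * M * \<delta> ^ DIM('a)"
        by (rule cyl_avg_le_kern_time[OF _ _ M that that C']) (use v in auto)
    qed (use C that in simp)
    also have "\<dots> = 2 * C * C' * M" using that by simp
    finally show ?thesis .
  qed
  then have "\<forall>\<^sub>F \<delta> in at_right 0. \<bar>kern_avg v x t \<delta> \<delta>\<bar> \<le> 2 * C * C' * M"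
    by (auto intro!: eventually_at_rightI[of 0 1])
  with tendsto_rabs[OF pt[unfolded kernel_point_def]] show ?thesis
    by (rule tendsto_upperbound) simp
qed

text \<open>Insert the averages at spatial scale \<open>R\<close> at both times: the two changes of scale cost \<open>R * M\<close>, the change of time
costs \<open>(t - s) / R * M'\<close>, uniformly in \<open>\<delta>\<close>, and \<open>\<delta>\<close> tends to 0.\<close>
lemma kernel_point_time_difference:
  fixes v :: "'a::euclidean_space \<times> real \<Rightarrow> real" and V G :: "'a \<times> real \<Rightarrow> 'a"
  assumes int: "integrable lebesgue v" "integrable lebesgue V" "integrable lebesgue G"
    and weak: "\<And>\<eta> \<theta> b. \<eta> \<in> test_functions B \<Longrightarrow> \<theta> \<in> test_functions J \<Longrightarrow> b \<in> Basis \<Longrightarrow>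
      (LINT z|lebesgue. v z * (frechet_derivative \<eta> (at (fst z)) b * \<theta> (snd z)))
        = - (LINT z|lebesgue. (V z \<bullet> b) * (\<eta> (fst z) * \<theta> (snd z)))"
    and eq: "\<And>\<eta> \<zeta>. \<eta> \<in> test_functions B \<Longrightarrow> \<zeta> \<in> test_functions J \<Longrightarrow>
      (LINT z|lebesgue. v z * (\<eta> (fst z) * frechet_derivative \<zeta> (at (snd z)) 1))
        = (LINT z|lebesgue. frechet_derivative \<eta> (at (fst z)) (G z) * \<zeta> (snd z))"
    and J: "J = {a0<..<b0}" "s \<in> J" "t \<in> J" "s < t" and R: "0 < R" "cball x R \<subseteq> B"
    and MV: "cyl_avg_le (\<lambda>z. norm (V z)) x s M" "cyl_avg_le (\<lambda>z. norm (V z)) x t M"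
    and MG: "cyl_avg_le (\<lambda>z. norm (G z)) x t M'"
    and pt: "kernel_point v x s" "kernel_point v x t"
    and C: "\<And>y::'a. bump y \<le> C" "0 < C" "\<And>(y::'a) (w::'a). \<bar>frechet_derivative bump (at y) w\<bar> \<le> C * norm w"
    and C': "\<And>y::real. bump y \<le> C'" "0 < C'"
  shows "\<bar>v (x, t) - v (x, s)\<bar> \<le> 4 * C * C' * (R * M) + C * ((t - s) / R * M')"
proof -
  have M0: "0 \<le> M" using cyl_avg_le_nonneg[OF MV(1)] by simp
  \<comment> \<open>For time scales below \<open>d\<close> all time kernels are supported in \<open>J\<close>.\<close>
  define d where "d = min R (min (s - a0) (b0 - t))"
  have d: "0 < d" using J R by (auto simp: d_def)
  have scale: "\<bar>kern_avg v x \<tau> R \<delta> - kern_avg v x \<tau> \<delta> \<delta>\<bar> \<le> 2 * C * C' * (R * M)"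
    if "0 < \<delta>" "\<delta> < d" "\<tau> = s \<or> \<tau> = t" for \<tau> \<delta>
  proof -
    have "cball \<tau> \<delta> \<subseteq> J" using that J by (auto simp: d_def dist_real_def)
    then have \<theta>: "kern \<tau> \<delta> \<in> test_functions J" using that by (intro kern_test_function) auto
    have "\<bar>kern_avg v x \<tau> R \<delta> - kern_avg v x \<tau> \<delta> \<delta>\<bar> \<le> C * (2 * C' * M) * (R - \<delta>)"
    proof (rule kernel_average_scale_change[OF int(1,2) weak[OF _ \<theta>] borel_measurable_kern _ R(2) that(1) _ C])
      show "\<bar>kern \<tau> \<delta> \<tau>'\<bar> \<le> C' / \<delta>" for \<tau>'
        using C' that by (simp add: kern_def bump_nonneg divide_right_mono)
      show "\<delta> \<le> R" using that by (simp add: d_def)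
      show "(LINT z|lebesgue. norm (V z) * (indicator (ball x \<rho>) (fst z) * \<bar>kern \<tau> \<delta> (snd z)\<bar>)) \<le> 2 * C' * M * \<rho> ^ DIM('a)"
        if "\<delta> \<le> \<rho>" for \<rho>
        using cyl_avg_le_kern_time[of "\<lambda>z. norm (V z)" x \<tau> M \<rho> \<delta>, OF _ _ _ _ _ C'] int(2) MV that
          \<open>0 < \<delta>\<close> \<open>\<tau> = s \<or> \<tau> = t\<close> by auto
    qed
    also have "\<dots> \<le> C * (2 * C' * M) * R"
      using C C' M0 that by (intro mult_left_mono) auto
    finally show ?thesis by (simp add: mult_ac)
  qed
  have time: "\<bar>kern_avg v x s R \<delta> - kern_avg v x t R \<delta>\<bar> \<le> C * ((t + \<delta> - s) / R * M')"
    if "0 < \<delta>" "\<delta> < d" for \<delta>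
  proof -
    have sub: "{s..t + \<delta>} \<subseteq> J" using that J by (auto simp: d_def)
    have "kern_avg v x s R \<delta> - kern_avg v x t R \<delta>
      = (LINT z|lebesgue. v z * (kern x R (fst z) * (kern s \<delta> (snd z) - kern t \<delta> (snd z))))"
      by (subst Bochner_Integration.integral_diff[symmetric])
         (use integrable_kern_product[OF int(1) R(1) that(1)] in \<open>auto simp: algebra_simps\<close>)
    also have "\<bar>\<dots>\<bar> \<le> C / R ^ (DIM('a) + 1) * (LINT z|lebesgue. norm (G z) * indicator (ball x R \<times> {s<..<t + \<delta>}) z)"
      by (rule kernel_average_time_change[OF int(3) eq J(4) that(1) sub R C(2,3)])
    also have "\<dots> \<le> C / R ^ (DIM('a) + 1) * (M' * (R ^ DIM('a) * (t + \<delta> - s)))"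
    proof (rule mult_left_mono)
      show "(LINT z|lebesgue. norm (G z) * indicator (ball x R \<times> {s<..<t + \<delta>}) z) \<le> M' * (R ^ DIM('a) * (t + \<delta> - s))"
        using R(1) J(4) that(1) by (intro cyl_avg_leD[OF MG]) simp_all
    qed (use C R in simp)
    also have "\<dots> = C * ((t + \<delta> - s) / R * M')" using R(1) by (simp add: field_simps)
    finally show ?thesis .
  qed
  have lim: "((\<lambda>\<delta>. \<bar>kern_avg v x t \<delta> \<delta> - kern_avg v x s \<delta> \<delta>\<bar>) \<longlongrightarrow> \<bar>v (x, t) - v (x, s)\<bar>) (at_right 0)"
    using pt unfolding kernel_point_def by (intro tendsto_intros)
  have lim': "((\<lambda>\<delta>. 4 * C * C' * (R * M) + C * ((t + \<delta> - s) / R * M')) \<longlongrightarrow>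
      4 * C * C' * (R * M) + C * ((t + 0 - s) / R * M')) (at_right 0)"
    using R by (intro tendsto_intros) auto
  have "\<bar>kern_avg v x t \<delta> \<delta> - kern_avg v x s \<delta> \<delta>\<bar> \<le> 4 * C * C' * (R * M) + C * ((t + \<delta> - s) / R * M')"
    if "0 < \<delta>" "\<delta> < d" for \<delta>
    using scale[OF that, of s] scale[OF that, of t] time[OF that] by simp
  then have "\<forall>\<^sub>F \<delta> in at_right 0. \<bar>kern_avg v x t \<delta> \<delta> - kern_avg v x s \<delta> \<delta>\<bar>
      \<le> 4 * C * C' * (R * M) + C * ((t + \<delta> - s) / R * M')"
    using d by (intro eventually_at_rightI[of 0 d]) auto
  from tendsto_le[OF _ lim' lim this] show ?thesis by simp
qed

section \<open>Slices and Caratheodory fields\<close>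

text \<open>Lebesgue measure on a product is the completion of the product of Borel-Lebesgue measures, so the theorems on
slices are applied to Borel null sets and, below, to Borel representatives.\<close>
lemma AE_lebesgue_slices:
  assumes "AE z in lebesgue. P (z :: 'a::euclidean_space \<times> 'b::euclidean_space)"
  shows "AE x in lebesgue. AE y in lebesgue. P (x, y)" "AE y in lebesgue. AE x in lebesgue. P (x, y)"
proof -
  have *: "AE z in lborel \<Otimes>\<^sub>M lborel. P z"
    using assms unfolding lborel_prod AE_completion_iff .
  then show "AE x in lebesgue. AE y in lebesgue. P (x, y)"
    using lborel_pair.AE_pair by (auto simp: AE_completion_iff)
  obtain N where N: "\<And>z. z \<notin> N \<Longrightarrow> P z" "N \<in> null_sets (lborel \<Otimes>\<^sub>M lborel)"
    using * unfolding eventually_ae_filter by (auto simp: space_pair_measure)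
  have "AE z in lborel \<Otimes>\<^sub>M lborel. z \<notin> N" using N(2) by (rule AE_not_in)
  then have "AE x in lborel. AE y in lborel. (x, y) \<notin> N" by (rule lborel_pair.AE_pair)
  then have "AE y in lborel. AE x in lborel. (x, y) \<notin> N"
  proof (subst lborel_pair.AE_commute[symmetric])
    have "space (lborel \<Otimes>\<^sub>M lborel) - N \<in> sets (lborel \<Otimes>\<^sub>M lborel)"
      by (intro sets.compl_sets null_setsD2[OF N(2)])
    then show "{z \<in> space (lborel \<Otimes>\<^sub>M lborel). (fst z, snd z) \<notin> N} \<in> sets (lborel \<Otimes>\<^sub>M lborel)"
      by (simp add: set_diff_eq)
  qed
  then show "AE y in lebesgue. AE x in lebesgue. P (x, y)"
    unfolding AE_completion_iff by (elim eventually_mono) (use N(1) in blast)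
qed

lemma borel_representative:
  fixes f :: "'a::euclidean_space \<times> 'b::euclidean_space \<Rightarrow> real"
  assumes "f \<in> borel_measurable lebesgue"
  obtains h where "h \<in> borel_measurable (lborel \<Otimes>\<^sub>M lborel)" "AE z in lebesgue. f z = h z"
  using completion_ex_borel_measurable_real[OF assms] by (auto simp: lborel_prod AE_completion_iff)

lemma AE_slice_measurable:
  fixes f :: "'a::euclidean_space \<times> 'b::euclidean_space \<Rightarrow> real"
  assumes "f \<in> borel_measurable lebesgue"
  shows "AE x in lebesgue. (\<lambda>y. f (x, y)) \<in> borel_measurable lebesgue"
proof -
  obtain h where h: "h \<in> borel_measurable (lborel \<Otimes>\<^sub>M lborel)" "AE z in lebesgue. f z = h z"
    by (rule borel_representative[OF assms])
  from AE_lebesgue_slices(1)[OF h(2)] show ?thesis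
  proof eventually_elim
    case (elim x)
    have "(\<lambda>y. h (x, y)) \<in> borel_measurable lborel"
      by (rule measurable_compose_Pair1[OF _ h(1)]) simp
    then have "(\<lambda>y. h (x, y)) \<in> borel_measurable lebesgue" by (rule measurable_completion)
    moreover have "AE y in lborel. h (x, y) = f (x, y)"
      using elim by (auto simp: AE_completion_iff)
    ultimately show ?case
      using borel_measurable_AE by (auto simp: AE_completion_iff)
  qed
qed

lemma measurable_compose_Pair2:
  "y \<in> space M2 \<Longrightarrow> g \<in> measurable (M1 \<Otimes>\<^sub>M M2) L \<Longrightarrow> (\<lambda>x. g (x, y)) \<in> measurable M1 L"
  by simp

lemma integral_lebesgue_slices:
  fixes f :: "'a::euclidean_space \<times> 'b::euclidean_space \<Rightarrow> real"
  assumes "integrable lebesgue f"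
  shows "(LINT z|lebesgue. f z) = (LINT y|lebesgue. LINT x|lebesgue. f (x, y))"
    and "(\<lambda>y. LINT x|lebesgue. f (x, y)) \<in> borel_measurable lebesgue"
proof -
  obtain h where h: "h \<in> borel_measurable (lborel \<Otimes>\<^sub>M lborel)" "AE z in lebesgue. f z = h z"
    using borel_representative borel_measurable_integrable[OF assms] by blast
  have hb: "h \<in> borel_measurable borel" using h(1) by (simp add: lborel_prod)
  have "integrable lebesgue h"
    using integrable_cong_AE[OF borel_measurable_integrable[OF assms] borel_measurable_lebesgueI[OF hb] h(2)] assms by simp
  then have hi: "integrable (lborel \<Otimes>\<^sub>M lborel) h"
    using hb by (simp add: lborel_prod integrable_completion)
  let ?h = "\<lambda>y. LINT x|lborel. h (x, y)"
  have hi2: "?h \<in> borel_measurable lborel"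
    using lborel_pair.integrable_snd[of "\<lambda>x y. h (x, y)"] hi by (auto dest: borel_measurable_integrable)
  then have hm: "?h \<in> borel_measurable lebesgue" by (rule measurable_completion)
  have eq: "AE y in lebesgue. ?h y = (LINT x|lebesgue. f (x, y))"
    using AE_lebesgue_slices(2)[OF h(2)]
  proof eventually_elim
    case (elim y)
    have "(\<lambda>x. h (x, y)) \<in> borel_measurable lborel"
      by (rule measurable_compose_Pair2[OF _ h(1)]) simp
    then have m: "(\<lambda>x. h (x, y)) \<in> borel_measurable lebesgue"
      and i: "(LINT x|lborel. h (x, y)) = (LINT x|lebesgue. h (x, y))"
      by (simp_all add: measurable_completion integral_completion)
    have e: "AE x in lebesgue. h (x, y) = f (x, y)" using elim by eventually_elim simp
    show ?case unfolding i by (rule integral_cong_AE[OF m borel_measurable_AE[OF m e] e])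
  qed
  show fm: "(\<lambda>y. LINT x|lebesgue. f (x, y)) \<in> borel_measurable lebesgue"
    by (rule borel_measurable_AE[OF hm eq])
  have "(LINT z|lebesgue. f z) = (LINT z|lebesgue. h z)"
    by (rule integral_cong_AE[OF borel_measurable_integrable[OF assms] borel_measurable_lebesgueI[OF hb] h(2)])
  also have "\<dots> = (LINT z|(lborel \<Otimes>\<^sub>M lborel). h z)"
    using hb by (simp add: lborel_prod integral_completion)
  also have "\<dots> = (LINT y|lborel. LINT x|lborel. h (x, y))"
    using lborel_pair.integral_snd[of "\<lambda>x y. h (x, y)"] hi by simp
  also have "\<dots> = (LINT y|lebesgue. LINT x|lborel. h (x, y))"
    by (rule integral_completion[symmetric, OF hi2])
  also have "\<dots> = (LINT y|lebesgue. LINT x|lebesgue. f (x, y))"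
    by (rule integral_cong_AE[OF hm fm eq])
  finally show "(LINT z|lebesgue. f z) = (LINT y|lebesgue. LINT x|lebesgue. f (x, y))" .
qed

lemma borel_measurable_coordinate:
  fixes v :: "'z \<Rightarrow> nat \<Rightarrow> 'b::topological_space"
  assumes "v \<in> borel_measurable M"
  shows "(\<lambda>z. v z i) \<in> borel_measurable M"
  using measurable_compose[OF assms borel_measurable_continuous_onI[of "\<lambda>w. w i"]]
  by (simp add: continuous_on_product_coordinates)

lemma borel_measurable_if_zero:
  fixes f :: "'a::euclidean_space \<Rightarrow> 'b::euclidean_space"
  assumes "f \<in> borel_measurable (lebesgue_on S)" "W \<in> sets lebesgue" "W \<subseteq> S" "S \<in> sets lebesgue"
  shows "(\<lambda>z. indicator W z *\<^sub>R f z) \<in> borel_measurable lebesgue"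
proof -
  have "(\<lambda>z. if z \<in> S then f z else 0) \<in> borel_measurable lebesgue"
    using assms(1,4) by (simp add: borel_measurable_if)
  then have "(\<lambda>z. indicator W z *\<^sub>R (if z \<in> S then f z else 0)) \<in> borel_measurable lebesgue"
    using assms(2) by (intro borel_measurable_scaleR borel_measurable_indicator)
  moreover have "(\<lambda>z. indicator W z *\<^sub>R (if z \<in> S then f z else 0)) = (\<lambda>z. indicator W z *\<^sub>R f z)"
    using assms(3) by (auto simp: indicator_def fun_eq_iff)
  ultimately show ?thesis by simp
qed


text \<open>Approximate \<open>w\<close> by simple functions. Their values need not lie in \<open>vecs N\<close>, where \<open>A z\<close> is continuous, so they are
first projected there by cutting off the entries from \<open>N\<close> on; this does not affect the limit.\<close>
lemma caratheodory_measurable: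
  fixes A :: "'z::euclidean_space \<Rightarrow> (nat \<Rightarrow> 'b::euclidean_space) \<Rightarrow> nat \<Rightarrow> 'b" and w :: "'z \<Rightarrow> nat \<Rightarrow> 'b"
  assumes S: "S \<in> sets lebesgue"
    and A: "\<And>\<xi>. \<xi> \<in> vecs N \<Longrightarrow> (\<lambda>z. A z \<xi>) \<in> borel_measurable (lebesgue_on S)"
    and cont: "AE z\<in>S in lebesgue. continuous_on (vecs N) (A z)"
    and w: "w \<in> borel_measurable (lebesgue_on S)" "\<And>z. z \<in> S \<Longrightarrow> w z \<in> vecs N"
  shows "(\<lambda>z. A z (w z) i) \<in> borel_measurable (lebesgue_on S)"
proof -
  define P where "P v = (\<lambda>i. if i < N then v i else (0::'b))" for v :: "nat \<Rightarrow> 'b"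
  have P: "P v \<in> vecs N" for v by (simp add: P_def vecs_def)
  have P_id: "v \<in> vecs N \<Longrightarrow> P v = v" for v by (auto simp: P_def vecs_def fun_eq_iff)
  have P_cont: "continuous_on UNIV P"
    unfolding P_def[abs_def]
  proof (rule continuous_on_coordinatewise_then_product)
    show "continuous_on UNIV (\<lambda>v::nat \<Rightarrow> 'b. if i < N then v i else 0)" for i
      by (cases "i < N") (simp_all add: continuous_on_product_coordinates)
  qed
  obtain F where F: "\<And>k. simple_function (lebesgue_on S) (F k)" "\<And>z. z \<in> space (lebesgue_on S) \<Longrightarrow> (\<lambda>k. F k z) \<longlonglongrightarrow> w z"
    using borel_measurable_implies_sequence_metric[OF w(1), of "\<lambda>_. 0"] by blast
  have m: "(\<lambda>z. A z (P (F k z)) i) \<in> borel_measurable (lebesgue_on S)" for k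
  proof -
    have "(\<lambda>z. A z (P v) i) \<in> borel_measurable (lebesgue_on S)" for v
      by (rule borel_measurable_coordinate[OF A[OF P]])
    moreover have "finite (F k ` space (lebesgue_on S))" using F(1) by (simp add: simple_function_def)
    moreover have "F k \<in> measurable (lebesgue_on S) (count_space (F k ` space (lebesgue_on S)))"
    proof (rule measurableI)
      show "F k -` X \<inter> space (lebesgue_on S) \<in> sets (lebesgue_on S)" for X
        by (rule simple_functionD(2)[OF F(1)])
    qed simp
    ultimately show ?thesis
      by (intro measurable_compose_countable'[of "F k ` space (lebesgue_on S)" "\<lambda>v z. A z (P v) i" _ _ "F k"]
          countable_finite)
  qed
  define h where "h k z = (if z \<in> S then A z (P (F k z)) i else 0)" for k z
  have h: "h k \<in> borel_measurable lebesgue" for k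
    unfolding h_def[abs_def] using m S by (rule borel_measurable_if_I)
  have "AE z in lebesgue. lim (\<lambda>k. h k z) = (if z \<in> S then A z (w z) i else 0)"
    using cont
  proof eventually_elim
    case (elim z)
    have "(\<lambda>k. h k z) \<longlonglongrightarrow> (if z \<in> S then A z (w z) i else 0)"
    proof (cases "z \<in> S")
      case True
      then have Fz: "(\<lambda>k. F k z) \<longlonglongrightarrow> w z" using F(2) by simp
      have "(\<lambda>k. P (F k z)) \<longlonglongrightarrow> P (w z)"
        by (rule continuous_on_tendsto_compose[OF P_cont Fz]) simp_all
      then have "(\<lambda>k. A z (P (F k z))) \<longlonglongrightarrow> A z (w z)"
        unfolding P_id[OF w(2)[OF True]]
        by (rule continuous_on_tendsto_compose[OF elim[rule_format, OF True]]) (use P w(2)[OF True] in simp_all)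
      then have "(\<lambda>k. A z (P (F k z)) i) \<longlonglongrightarrow> A z (w z) i"
        by (rule continuous_on_tendsto_compose[OF continuous_on_product_coordinates]) simp_all
      then show ?thesis using True by (simp add: h_def)
    qed (simp add: h_def)
    then show ?case by (rule limI)
  qed
  then have "(\<lambda>z. if z \<in> S then A z (w z) i else 0) \<in> borel_measurable lebesgue"
    by (rule borel_measurable_AE[OF borel_measurable_lim_metric[OF h]])
  then show ?thesis using S by (simp add: borel_measurable_if)
qed

section \<open>Test functions and systems in coordinates\<close>

lemma vnorm_nonneg [simp]: "0 \<le> vnorm N v"
  by (simp add: vnorm_def L2_set_nonneg)

lemma norm_sum_scaleR_le_vnorm:
  fixes w :: "nat \<Rightarrow> 'b::real_normed_vector"
  shows "norm (\<Sum>i<N. e i *\<^sub>R w i) \<le> vnorm N e * vnorm N w"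
proof -
  have "norm (\<Sum>i<N. e i *\<^sub>R w i) \<le> (\<Sum>i<N. norm (e i *\<^sub>R w i))" by (rule norm_sum)
  also have "\<dots> = (\<Sum>i<N. \<bar>norm (e i)\<bar> * \<bar>norm (w i)\<bar>)" by simp
  also have "\<dots> \<le> vnorm N e * vnorm N w" unfolding vnorm_def by (rule L2_set_mult_ineq)
  finally show ?thesis .
qed

lemma vnorm_power2: "(vnorm N (y :: nat \<Rightarrow> real))\<^sup>2 = (\<Sum>i<N. y i * y i)"
  unfolding vnorm_def L2_set_def by (simp add: sum_nonneg power2_eq_square)

text \<open>Duality reduces estimates for vectors to estimates for their components in unit directions, without a factor
depending on \<open>N\<close>.\<close>
lemma vnorm_le_dual:
  assumes "\<And>e. vnorm N e = 1 \<Longrightarrow> (\<Sum>i<N. e i * y i) \<le> K" "0 \<le> K"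
  shows "vnorm N (y :: nat \<Rightarrow> real) \<le> K"
proof (cases "vnorm N y = 0")
  case False
  then have pos: "0 < vnorm N y" using vnorm_nonneg[of N y] by linarith
  have "(vnorm N (\<lambda>i. y i / vnorm N y))\<^sup>2 = (\<Sum>i<N. y i * y i) / (vnorm N y * vnorm N y)"
    unfolding vnorm_power2 by (simp add: sum_divide_distrib)
  also have "\<dots> = 1" using pos by (simp add: power2_eq_square flip: vnorm_power2)
  finally have "(vnorm N (\<lambda>i. y i / vnorm N y))\<^sup>2 = 1" .
  then have "vnorm N (\<lambda>i. y i / vnorm N y) = 1"
    using vnorm_nonneg[of N "\<lambda>i. y i / vnorm N y"] by (simp add: power2_eq_1_iff)
  from assms(1)[OF this] have "(\<Sum>i<N. y i * y i) / vnorm N y \<le> K"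
    by (simp add: sum_divide_distrib)
  then show ?thesis using pos by (simp add: power2_eq_square flip: vnorm_power2)
qed (use assms in simp)

lemma vnorm_triangle: "vnorm N (\<lambda>i. a i + b i) \<le> vnorm N a + vnorm N (b :: nat \<Rightarrow> 'b::real_normed_vector)"
proof -
  have "vnorm N (\<lambda>i. a i + b i) \<le> L2_set (\<lambda>i. norm (a i) + norm (b i)) {..<N}"
    unfolding vnorm_def by (intro L2_set_mono) (auto intro: norm_triangle_ineq)
  also have "\<dots> \<le> vnorm N a + vnorm N b" unfolding vnorm_def by (rule L2_set_triangle_ineq)
  finally show ?thesis .
qed

lemma vnorm_scaleR: "vnorm N (\<lambda>i. c *\<^sub>R w i) = \<bar>c\<bar> * vnorm N w"
  unfolding vnorm_def by (simp add: L2_set_right_distrib)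

lemma norm_le_vnorm: "i < N \<Longrightarrow> norm (w i) \<le> vnorm N w"
  unfolding vnorm_def by (intro member_le_L2_set[of "{..<N}" i "\<lambda>i. norm (w i)"]) auto

lemma borel_measurable_vnorm:
  fixes w :: "'z \<Rightarrow> nat \<Rightarrow> 'b::{real_normed_vector, second_countable_topology}"
  assumes "\<And>i. i < N \<Longrightarrow> (\<lambda>z. w z i) \<in> borel_measurable M"
  shows "(\<lambda>z. vnorm N (w z)) \<in> borel_measurable M"
proof -
  have "(\<lambda>z. (norm (w z i))\<^sup>2) \<in> borel_measurable M" if "i \<in> {..<N}" for i
  proof -
    have "(\<lambda>z. w z i) \<in> borel_measurable M" using assms that by simp
    then show ?thesis by measurable
  qed
  then have "(\<lambda>z. \<Sum>i<N. (norm (w z i))\<^sup>2) \<in> borel_measurable M" by (rule borel_measurable_sum)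
  then show ?thesis
    unfolding vnorm_def L2_set_def
    by (rule borel_measurable_continuous_on[rotated]) (intro continuous_intros)
qed

lemma test_functions_smooth: "f \<in> test_functions S \<Longrightarrow> smooth f"
  by (simp add: test_functions_def smooth_def)

lemma test_function_support:
  assumes "f \<in> test_functions S"
  obtains K where "compact K" "K \<subseteq> S" "closed K" "\<And>x. x \<notin> K \<Longrightarrow> f x = 0"
    "\<And>x e. x \<notin> K \<Longrightarrow> frechet_derivative f (at x) e = 0"
proof -
  let ?K = "closure {x. f x \<noteq> 0}"
  have K: "compact ?K" "?K \<subseteq> S" using assms by (auto simp: test_functions_def compactly_contained_def)
  have z: "f x = 0" if "x \<notin> ?K" for x using that closure_subset[of "{x. f x \<noteq> 0}"] by auto
  have d: "frechet_derivative f (at x) e = 0" if x: "x \<notin> ?K" for x e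
  proof -
    have "((\<lambda>_. 0) has_derivative (\<lambda>_. 0)) (at x)" by simp
    then have "(f has_derivative (\<lambda>_. 0)) (at x)"
    proof (rule has_derivative_transform_within_open)
      show "open (- ?K)" by (rule open_Compl[OF closed_closure])
      show "x \<in> - ?K" using x by simp
      show "0 = f y" if "y \<in> - ?K" for y using z[of y] that by simp
    qed
    from frechet_derivative_at[OF this, symmetric] show ?thesis by simp
  qed
  show ?thesis by (rule that[OF K closed_closure z d])
qed

lemma continuous_compact_support_bounded:
  fixes f :: "'a::euclidean_space \<Rightarrow> real"
  assumes "continuous_on UNIV f" "compact K" "\<And>x. x \<notin> K \<Longrightarrow> f x = 0"
  obtains C where "\<And>x. \<bar>f x\<bar> \<le> C"
proof -
  have "compact (f ` K)" using assms by (intro compact_continuous_image continuous_on_subset[OF assms(1)]) auto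
  then obtain C where C: "0 < C" "\<forall>y\<in>f ` K. norm y \<le> C" using compact_imp_bounded bounded_pos by blast
  have "\<bar>f x\<bar> \<le> C" for x using C assms(3)[of x] by (cases "x \<in> K") auto
  then show ?thesis by (rule that)
qed

lemma test_function_bounded:
  assumes "f \<in> test_functions S"
  obtains C where "\<And>x. \<bar>f x\<bar> \<le> C"
proof -
  obtain K where K: "compact K" "K \<subseteq> S" "closed K" "\<And>x. x \<notin> K \<Longrightarrow> f x = 0"
    "\<And>x e. x \<notin> K \<Longrightarrow> frechet_derivative f (at x) e = 0"
    by (rule test_function_support[OF assms]) (rule that)
  show ?thesis
  proof (rule continuous_compact_support_bounded[OF smooth_continuous[OF test_functions_smooth[OF assms]] K(1)])
    show "f x = 0" if "x \<notin> K" for x using K(4) that .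
    show thesis if "\<And>x. \<bar>f x\<bar> \<le> C" for C using that by (rule \<open>\<And>C. (\<And>x. \<bar>f x\<bar> \<le> C) \<Longrightarrow> thesis\<close>)
  qed
qed

lemma test_function_partial:
  assumes "f \<in> test_functions S" "b \<in> Basis"
  shows "(\<lambda>x. frechet_derivative f (at x) b) \<in> test_functions S"
proof -
  obtain K where K: "compact K" "K \<subseteq> S" "closed K" "\<And>x. x \<notin> K \<Longrightarrow> f x = 0"
    "\<And>x e. x \<notin> K \<Longrightarrow> frechet_derivative f (at x) e = 0"
    by (rule test_function_support[OF assms(1)]) (rule that)
  show ?thesis
    by (rule test_functionsI[OF smooth_partial[OF test_functions_smooth[OF assms(1)] assms(2)] _ K(1,2)])
       (use K(5) in blast)
qed

lemma integrable_mult_test_functions: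
  fixes g :: "'a::euclidean_space \<times> real \<Rightarrow> real"
  assumes g: "integrable lebesgue g" and "\<eta> \<in> test_functions S" "\<theta> \<in> test_functions J"
  shows "integrable lebesgue (\<lambda>z. g z * (\<eta> (fst z) * \<theta> (snd z)))"
proof -
  obtain C where C: "\<And>x. \<bar>\<eta> x\<bar> \<le> C" by (rule test_function_bounded[OF assms(2)]) (rule that)
  obtain C' where C': "\<And>x. \<bar>\<theta> x\<bar> \<le> C'" by (rule test_function_bounded[OF assms(3)]) (rule that)
  show ?thesis
  proof (rule integrable_mult_bounded[OF g])
    show "(\<lambda>z. \<eta> (fst z) * \<theta> (snd z)) \<in> borel_measurable lebesgue"
      by (intro borel_measurable_times borel_fst borel_snd borel_measurable_smooth)
         (use assms test_functions_smooth in auto)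
    show "\<bar>\<eta> (fst z) * \<theta> (snd z)\<bar> \<le> C * C'" for z :: "'a \<times> real"
      unfolding abs_mult by (intro mult_mono C C') (auto intro: order_trans[OF abs_ge_zero C])
  qed
qed

text \<open>Fubini turns the weak gradient on almost every time slice into a weak gradient in space-time, tested with
products.\<close>
lemma space_time_weak_gradient:
  fixes f :: "(real^'n) \<times> real \<Rightarrow> real" and h :: "(real^'n) \<times> real \<Rightarrow> real^'n"
  assumes f: "integrable lebesgue (\<lambda>z. indicator (B \<times> J) z *\<^sub>R f z)"
    and h: "integrable lebesgue (\<lambda>z. indicator (B \<times> J) z *\<^sub>R h z)"
    and weak: "AE t\<in>J in lebesgue. weak_gradient_on B (\<lambda>x. f (x, t)) (\<lambda>x. h (x, t))"
    and \<eta>: "\<eta> \<in> test_functions B" and \<theta>: "\<theta> \<in> test_functions J" and b: "b \<in> Basis"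
  shows "(LINT z|lebesgue. (indicator (B \<times> J) z *\<^sub>R f z) * (frechet_derivative \<eta> (at (fst z)) b * \<theta> (snd z)))
    = - (LINT z|lebesgue. ((indicator (B \<times> J) z *\<^sub>R h z) \<bullet> b) * (\<eta> (fst z) * \<theta> (snd z)))"
proof -
  obtain j where j: "b = axis j 1" using b by (auto simp: Basis_vec_def)
  have i1: "integrable lebesgue (\<lambda>z. (indicator (B \<times> J) z *\<^sub>R f z) * (frechet_derivative \<eta> (at (fst z)) b * \<theta> (snd z)))"
    by (rule integrable_mult_test_functions[OF f test_function_partial[OF \<eta> b] \<theta>])
  have i2: "integrable lebesgue (\<lambda>z. ((indicator (B \<times> J) z *\<^sub>R h z) \<bullet> b) * (\<eta> (fst z) * \<theta> (snd z)))"
    by (rule integrable_mult_test_functions[OF integrable_bounded_linear[OF bounded_linear_inner_left h] \<eta> \<theta>])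
  have e1: "(LINT x|lebesgue. (indicator (B \<times> J) (x, t) *\<^sub>R f (x, t)) * (frechet_derivative \<eta> (at x) b * \<theta> t))
    = (indicator J t * \<theta> t) * (LINT x:B|lebesgue. f (x, t) * frechet_derivative \<eta> (at x) (axis j 1))" for t
  proof -
    have "(LINT x|lebesgue. (indicator (B \<times> J) (x, t) *\<^sub>R f (x, t)) * (frechet_derivative \<eta> (at x) b * \<theta> t))
      = (LINT x|lebesgue. (indicator J t * \<theta> t) * (indicator B x *\<^sub>R (f (x, t) * frechet_derivative \<eta> (at x) (axis j 1))))"
      by (intro Bochner_Integration.integral_cong refl) (simp add: indicator_times j mult_ac)
    then show ?thesis unfolding set_lebesgue_integral_def by (simp only: integral_mult_right_zero)
  qed
  have e2: "(LINT x|lebesgue. ((indicator (B \<times> J) (x, t) *\<^sub>R h (x, t)) \<bullet> b) * (\<eta> x * \<theta> t))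
    = (indicator J t * \<theta> t) * (LINT x:B|lebesgue. h (x, t) $ j * \<eta> x)" for t
  proof -
    have "(LINT x|lebesgue. ((indicator (B \<times> J) (x, t) *\<^sub>R h (x, t)) \<bullet> b) * (\<eta> x * \<theta> t))
      = (LINT x|lebesgue. (indicator J t * \<theta> t) * (indicator B x *\<^sub>R (h (x, t) $ j * \<eta> x)))"
      by (intro Bochner_Integration.integral_cong refl) (simp add: indicator_times j inner_axis mult_ac)
    then show ?thesis unfolding set_lebesgue_integral_def by (simp only: integral_mult_right_zero)
  qed
  have "(LINT t|lebesgue. (indicator J t * \<theta> t) * (LINT x:B|lebesgue. f (x, t) * frechet_derivative \<eta> (at x) (axis j 1)))
    = (LINT t|lebesgue. - ((indicator J t * \<theta> t) * (LINT x:B|lebesgue. h (x, t) $ j * \<eta> x)))"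
  proof (rule integral_cong_AE)
    show "AE t in lebesgue. (indicator J t * \<theta> t) * (LINT x:B|lebesgue. f (x, t) * frechet_derivative \<eta> (at x) (axis j 1))
       = - ((indicator J t * \<theta> t) * (LINT x:B|lebesgue. h (x, t) $ j * \<eta> x))"
      using weak
    proof eventually_elim
      case (elim t)
      show ?case
      proof (cases "t \<in> J")
        case True
        with elim \<eta> have "(LINT x:B|lebesgue. f (x, t) * frechet_derivative \<eta> (at x) (axis j 1))
          = - (LINT x:B|lebesgue. h (x, t) $ j * \<eta> x)" unfolding weak_gradient_on_def by blast
        then show ?thesis by simp
      qed simp
    qed
    show fm: "(\<lambda>t. (indicator J t * \<theta> t) * (LINT x:B|lebesgue. f (x, t) * frechet_derivative \<eta> (at x) (axis j 1)))
        \<in> borel_measurable lebesgue"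
      using integral_lebesgue_slices(2)[OF i1] by (simp only: e1 fst_conv snd_conv)
    show "(\<lambda>t. - ((indicator J t * \<theta> t) * (LINT x:B|lebesgue. h (x, t) $ j * \<eta> x))) \<in> borel_measurable lebesgue"
      using integral_lebesgue_slices(2)[OF i2] by (simp only: e2 fst_conv snd_conv borel_measurable_uminus)
  qed
  then show ?thesis
    unfolding integral_lebesgue_slices(1)[OF i1] integral_lebesgue_slices(1)[OF i2]
    by (simp only: e1 e2 fst_conv snd_conv Bochner_Integration.integral_minus)
qed

section \<open>The equation in terms of the flux\<close>

lemma product_test_function:
  fixes \<eta> :: "'a::euclidean_space \<Rightarrow> real" and \<zeta> :: "real \<Rightarrow> real"
  assumes \<eta>: "\<eta> \<in> test_functions B" and \<zeta>: "\<zeta> \<in> test_functions J" and U: "B \<times> J \<subseteq> U"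
  shows "(\<lambda>z. c * (\<eta> (fst z) * \<zeta> (snd z))) \<in> test_functions U"
    and "frechet_derivative (\<lambda>z. c * (\<eta> (fst z) * \<zeta> (snd z))) (at z) d
      = c * (\<eta> (fst z) * frechet_derivative \<zeta> (at (snd z)) (snd d)
             + frechet_derivative \<eta> (at (fst z)) (fst d) * \<zeta> (snd z))"
proof -
  obtain K where K: "compact K" "K \<subseteq> B" "closed K" "\<And>x. x \<notin> K \<Longrightarrow> \<eta> x = 0"
    "\<And>x e. x \<notin> K \<Longrightarrow> frechet_derivative \<eta> (at x) e = 0"
    by (rule test_function_support[OF \<eta>]) (rule that)
  obtain K' where K': "compact K'" "K' \<subseteq> J" "closed K'" "\<And>x. x \<notin> K' \<Longrightarrow> \<zeta> x = 0"
    "\<And>x e. x \<notin> K' \<Longrightarrow> frechet_derivative \<zeta> (at x) e = 0"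
    by (rule test_function_support[OF \<zeta>]) (rule that)
  have "smooth (\<lambda>z. \<eta> (fst z + 0))" "smooth (\<lambda>z. \<zeta> (snd z + 0))"
    by (rule smooth_affine[OF test_functions_smooth[OF \<eta>] bounded_linear_fst],
        rule smooth_affine[OF test_functions_smooth[OF \<zeta>] bounded_linear_snd])
  then have "smooth (\<lambda>z. c * (\<eta> (fst z) * \<zeta> (snd z)))" by (intro smooth_mult smooth_const) simp_all
  then show "(\<lambda>z. c * (\<eta> (fst z) * \<zeta> (snd z))) \<in> test_functions U"
  proof (rule test_functionsI[OF _ _ compact_Times[OF K(1) K'(1)]])
    show "z \<in> K \<times> K'" if "c * (\<eta> (fst z) * \<zeta> (snd z)) \<noteq> 0" for z
      using that K(4)[of "fst z"] K'(4)[of "snd z"] by (cases z) auto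
    show "K \<times> K' \<subseteq> U" using K(2) K'(2) U by blast
  qed
  have d1: "((\<lambda>z. \<eta> (fst z)) has_derivative (\<lambda>d. frechet_derivative \<eta> (at (fst z)) (fst d))) (at z)"
    by (rule has_derivative_compose[OF has_derivative_fst[OF has_derivative_ident]])
       (simp add: frechet_derivative_works[symmetric] smooth_differentiable test_functions_smooth[OF \<eta>])
  have d2: "((\<lambda>z. \<zeta> (snd z)) has_derivative (\<lambda>d. frechet_derivative \<zeta> (at (snd z)) (snd d))) (at z)"
    by (rule has_derivative_compose[OF has_derivative_snd[OF has_derivative_ident]])
       (simp add: frechet_derivative_works[symmetric] smooth_differentiable test_functions_smooth[OF \<zeta>])
  show "frechet_derivative (\<lambda>z. c * (\<eta> (fst z) * \<zeta> (snd z))) (at z) d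
      = c * (\<eta> (fst z) * frechet_derivative \<zeta> (at (snd z)) (snd d)
             + frechet_derivative \<eta> (at (fst z)) (fst d) * \<zeta> (snd z))"
    using fun_cong[OF frechet_derivative_at[OF has_derivative_mult_right[OF has_derivative_mult[OF d1 d2], of c]], of d]
    by simp
qed

lemma frechet_derivative_axis_expand:
  fixes f :: "real^'n \<Rightarrow> real"
  assumes "f differentiable (at x)"
  shows "frechet_derivative f (at x) v = (\<Sum>j\<in>UNIV. v $ j * frechet_derivative f (at x) (axis j 1))"
proof -
  have lin: "linear (frechet_derivative f (at x))" using assms by (rule linear_frechet_derivative)
  have "frechet_derivative f (at x) v = frechet_derivative f (at x) (\<Sum>j\<in>UNIV. v $ j *\<^sub>R axis j 1)"
    by (subst basis_expansion[of v, symmetric]) (simp add: scalar_mult_eq_scaleR)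
  also have "\<dots> = (\<Sum>j\<in>UNIV. v $ j * frechet_derivative f (at x) (axis j 1))"
    using lin by (simp add: linear_sum linear_cmul)
  finally show ?thesis .
qed

lemma integrable_frechet_pairing:
  fixes V :: "'a::euclidean_space \<times> real \<Rightarrow> 'a"
  assumes V: "integrable lebesgue V" and \<eta>: "\<eta> \<in> test_functions B" and \<zeta>: "\<zeta> \<in> test_functions J"
  shows "integrable lebesgue (\<lambda>z. frechet_derivative \<eta> (at (fst z)) (V z) * \<zeta> (snd z))"
proof -
  have "integrable lebesgue (\<lambda>z. \<Sum>b\<in>Basis. (V z \<bullet> b) * (frechet_derivative \<eta> (at (fst z)) b * \<zeta> (snd z)))"
  proof (rule Bochner_Integration.integrable_sum)
    fix b :: 'a assume b: "b \<in> Basis"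
    show "integrable lebesgue (\<lambda>z. (V z \<bullet> b) * (frechet_derivative \<eta> (at (fst z)) b * \<zeta> (snd z)))"
      by (rule integrable_mult_test_functions[OF integrable_bounded_linear[OF bounded_linear_inner_left V]
            test_function_partial[OF \<eta> b] \<zeta>])
  qed
  moreover have "(\<Sum>b\<in>Basis. (V z \<bullet> b) * (frechet_derivative \<eta> (at (fst z)) b * \<zeta> (snd z)))
      = frechet_derivative \<eta> (at (fst z)) (V z) * \<zeta> (snd z)" for z
    using frechet_derivative_expand[OF smooth_differentiable[OF test_functions_smooth[OF \<eta>]], of "fst z" "V z"]
    by (simp add: sum_distrib_right mult.assoc)
  ultimately show ?thesis by simp
qed

lemma integrable_dominated_AE:
  fixes f :: "'z::euclidean_space \<Rightarrow> 'b::euclidean_space"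
  assumes "integrable lebesgue g" "f \<in> borel_measurable lebesgue" "AE z in lebesgue. norm (f z) \<le> g z"
  shows "integrable lebesgue f"
  by (rule Bochner_Integration.integrable_bound[OF assms(1,2)])
     (use assms(3) in \<open>eventually_elim, simp\<close>)

lemma powr_diff_mult: "0 \<le> (x::real) \<Longrightarrow> x powr (p - 2) * x = x powr (p - 1)"
  by (cases "x = 0") (use powr_add[of x "p - 2" 1] in \<open>auto simp: powr_one\<close>)

context
  fixes p q L T \<nu> :: real and \<Omega> :: "(real^'n) set" and N :: nat and A F u Du B J W H
    and Q :: "(real^'n) \<times> real \<Rightarrow> nat \<Rightarrow> real^'n"
  assumes sys: "parabolic_system p q L \<Omega> T N \<nu> A F u Du" and p: "1 < p"
    and W: "W = B \<times> J" "W \<subseteq> space_time \<Omega> T" "W \<in> sets lebesgue"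
    and u_int: "\<And>i. i < N \<Longrightarrow> integrable lebesgue (\<lambda>z. indicator W z *\<^sub>R u z i)"
    and H: "H = (\<lambda>z. indicator W z *\<^sub>R (vnorm N (Du z) + vnorm N (F z)) powr (p - 1))"
    and H_int: "integrable lebesgue H"
    and Q: "Q = (\<lambda>z i. A z (Du z) i - vnorm N (F z) powr (p - 2) *\<^sub>R F z i)"
begin

lemma space_time_measurable: "space_time \<Omega> T \<in> sets lebesgue"
proof -
  have "open (space_time \<Omega> T)" using sys by (auto simp: parabolic_system_def intro: open_Times)
  then have "space_time \<Omega> T \<in> sets borel" by (rule borel_open)
  then show ?thesis by auto
qed

lemma cut_measurable:
  fixes f :: "(real^'n) \<times> real \<Rightarrow> 'b::euclidean_space"
  assumes "f \<in> borel_measurable (lebesgue_on (space_time \<Omega> T))"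
  shows "(\<lambda>z. indicator W z *\<^sub>R f z) \<in> borel_measurable lebesgue"
  by (rule borel_measurable_if_zero[OF assms W(3,2) space_time_measurable])

text \<open>The bound for \<open>Q\<close> combines the growth of the vector field with \<open>||F|^(p-2) F| = |F|^(p-1)\<close>; the value
\<open>0 powr (p - 2) = 0\<close> makes the latter true also where \<open>F\<close> vanishes.\<close>
lemma elliptic_part_integrable: "i < N \<Longrightarrow> integrable lebesgue (\<lambda>z. indicator W z *\<^sub>R A z (Du z) i)"
  and forcing_part_integrable: "i < N \<Longrightarrow> integrable lebesgue (\<lambda>z. indicator W z *\<^sub>R (vnorm N (F z) powr (p - 2) *\<^sub>R F z i))"
  and flux_bound: "AE z in lebesgue. indicator W z * vnorm N (Q z) \<le> (L + 1) * H z"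
proof -
  have L: "0 < L" and ps: "p_structure N p \<nu> L (space_time \<Omega> T) A"
    and Fm: "F \<in> borel_measurable (lebesgue_on (space_time \<Omega> T))"
    and Dum: "Du \<in> borel_measurable (lebesgue_on (space_time \<Omega> T))"
    and Duv: "\<And>z. z \<in> space_time \<Omega> T \<Longrightarrow> Du z \<in> vecs N"
    using sys by (auto simp: parabolic_system_def Lm_loc_W1m_loc_def)
  let ?FF = "\<lambda>z i. vnorm N (F z) powr (p - 2) *\<^sub>R F z i"
  have FF: "vnorm N (?FF z) = vnorm N (F z) powr (p - 1)" for z
    by (simp add: vnorm_scaleR powr_diff_mult)
  have FF_H: "indicator W z * vnorm N (?FF z) \<le> H z" for z
    unfolding H FF using p by (auto simp: indicator_def intro!: powr_mono2)
  have A_H: "AE z in lebesgue. indicator W z * vnorm N (A z (Du z)) \<le> L * H z"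
  proof -
    have "AE z\<in>space_time \<Omega> T in lebesgue. \<forall>\<xi>\<in>vecs N.
        \<nu> * vnorm N \<xi> powr p \<le> vinner N (A z \<xi>) \<xi> \<and> vnorm N (A z \<xi>) \<le> L * vnorm N \<xi> powr (p - 1)"
      using ps unfolding p_structure_def by blast
    then show ?thesis
    proof eventually_elim
      case (elim z)
      show ?case
      proof (cases "z \<in> W")
        case True
        then have "z \<in> space_time \<Omega> T" using W(2) by blast
        with elim Duv have "vnorm N (A z (Du z)) \<le> L * vnorm N (Du z) powr (p - 1)" by blast
        also have "\<dots> \<le> L * (vnorm N (Du z) + vnorm N (F z)) powr (p - 1)"
          using L p by (intro mult_left_mono powr_mono2) auto
        finally show ?thesis using True by (simp add: H)
      qed (simp add: H)
    qed
  qed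
  show "integrable lebesgue (\<lambda>z. indicator W z *\<^sub>R A z (Du z) i)" if i: "i < N"
  proof (rule integrable_dominated_AE[of "\<lambda>z. L * H z"])
    show "integrable lebesgue (\<lambda>z. L * H z)" using H_int by simp
    show "(\<lambda>z. indicator W z *\<^sub>R A z (Du z) i) \<in> borel_measurable lebesgue"
    proof (rule cut_measurable, rule caratheodory_measurable[OF space_time_measurable _ _ Dum Duv])
      show "(\<lambda>z. A z \<xi>) \<in> borel_measurable (lebesgue_on (space_time \<Omega> T))" if "\<xi> \<in> vecs N" for \<xi>
        using ps that unfolding p_structure_def by blast
      show "AE z\<in>space_time \<Omega> T in lebesgue. continuous_on (vecs N) (A z)"
        using ps unfolding p_structure_def by blast
    qed
    show "AE z in lebesgue. norm (indicator W z *\<^sub>R A z (Du z) i) \<le> L * H z"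
      using A_H
    proof eventually_elim
      case (elim z)
      show ?case using norm_le_vnorm[OF i, of "A z (Du z)"] elim by (auto simp: indicator_def split: if_splits)
    qed
  qed
  show "integrable lebesgue (\<lambda>z. indicator W z *\<^sub>R ?FF z i)" if i: "i < N"
  proof (rule integrable_dominated_AE[OF H_int])
    have "(\<lambda>z. vnorm N (F z)) \<in> borel_measurable (lebesgue_on (space_time \<Omega> T))"
      by (rule borel_measurable_vnorm) (rule borel_measurable_coordinate[OF Fm])
    then have "(\<lambda>z. ?FF z i) \<in> borel_measurable (lebesgue_on (space_time \<Omega> T))"
      using borel_measurable_coordinate[OF Fm, of i] by measurable
    then show "(\<lambda>z. indicator W z *\<^sub>R ?FF z i) \<in> borel_measurable lebesgue" by (rule cut_measurable)
    have "norm (indicator W z *\<^sub>R ?FF z i) \<le> H z" for z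
      using norm_le_vnorm[OF i, of "?FF z"] FF_H[of z] by (auto simp: indicator_def split: if_splits)
    then show "AE z in lebesgue. norm (indicator W z *\<^sub>R ?FF z i) \<le> H z" by simp
  qed
  show "AE z in lebesgue. indicator W z * vnorm N (Q z) \<le> (L + 1) * H z"
    using A_H
  proof eventually_elim
    case (elim z)
    have "vnorm N (Q z) \<le> vnorm N (A z (Du z)) + vnorm N (\<lambda>i. (-1) *\<^sub>R ?FF z i)"
      using vnorm_triangle[of N "A z (Du z)" "\<lambda>i. (-1) *\<^sub>R ?FF z i"] by (simp add: Q)
    also have "vnorm N (\<lambda>i. (-1) *\<^sub>R ?FF z i) = vnorm N (?FF z)" by (simp add: vnorm_def)
    finally have "indicator W z * vnorm N (Q z) \<le> indicator W z * vnorm N (A z (Du z)) + indicator W z * vnorm N (?FF z)"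
      by (auto simp: indicator_def)
    then show ?case using elim FF_H[of z] by (simp add: distrib_right)
  qed
qed

lemma flux_integrable: "i < N \<Longrightarrow> integrable lebesgue (\<lambda>z. indicator W z *\<^sub>R Q z i)"
  using Bochner_Integration.integrable_diff[OF elliptic_part_integrable forcing_part_integrable, of i i] by (simp add: Q scaleR_right_diff_distrib)

text \<open>The system tested with \<open>\<eta>(x) \<zeta>(t) e\<close>. The integrals over space-time may be replaced by integrals of functions cut
off outside \<open>W\<close>, where the test function and its derivatives vanish; since the three terms are separately integrable, the
equation can be rearranged.\<close>
lemma flux_identity:
  assumes \<eta>: "\<eta> \<in> test_functions B" and \<zeta>: "\<zeta> \<in> test_functions J"
  shows "(LINT z|lebesgue. (\<Sum>i<N. e i *\<^sub>R (indicator W z *\<^sub>R u z i)) * (\<eta> (fst z) * frechet_derivative \<zeta> (at (snd z)) 1))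
    = (LINT z|lebesgue. frechet_derivative \<eta> (at (fst z)) (\<Sum>i<N. e i *\<^sub>R (indicator W z *\<^sub>R Q z i)) * \<zeta> (snd z))"
proof -
  let ?U = "space_time \<Omega> T"
  let ?FF = "\<lambda>z i. vnorm N (F z) powr (p - 2) *\<^sub>R F z i"
  let ?D = "\<lambda>z :: (real^'n) \<times> real. frechet_derivative \<eta> (at (fst z))"
  let ?d = "\<lambda>z :: (real^'n) \<times> real. frechet_derivative \<zeta> (at (snd z)) 1"
  define \<phi> where "\<phi> z i = (if i < N then e i * (\<eta> (fst z) * \<zeta> (snd z)) else 0)" for z i
  have U: "B \<times> J \<subseteq> ?U" using W by simp
  have D_lin: "linear (?D z)" for z
    by (intro linear_frechet_derivative smooth_differentiable test_functions_smooth[OF \<eta>])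
  have \<zeta>_lin: "linear (frechet_derivative \<zeta> (at \<tau>))" for \<tau>
    by (intro linear_frechet_derivative smooth_differentiable test_functions_smooth[OF \<zeta>])
  have \<phi>: "\<phi> \<in> vec_test_functions N ?U"
    unfolding vec_test_functions_def using product_test_function(1)[OF \<eta> \<zeta> U]
    by (auto simp: \<phi>_def[abs_def] vecs_def)
  have \<phi>_i: "(\<lambda>z. \<phi> z i) = (\<lambda>z. e i * (\<eta> (fst z) * \<zeta> (snd z)))" if "i < N" for i
    using that by (simp add: \<phi>_def)
  have td: "vinner N (w z) (time_deriv \<phi> z) = (\<Sum>i<N. e i *\<^sub>R w z i) * (\<eta> (fst z) * ?d z)"
    for w :: "(real^'n) \<times> real \<Rightarrow> nat \<Rightarrow> real" and z
  proof -
    have "time_deriv \<phi> z i = e i * (\<eta> (fst z) * ?d z)" if "i < N" for i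
      unfolding time_deriv_def \<phi>_i[OF that] product_test_function(2)[OF \<eta> \<zeta> U]
      using linear_0[OF D_lin] by simp
    then show ?thesis unfolding vinner_def by (simp add: sum_distrib_left mult_ac)
  qed
  have sg: "vinner N (w z) (space_grad \<phi> z) = ?D z (\<Sum>i<N. e i *\<^sub>R w z i) * \<zeta> (snd z)"
    for w :: "(real^'n) \<times> real \<Rightarrow> nat \<Rightarrow> real^'n" and z
  proof -
    have "w z i \<bullet> space_grad \<phi> z i = e i * ?D z (w z i) * \<zeta> (snd z)" if "i < N" for i
    proof -
      have "space_grad \<phi> z i = (\<chi> j. e i * (?D z (axis j 1) * \<zeta> (snd z)))"
        unfolding space_grad_def \<phi>_i[OF that] product_test_function(2)[OF \<eta> \<zeta> U]
        using linear_0[OF \<zeta>_lin] by simp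
      then have "w z i \<bullet> space_grad \<phi> z i = (\<Sum>j\<in>UNIV. w z i $ j * (e i * (?D z (axis j 1) * \<zeta> (snd z))))"
        by (simp add: inner_vec_def)
      also have "\<dots> = e i * ?D z (w z i) * \<zeta> (snd z)"
        by (subst frechet_derivative_axis_expand[OF smooth_differentiable[OF test_functions_smooth[OF \<eta>]]])
           (simp add: sum_distrib_left sum_distrib_right mult_ac)
      finally show ?thesis .
    qed
    then have "vinner N (w z) (space_grad \<phi> z) = (\<Sum>i<N. e i * ?D z (w z i)) * \<zeta> (snd z)"
      unfolding vinner_def by (simp add: sum_distrib_right)
    then show ?thesis using D_lin by (simp add: linear_sum linear_cmul)
  qed
  let ?a = "\<lambda>z. (\<Sum>i<N. e i *\<^sub>R (indicator W z *\<^sub>R u z i)) * (\<eta> (fst z) * ?d z)"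
  let ?b = "\<lambda>z. ?D z (\<Sum>i<N. e i *\<^sub>R (indicator W z *\<^sub>R A z (Du z) i)) * \<zeta> (snd z)"
  let ?c = "\<lambda>z. ?D z (\<Sum>i<N. e i *\<^sub>R (indicator W z *\<^sub>R ?FF z i)) * \<zeta> (snd z)"
  have \<zeta>': "(\<lambda>\<tau>. frechet_derivative \<zeta> (at \<tau>) 1) \<in> test_functions J"
    by (rule test_function_partial[OF \<zeta>]) simp
  have ia: "integrable lebesgue ?a"
    by (rule integrable_mult_test_functions[OF Bochner_Integration.integrable_sum \<eta> \<zeta>'])
       (use u_int in auto)
  have ib: "integrable lebesgue ?b"
    by (rule integrable_frechet_pairing[OF Bochner_Integration.integrable_sum \<eta> \<zeta>])
       (rule integrable_scaleR_right, use elliptic_part_integrable in auto)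
  have ic: "integrable lebesgue ?c"
    by (rule integrable_frechet_pairing[OF Bochner_Integration.integrable_sum \<eta> \<zeta>])
       (rule integrable_scaleR_right, use forcing_part_integrable in auto)
  have off: "\<eta> (fst z) * ?d z = 0 \<and> (\<forall>v. ?D z v * \<zeta> (snd z) = 0)" if "z \<notin> W" for z
  proof -
    obtain K where K: "compact K" "K \<subseteq> B" "closed K" "\<And>x. x \<notin> K \<Longrightarrow> \<eta> x = 0"
      "\<And>x e. x \<notin> K \<Longrightarrow> frechet_derivative \<eta> (at x) e = 0"
      by (rule test_function_support[OF \<eta>]) (rule that)
    obtain K' where K': "compact K'" "K' \<subseteq> J" "closed K'" "\<And>x. x \<notin> K' \<Longrightarrow> \<zeta> x = 0"
      "\<And>x e. x \<notin> K' \<Longrightarrow> frechet_derivative \<zeta> (at x) e = 0"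
      by (rule test_function_support[OF \<zeta>]) (rule that)
    have "fst z \<notin> K \<or> snd z \<notin> K'" using \<open>z \<notin> W\<close> K(2) K'(2) W(1) by (cases z) auto
    then show ?thesis using K(4,5) K'(4,5) by auto
  qed
  have sum_W: "(\<Sum>i<N. e i *\<^sub>R (indicator W z *\<^sub>R w i)) = (\<Sum>i<N. e i *\<^sub>R w i)" if "z \<in> W"
    for w :: "nat \<Rightarrow> 'b::real_vector" and z
    using that by simp
  have e1: "indicator ?U z *\<^sub>R (- vinner N (u z) (time_deriv \<phi> z) + vinner N (A z (Du z)) (space_grad \<phi> z)) = - ?a z + ?b z" for z
  proof (cases "z \<in> W")
    case True
    then have "z \<in> ?U" using W(2) by blast
    then show ?thesis unfolding td[of u] sg[of "\<lambda>z. A z (Du z)"] sum_W[OF True] by simp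
  next
    case False
    note off = off[OF False, THEN conjunct1] off[OF False, THEN conjunct2, rule_format]
    show ?thesis unfolding td[of u] sg[of "\<lambda>z. A z (Du z)"] off by simp
  qed
  have e2: "indicator ?U z *\<^sub>R vinner N (?FF z) (space_grad \<phi> z) = ?c z" for z
  proof (cases "z \<in> W")
    case True
    then have "z \<in> ?U" using W(2) by blast
    then show ?thesis unfolding sg[of ?FF] sum_W[OF True] by simp
  next
    case False
    note off = off[OF False, THEN conjunct2, rule_format]
    show ?thesis unfolding sg[of ?FF] off by simp
  qed
  have "distributional_solution N p ?U A F u Du" using sys by (simp add: parabolic_system_def)
  then have "(LINT z:?U|lebesgue. - vinner N (u z) (time_deriv \<phi> z) + vinner N (A z (Du z)) (space_grad \<phi> z))
      = (LINT z:?U|lebesgue. vinner N (?FF z) (space_grad \<phi> z))"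
    using \<phi> unfolding distributional_solution_def by (rule bspec)
  then have "(LINT z|lebesgue. - ?a z + ?b z) = (LINT z|lebesgue. ?c z)"
    unfolding set_lebesgue_integral_def by (simp only: e1 e2)
  then have "(LINT z|lebesgue. ?a z) = (LINT z|lebesgue. ?b z - ?c z)"
    using ia ib ic by simp
  also have "\<dots> = (LINT z|lebesgue. ?D z (\<Sum>i<N. e i *\<^sub>R (indicator W z *\<^sub>R Q z i)) * \<zeta> (snd z))"
  proof (intro Bochner_Integration.integral_cong refl)
    fix z
    have "(\<Sum>i<N. e i *\<^sub>R (indicator W z *\<^sub>R Q z i))
      = (\<Sum>i<N. e i *\<^sub>R (indicator W z *\<^sub>R A z (Du z) i)) - (\<Sum>i<N. e i *\<^sub>R (indicator W z *\<^sub>R ?FF z i))"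
      by (simp add: Q scaleR_right_diff_distrib sum_subtractf)
    then show "?b z - ?c z = ?D z (\<Sum>i<N. e i *\<^sub>R (indicator W z *\<^sub>R Q z i)) * \<zeta> (snd z)"
      by (simp only: linear_diff[OF D_lin] left_diff_distrib)
  qed
  finally show ?thesis .
qed

end

section \<open>Strong maximal function and averages over cylinders\<close>

lemma cylinder_compactly_contained:
  fixes x0 :: "real^'n"
  assumes "compactly_contained (par_cyl x0 t0 R) (space_time \<Omega> T)" "0 < R"
  shows "par_cyl x0 t0 R \<subseteq> space_time \<Omega> T" "compactly_contained (ball x0 R) \<Omega>"
    "0 < t0 - R\<^sup>2" "t0 + R\<^sup>2 < T"
proof -
  have sub: "closure (ball x0 R) \<times> closure (time_interval t0 R) \<subseteq> \<Omega> \<times> {0<..<T}"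
    using assms(1) by (simp add: compactly_contained_def par_cyl_def closure_Times)
  have R2: "t0 - R\<^sup>2 < t0 + R\<^sup>2" using assms(2) by simp
  have cJ: "closure (time_interval t0 R) = {t0 - R\<^sup>2..t0 + R\<^sup>2}"
    using closure_greaterThanLessThan[OF R2] .
  have x0: "x0 \<in> closure (ball x0 R)" using assms(2) closure_subset[of "ball x0 R"] by auto
  show "par_cyl x0 t0 R \<subseteq> space_time \<Omega> T"
    using sub closure_subset[of "ball x0 R"] closure_subset[of "time_interval t0 R"]
    unfolding par_cyl_def by blast
  have "{t0 - R\<^sup>2..t0 + R\<^sup>2} \<subseteq> {0<..<T}" using sub x0 unfolding cJ by blast
  moreover have "t0 - R\<^sup>2 \<in> {t0 - R\<^sup>2..t0 + R\<^sup>2}" "t0 + R\<^sup>2 \<in> {t0 - R\<^sup>2..t0 + R\<^sup>2}"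
    using R2 by simp_all
  ultimately have "t0 - R\<^sup>2 \<in> {0<..<T}" "t0 + R\<^sup>2 \<in> {0<..<T}" by blast+
  then show "0 < t0 - R\<^sup>2" "t0 + R\<^sup>2 < T" by simp_all
  have "t0 \<in> closure (time_interval t0 R)" unfolding cJ by simp
  then have "closure (ball x0 R) \<subseteq> \<Omega>" using sub by blast
  then show "compactly_contained (ball x0 R) \<Omega>"
    by (simp add: compactly_contained_def)
qed

lemma emeasure_cylinder:
  fixes x :: "'a::euclidean_space"
  assumes "0 \<le> \<rho>" "a \<le> b"
  shows "emeasure lebesgue (ball x \<rho> \<times> {a<..<b::real}) = ennreal (unit_ball_vol DIM('a) * (\<rho> ^ DIM('a) * (b - a)))"
proof -
  have "ball x \<rho> \<times> {a<..<b} \<in> sets borel"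
    by (intro borel_open open_Times open_ball open_greaterThanLessThan)
  then have "emeasure lebesgue (ball x \<rho> \<times> {a<..<b}) = emeasure (lborel \<Otimes>\<^sub>M lborel) (ball x \<rho> \<times> {a<..<b})"
    by (simp add: lborel_prod)
  also have "\<dots> = emeasure lborel (ball x \<rho>) * emeasure lborel {a<..<b}"
    by (rule lborel.emeasure_pair_measure_Times) auto
  also have "\<dots> = ennreal (unit_ball_vol DIM('a) * (\<rho> ^ DIM('a) * (b - a)))"
    using assms by (simp add: emeasure_ball ennreal_mult unit_ball_vol_nonneg mult.assoc)
  finally show ?thesis .
qed

lemma strong_maximal_cylinder:
  fixes f :: "(real^'n) \<times> real \<Rightarrow> real"
  assumes "strong_maximal f (x, t) \<le> ennreal M" "x \<in> ball y \<rho>" "a < t" "t < b"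
  shows "(\<integral>\<^sup>+\<zeta>\<in>ball y \<rho> \<times> {a<..<b}. ennreal \<bar>f \<zeta>\<bar> \<partial>lebesgue)
    \<le> ennreal M * ennreal (unit_ball_vol CARD('n) * (\<rho> ^ CARD('n) * (b - a)))"
proof -
  have \<rho>: "0 < \<rho>" using assms(2) by (metis mem_ball zero_le_dist order_le_less_trans)
  let ?C = "ball y \<rho> \<times> {a<..<b}"
  let ?I = "\<integral>\<^sup>+\<zeta>\<in>?C. ennreal \<bar>f \<zeta>\<bar> \<partial>lebesgue"
  have em: "emeasure lebesgue ?C = ennreal (unit_ball_vol CARD('n) * (\<rho> ^ CARD('n) * (b - a)))"
    using emeasure_cylinder[of \<rho> a b y] \<rho> assms by simp
  have pos: "0 < unit_ball_vol CARD('n) * (\<rho> ^ CARD('n) * (b - a))"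
    using \<rho> assms by (simp add: unit_ball_vol_pos)
  have "?I / emeasure lebesgue ?C \<le> strong_maximal f (x, t)"
    unfolding strong_maximal_def by (rule SUP_upper2[of "(y, \<rho>, a, b)"]) (use assms in auto)
  then have "?I / emeasure lebesgue ?C \<le> ennreal M" using assms(1) by (rule order_trans)
  then have "?I / emeasure lebesgue ?C * emeasure lebesgue ?C \<le> ennreal M * emeasure lebesgue ?C"
    by (rule mult_right_mono) simp
  moreover have "?I / emeasure lebesgue ?C * emeasure lebesgue ?C = ?I"
  proof -
    have self: "ennreal c / ennreal c = 1" if "0 < c" for c
      using that by (simp add: ennreal_divide_self)
    show ?thesis unfolding em ennreal_divide_times self[OF pos] by simp
  qed
  ultimately show ?thesis unfolding em by simp
qed

text \<open>The integrals are bounded first as integrals of nonnegative functions. If \<open>f\<close> fails to be integrable on the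
cylinder, its Bochner integral is 0 and the bound is trivial.\<close>
lemma strong_maximal_cyl_avg_le:
  fixes f :: "(real^'n) \<times> real \<Rightarrow> real"
  assumes "strong_maximal f (x, t) \<le> ennreal M" "0 \<le> M" "\<And>z. 0 \<le> f z"
  shows "cyl_avg_le f x t (M * unit_ball_vol CARD('n))"
  unfolding cyl_avg_le_def
proof (intro allI impI, elim conjE)
  fix \<rho> a b :: real assume h: "0 < \<rho>" "a < t" "t < b"
  let ?C = "ball x \<rho> \<times> {a<..<b}"
  let ?m = "unit_ball_vol CARD('n) * (\<rho> ^ CARD('n) * (b - a))"
  have m0: "0 \<le> ?m" using h by (simp add: unit_ball_vol_nonneg)
  have "(LINT z|lebesgue. f z * indicator ?C z) \<le> M * ?m"
  proof (cases "integrable lebesgue (\<lambda>z. f z * indicator ?C z)")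
    case True
    have "ennreal (LINT z|lebesgue. f z * indicator ?C z) = (\<integral>\<^sup>+z. ennreal (f z * indicator ?C z) \<partial>lebesgue)"
      by (rule nn_integral_eq_integral[symmetric, OF True]) (use assms(3) in simp)
    also have "\<dots> = (\<integral>\<^sup>+z\<in>?C. ennreal \<bar>f z\<bar> \<partial>lebesgue)"
      by (intro nn_integral_cong) (use assms(3) in \<open>auto simp: indicator_def\<close>)
    also have "\<dots> \<le> ennreal M * ennreal ?m"
      by (rule strong_maximal_cylinder[OF assms(1)]) (use h in auto)
    also have "\<dots> = ennreal (M * ?m)" using assms(2) m0 by (simp add: ennreal_mult)
    finally show ?thesis using assms(2) m0 by (simp add: ennreal_le_iff)
  next
    case False
    then show ?thesis using assms(2) m0 by (simp add: not_integrable_integral_eq)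
  qed
  then show "(LINT z|lebesgue. f z * indicator ?C z) \<le> M * unit_ball_vol CARD('n) * (\<rho> ^ DIM(real^'n) * (b - a))"
    by (simp add: mult_ac)
qed

lemma cyl_avg_le_mono_AE:
  fixes f g :: "'a::euclidean_space \<times> real \<Rightarrow> real"
  assumes "cyl_avg_le g x t M" "integrable lebesgue f" "integrable lebesgue g" "AE z in lebesgue. f z \<le> g z"
  shows "cyl_avg_le f x t M"
  unfolding cyl_avg_le_def
proof (intro allI impI, elim conjE)
  fix \<rho> a b :: real assume h: "0 < \<rho>" "a < t" "t < b"
  let ?C = "ball x \<rho> \<times> {a<..<b}"
  have i: "integrable lebesgue (\<lambda>z. k z * indicator ?C z)" if "integrable lebesgue k" for k :: "'a \<times> real \<Rightarrow> real"
    by (rule integrable_mult_bounded[OF that borel_measurable_indicator[OF cylinder_sets], where C = 1])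
       (simp add: indicator_def)
  have "(LINT z|lebesgue. f z * indicator ?C z) \<le> (LINT z|lebesgue. g z * indicator ?C z)"
    by (rule integral_mono_AE[OF i[OF assms(2)] i[OF assms(3)]])
       (use assms(4) in \<open>eventually_elim, simp add: indicator_def\<close>)
  also have "\<dots> \<le> M * (\<rho> ^ DIM('a) * (b - a))" by (rule cyl_avg_leD[OF assms(1) h])
  finally show "(LINT z|lebesgue. f z * indicator ?C z) \<le> M * (\<rho> ^ DIM('a) * (b - a))" .
qed

lemma cyl_avg_le_mult:
  fixes f :: "'a::euclidean_space \<times> real \<Rightarrow> real"
  assumes "cyl_avg_le f x t M" "0 \<le> c"
  shows "cyl_avg_le (\<lambda>z. c * f z) x t (c * M)"
  unfolding cyl_avg_le_def
proof (intro allI impI, elim conjE)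
  fix \<rho> a b :: real assume h: "0 < \<rho>" "a < t" "t < b"
  show "(LINT z|lebesgue. c * f z * indicator (ball x \<rho> \<times> {a<..<b}) z) \<le> c * M * (\<rho> ^ DIM('a) * (b - a))"
    using mult_left_mono[OF cyl_avg_leD[OF assms(1) h] assms(2)] by (simp add: mult.assoc)
qed

text \<open>The concave function \<open>y powr \<alpha>\<close> lies below its tangent at \<open>M\<close>.\<close>
lemma powr_tangent:
  assumes "0 < \<alpha>" "\<alpha> \<le> 1" "0 < (M::real)" "0 \<le> y"
  shows "y powr \<alpha> \<le> \<alpha> * M powr (\<alpha> - 1) * y + (1 - \<alpha>) * M powr \<alpha>"
proof (cases "y = 0")
  case False
  have "(y / M) powr \<alpha> * 1 powr (1 - \<alpha>) \<le> \<alpha> * (y / M) + (1 - \<alpha>) * 1"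
    by (rule Youngs_inequality_0) (use assms False in auto)
  then have "M powr \<alpha> * (y / M) powr \<alpha> \<le> M powr \<alpha> * (\<alpha> * (y / M) + (1 - \<alpha>))"
    by (intro mult_left_mono) auto
  moreover have "M powr \<alpha> * (y / M) powr \<alpha> = y powr \<alpha>"
    using assms by (simp flip: powr_mult)
  moreover have "\<alpha> * M powr (\<alpha> - 1) * y + (1 - \<alpha>) * M powr \<alpha> = M powr \<alpha> * (\<alpha> * (y / M) + (1 - \<alpha>))"
  proof -
    have e: "M powr (\<alpha> - 1) = M powr \<alpha> / M" using assms by (simp add: powr_diff)
    show ?thesis unfolding e by (simp add: algebra_simps)
  qed
  ultimately show ?thesis by linarith
qed (use assms in simp)

text \<open>Jensen's inequality for averages, by integrating the tangent inequality at \<open>M\<close>.\<close>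
lemma cyl_avg_le_powr:
  fixes f :: "(real^'n) \<times> real \<Rightarrow> real"
  assumes M: "cyl_avg_le f x t (M * unit_ball_vol CARD('n))" "0 < M"
    and f: "integrable lebesgue f" "\<And>z. 0 \<le> f z" and \<alpha>: "0 < \<alpha>" "\<alpha> \<le> 1"
  shows "cyl_avg_le (\<lambda>z. f z powr \<alpha>) x t (M powr \<alpha> * unit_ball_vol CARD('n))"
  unfolding cyl_avg_le_def
proof (intro allI impI, elim conjE)
  fix \<rho> a b :: real assume h: "0 < \<rho>" "a < t" "t < b"
  let ?C = "ball x \<rho> \<times> {a<..<b}"
  let ?m = "unit_ball_vol CARD('n) * (\<rho> ^ CARD('n) * (b - a))"
  have m0: "0 \<le> ?m" using h by (simp add: unit_ball_vol_nonneg)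
  have em: "emeasure lebesgue ?C = ennreal ?m" using emeasure_cylinder[of \<rho> a b x] h by simp
  have i: "integrable lebesgue (\<lambda>z. f z * indicator ?C z)"
    by (rule integrable_mult_bounded[OF f(1) borel_measurable_indicator[OF cylinder_sets], where C = 1])
       (simp add: indicator_def)
  have iC: "integrable lebesgue (indicator ?C :: _ \<Rightarrow> real)"
    by (rule integrable_real_indicator[OF cylinder_sets]) (simp add: em)
  have LC: "(LINT z|lebesgue. indicator ?C z) = ?m"
    using m0 by (simp add: measure_def em)
  have i2: "integrable lebesgue (\<lambda>z. \<alpha> * M powr (\<alpha> - 1) * (f z * indicator ?C z) + (1 - \<alpha>) * M powr \<alpha> * indicator ?C z)"
    using i iC by simp
  have "(LINT z|lebesgue. f z powr \<alpha> * indicator ?C z)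
      \<le> (LINT z|lebesgue. \<alpha> * M powr (\<alpha> - 1) * (f z * indicator ?C z) + (1 - \<alpha>) * M powr \<alpha> * indicator ?C z)"
  proof (rule integral_mono'[OF i2])
    show "f z powr \<alpha> * indicator ?C z \<le> \<alpha> * M powr (\<alpha> - 1) * (f z * indicator ?C z) + (1 - \<alpha>) * M powr \<alpha> * indicator ?C z" for z
      using powr_tangent[OF \<alpha> M(2) f(2)[of z]] by (simp add: indicator_def)
    show "0 \<le> \<alpha> * M powr (\<alpha> - 1) * (f z * indicator ?C z) + (1 - \<alpha>) * M powr \<alpha> * indicator ?C z" for z
      using \<alpha> f(2)[of z] by (simp add: indicator_def)
  qed
  also have "\<dots> = \<alpha> * M powr (\<alpha> - 1) * (LINT z|lebesgue. f z * indicator ?C z) + (1 - \<alpha>) * M powr \<alpha> * ?m"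
    using i iC LC by simp
  also have "\<dots> \<le> \<alpha> * M powr (\<alpha> - 1) * (M * ?m) + (1 - \<alpha>) * M powr \<alpha> * ?m"
    using cyl_avg_leD[OF M(1) h] \<alpha> by (intro add_right_mono mult_left_mono) (auto simp: mult_ac)
  also have "\<dots> = M powr \<alpha> * ?m"
    using M(2) by (simp add: powr_diff algebra_simps)
  finally show "(LINT z|lebesgue. f z powr \<alpha> * indicator ?C z)
    \<le> M powr \<alpha> * unit_ball_vol CARD('n) * (\<rho> ^ DIM(real^'n) * (b - a))" by (simp add: mult_ac)
qed

text \<open>On a set of finite measure \<open>L^m\<close> embeds into \<open>L^1\<close>, because \<open>y \<le> 1 + y^m\<close>.\<close>
lemma nn_integral_le_powr:
  fixes f :: "'z \<Rightarrow> real"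
  assumes "1 \<le> m" "W \<in> sets M" "emeasure M W < \<infinity>" "\<And>z. 0 \<le> f z"
    and "(\<integral>\<^sup>+z\<in>W. ennreal (f z powr m) \<partial>M) < \<infinity>" "(\<lambda>z. indicator W z *\<^sub>R f z) \<in> borel_measurable M"
  shows "integrable M (\<lambda>z. indicator W z *\<^sub>R f z)"
proof (rule integrableI_bounded[OF assms(6)])
  have fm: "(\<lambda>z. ennreal (f z powr m) * indicator W z) \<in> borel_measurable M"
  proof -
    have "(\<lambda>z. ennreal ((indicator W z *\<^sub>R f z) powr m)) \<in> borel_measurable M" using assms(6) by measurable
    moreover have "(\<lambda>z. ennreal ((indicator W z *\<^sub>R f z) powr m)) = (\<lambda>z. ennreal (f z powr m) * indicator W z)"
      by (auto simp: indicator_def fun_eq_iff)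
    ultimately show ?thesis by (rule back_subst[of "\<lambda>g. g \<in> borel_measurable M"])
  qed
  have "(\<integral>\<^sup>+z. ennreal (norm (indicator W z *\<^sub>R f z)) \<partial>M)
    \<le> (\<integral>\<^sup>+z. indicator W z + ennreal (f z powr m) * indicator W z \<partial>M)"
  proof (rule nn_integral_mono)
    fix z
    have "f z \<le> 1 + f z powr m"
    proof (cases "f z \<le> 1")
      case False
      then have "f z powr 1 \<le> f z powr m" using assms(1) by (intro powr_mono) auto
      then show ?thesis using False by (simp add: powr_one)
    qed (simp add: add_increasing2)
    then have "ennreal (f z) \<le> 1 + ennreal (f z powr m)"
      using ennreal_leI[of "f z" "1 + f z powr m"] by simp
    then show "ennreal (norm (indicator W z *\<^sub>R f z)) \<le> indicator W z + ennreal (f z powr m) * indicator W z"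
      using assms(4)[of z] by (simp add: indicator_def)
  qed
  also have "\<dots> = emeasure M W + (\<integral>\<^sup>+z\<in>W. ennreal (f z powr m) \<partial>M)"
    using assms(2) fm by (subst nn_integral_add) auto
  also have "\<dots> < \<infinity>" using assms(3,5) by simp
  finally show "(\<integral>\<^sup>+z. ennreal (norm (indicator W z *\<^sub>R f z)) \<partial>M) < \<infinity>" .
qed

section \<open>The pointwise estimate of order 1/2 in time\<close>

definition kernel_points :: "nat \<Rightarrow> ((real^'n) \<times> real \<Rightarrow> nat \<Rightarrow> real) \<Rightarrow> ((real^'n) \<times> real) set \<Rightarrow> ((real^'n) \<times> real) set" where
  "kernel_points N u W = {(x, t). \<forall>i<N. kernel_point (\<lambda>z. indicator W z *\<^sub>R u z i) x t}"

lemma kernel_point_sum: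
  fixes w :: "'a::euclidean_space \<times> real \<Rightarrow> nat \<Rightarrow> real"
  assumes "\<And>i. i < N \<Longrightarrow> integrable lebesgue (\<lambda>z. w z i)"
    and "\<And>i. i < N \<Longrightarrow> kernel_point (\<lambda>z. w z i) x t"
  shows "kernel_point (\<lambda>z. \<Sum>i<N. e i *\<^sub>R w z i) x t"
proof -
  have "((\<lambda>\<delta>. \<Sum>i<N. e i * kern_avg (\<lambda>z. w z i) x t \<delta> \<delta>) \<longlongrightarrow> (\<Sum>i<N. e i * w (x, t) i)) (at_right 0)"
    using assms(2) unfolding kernel_point_def by (intro tendsto_intros) auto
  moreover have "\<forall>\<^sub>F \<delta> in at_right 0. (\<Sum>i<N. e i * kern_avg (\<lambda>z. w z i) x t \<delta> \<delta>) = kern_avg (\<lambda>z. \<Sum>i<N. e i *\<^sub>R w z i) x t \<delta> \<delta>"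
  proof (rule eventually_at_rightI[of 0 1])
    fix \<delta> :: real assume "\<delta> \<in> {0<..<1}"
    then have i: "integrable lebesgue (\<lambda>z. w z i * (kern x \<delta> (fst z) * kern t \<delta> (snd z)))" if "i < N" for i
      using integrable_kern_product[OF assms(1)[OF that], of \<delta> \<delta> x t] by simp
    have "kern_avg (\<lambda>z. \<Sum>i<N. e i *\<^sub>R w z i) x t \<delta> \<delta>
      = (LINT z|lebesgue. (\<Sum>i<N. e i * (w z i * (kern x \<delta> (fst z) * kern t \<delta> (snd z)))))"
      by (intro Bochner_Integration.integral_cong refl) (simp add: sum_distrib_right mult.assoc)
    also have "\<dots> = (\<Sum>i<N. e i * kern_avg (\<lambda>z. w z i) x t \<delta> \<delta>)"
      using i by simp
    finally show "(\<Sum>i<N. e i * kern_avg (\<lambda>z. w z i) x t \<delta> \<delta>) = kern_avg (\<lambda>z. \<Sum>i<N. e i *\<^sub>R w z i) x t \<delta> \<delta>" by simp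
  qed simp
  ultimately show ?thesis unfolding kernel_point_def by (simp add: tendsto_cong)
qed

lemma integrable_powr_le_1:
  fixes f :: "'a::euclidean_space \<Rightarrow> real"
  assumes f: "integrable lebesgue f" "\<And>z. 0 \<le> f z" and W: "\<And>z. z \<notin> W \<Longrightarrow> f z = 0" "W \<in> sets lebesgue" "emeasure lebesgue W < \<infinity>"
    and \<alpha>: "0 < \<alpha>" "\<alpha> \<le> 1"
  shows "integrable lebesgue (\<lambda>z. f z powr \<alpha>)"
proof (rule integrable_dominated_AE[of "\<lambda>z. indicator W z + f z"])
  show "integrable lebesgue (\<lambda>z. indicator W z + f z)" using f(1) W by (intro Bochner_Integration.integrable_add integrable_real_indicator) auto
  show "(\<lambda>z. f z powr \<alpha>) \<in> borel_measurable lebesgue" using borel_measurable_integrable[OF f(1)] by measurable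
  have "norm (f z powr \<alpha>) \<le> indicator W z + f z" for z
  proof (cases "z \<in> W")
    case True
    have "f z powr \<alpha> \<le> \<alpha> * f z + (1 - \<alpha>)" using powr_tangent[OF \<alpha>, of 1 "f z"] f(2) by simp
    also have "\<dots> \<le> 1 * f z + 1" using \<alpha> f(2)[of z] by (intro add_mono mult_right_mono) auto
    finally show ?thesis using True by simp
  qed (simp add: W)
  then show "AE z in lebesgue. norm (f z powr \<alpha>) \<le> indicator W z + f z" by simp
qed

lemma epowr_finite_iff: "epowr X a < \<infinity> \<longleftrightarrow> X < \<infinity>"
  by (auto simp: epowr_def top.not_eq_extremum split: if_splits)

lemma enn2real_epowr: "X < \<infinity> \<Longrightarrow> enn2real (epowr X a) = enn2real X powr a"
  by (auto simp: epowr_def)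

lemma enn2real_plus_one:
  assumes "X < \<infinity>" shows "X \<le> ennreal (enn2real (X + 1))" "1 \<le> enn2real (X + 1)"
proof -
  have top: "X + 1 < top" using assms by simp
  then have e: "ennreal (enn2real (X + 1)) = X + 1" by (rule ennreal_enn2real)
  show "X \<le> ennreal (enn2real (X + 1))" unfolding e by simp
  have "enn2real 1 \<le> enn2real (X + 1)" by (rule enn2real_mono[OF _ top]) simp
  then show "1 \<le> enn2real (X + 1)" by simp
qed

text \<open>The radius that balances \<open>R * M\<close> against \<open>h / R * M powr (p - 1)\<close>.\<close>
lemma optimal_radius:
  fixes h M p r R :: real
  assumes "0 < h" "1 \<le> M" and R: "R = sqrt (h / 2) * M powr ((p - 2) / 2)"
  shows "0 < R" "R * M \<le> sqrt h * M powr (p / 2)" "h / R * M powr (p - 1) \<le> 2 * (sqrt h * M powr (p / 2))"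
proof -
  have M: "0 < M" using assms by simp
  show R0: "0 < R" using assms by simp
  have "M powr ((p - 2) / 2) * M = M powr (p / 2)"
    using M powr_add[of M "(p - 2) / 2" 1] by (simp add: diff_divide_distrib)
  then have "R * M = sqrt (h / 2) * M powr (p / 2)" unfolding R by (simp add: mult.assoc)
  also have "\<dots> \<le> sqrt h * M powr (p / 2)" using assms by (intro mult_right_mono real_sqrt_le_mono) auto
  finally show "R * M \<le> sqrt h * M powr (p / 2)" .
  have "M powr (p - 1) = M powr ((p - 2) / 2) * M powr (p / 2)"
  proof -
    have "(p - 2) / 2 + p / 2 = p - 1" by (simp add: field_simps)
    then show ?thesis by (simp flip: powr_add)
  qed
  then have "h / R * M powr (p - 1) = h / sqrt (h / 2) * M powr (p / 2)"
    unfolding R using M assms by simp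
  also have "h / sqrt (h / 2) = sqrt 2 * sqrt h"
  proof -
    have "h = sqrt h * sqrt h" using assms by simp
    then have "h / (sqrt h / sqrt 2) = sqrt 2 * sqrt h" using assms by (simp add: field_simps)
    then show ?thesis by (simp add: real_sqrt_divide)
  qed
  also have "sqrt 2 * sqrt h * M powr (p / 2) \<le> 2 * sqrt h * M powr (p / 2)"
    using assms real_sqrt_le_mono[of 2 4] by (intro mult_right_mono) auto
  finally show "h / R * M powr (p - 1) \<le> 2 * (sqrt h * M powr (p / 2))" by (simp add: mult.assoc)
qed

context
  fixes p q L T \<nu> :: real and \<Omega> :: "(real^'n) set" and N :: nat and A F u Du and x0 :: "real^'n" and t0 r :: real
    and W :: "((real^'n) \<times> real) set" and C C' \<omega> :: real
  assumes sys: "parabolic_system p q L \<Omega> T N \<nu> A F u Du" and p: "1 < p" and pq: "1 \<le> p * q / 2"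
    and r: "0 < r" and cc: "compactly_contained (par_cyl x0 t0 (2 * r)) (space_time \<Omega> T)"
    and W: "W = par_cyl x0 t0 (2 * r)"
    and C: "\<And>y::real^'n. bump y \<le> C" "0 < C" "\<And>(y::real^'n) w. \<bar>frechet_derivative bump (at y) w\<bar> \<le> C * norm w"
    and C': "\<And>y::real. bump y \<le> C'" "0 < C'"
    and \<omega>: "\<omega> = unit_ball_vol CARD('n)"
begin

lemma cyl_subset: "W \<subseteq> space_time \<Omega> T" and B_cc: "compactly_contained (ball x0 (2 * r)) \<Omega>"
  and J_cc: "0 < t0 - (2 * r)\<^sup>2" "t0 + (2 * r)\<^sup>2 < T"
  using cylinder_compactly_contained[OF cc] r W by auto

lemma cyl_sets: "W \<in> sets lebesgue" and cyl_finite: "emeasure lebesgue W < \<infinity>"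
  unfolding W par_cyl_def using cylinder_sets r by (auto simp: emeasure_cylinder)

lemma space_time_sets: "space_time \<Omega> T \<in> sets lebesgue"
proof -
  have "open (space_time \<Omega> T)" using sys by (auto simp: parabolic_system_def intro: open_Times)
  then have "space_time \<Omega> T \<in> sets borel" by (rule borel_open)
  then show ?thesis by auto
qed

lemma cut_off_measurable:
  fixes f :: "(real^'n) \<times> real \<Rightarrow> 'b::euclidean_space"
  assumes "f \<in> borel_measurable (lebesgue_on (space_time \<Omega> T))"
  shows "(\<lambda>z. indicator W z *\<^sub>R f z) \<in> borel_measurable lebesgue"
  by (rule borel_measurable_if_zero[OF assms cyl_sets cyl_subset space_time_sets])

lemma solution_measurable:
  "(\<lambda>z. u z i) \<in> borel_measurable (lebesgue_on (space_time \<Omega> T))"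
  "(\<lambda>z. Du z i) \<in> borel_measurable (lebesgue_on (space_time \<Omega> T))"
  "(\<lambda>z. F z i) \<in> borel_measurable (lebesgue_on (space_time \<Omega> T))"
  using sys by (auto simp: parabolic_system_def Lm_loc_W1m_loc_def intro: borel_measurable_coordinate)

lemma vnorm_measurable:
  "(\<lambda>z. vnorm N (u z)) \<in> borel_measurable (lebesgue_on (space_time \<Omega> T))"
  "(\<lambda>z. vnorm N (Du z)) \<in> borel_measurable (lebesgue_on (space_time \<Omega> T))"
  "(\<lambda>z. vnorm N (F z)) \<in> borel_measurable (lebesgue_on (space_time \<Omega> T))"
  by (rule borel_measurable_vnorm, rule solution_measurable)+

lemma vnorm_integrable:
  "integrable lebesgue (\<lambda>z. indicator W z *\<^sub>R vnorm N (u z))"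
  "integrable lebesgue (\<lambda>z. indicator W z *\<^sub>R vnorm N (Du z))"
proof -
  have "(\<integral>\<^sup>+z\<in>W. ennreal (vnorm N (u z) powr (p * q / 2) + vnorm N (Du z) powr (p * q / 2)) \<partial>lebesgue) < \<infinity>"
    using sys B_cc J_cc r unfolding parabolic_system_def Lm_loc_W1m_loc_def W par_cyl_def by auto
  then have "(\<integral>\<^sup>+z\<in>W. ennreal (vnorm N (u z) powr (p * q / 2)) \<partial>lebesgue) < \<infinity>"
    "(\<integral>\<^sup>+z\<in>W. ennreal (vnorm N (Du z) powr (p * q / 2)) \<partial>lebesgue) < \<infinity>"
    by (rule order_le_less_trans[rotated], intro nn_integral_mono mult_right_mono ennreal_leI, simp, simp)+
  then show "integrable lebesgue (\<lambda>z. indicator W z *\<^sub>R vnorm N (u z))"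
    "integrable lebesgue (\<lambda>z. indicator W z *\<^sub>R vnorm N (Du z))"
    by (intro nn_integral_le_powr[OF pq cyl_sets cyl_finite] cut_off_measurable vnorm_measurable; simp)+
qed

lemma component_integrable:
  assumes "i < N"
  shows "integrable lebesgue (\<lambda>z. indicator W z *\<^sub>R u z i)" "integrable lebesgue (\<lambda>z. indicator W z *\<^sub>R Du z i)"
proof -
  show "integrable lebesgue (\<lambda>z. indicator W z *\<^sub>R u z i)"
  proof (rule integrable_dominated_AE[OF vnorm_integrable(1) cut_off_measurable[OF solution_measurable(1)]])
    have "norm (indicator W z *\<^sub>R u z i) \<le> indicator W z *\<^sub>R vnorm N (u z)" for z
      using norm_le_vnorm[OF assms, of "u z"] by (simp add: indicator_def)
    then show "AE z in lebesgue. norm (indicator W z *\<^sub>R u z i) \<le> indicator W z *\<^sub>R vnorm N (u z)" by simp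
  qed
  show "integrable lebesgue (\<lambda>z. indicator W z *\<^sub>R Du z i)"
  proof (rule integrable_dominated_AE[OF vnorm_integrable(2) cut_off_measurable[OF solution_measurable(2)]])
    have "norm (indicator W z *\<^sub>R Du z i) \<le> indicator W z *\<^sub>R vnorm N (Du z)" for z
      using norm_le_vnorm[OF assms, of "Du z"] by (simp add: indicator_def)
    then show "AE z in lebesgue. norm (indicator W z *\<^sub>R Du z i) \<le> indicator W z *\<^sub>R vnorm N (Du z)" by simp
  qed
qed

lemma AE_kernel_points: "AE z in lebesgue. z \<in> kernel_points N u W"
proof -
  have "AE z in lebesgue. \<forall>i\<in>{..<N}. kernel_point (\<lambda>z. indicator W z *\<^sub>R u z i) (fst z) (snd z)"
  proof (rule AE_finite_allI)
    fix i assume "i \<in> {..<N}"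
    then have "integrable lebesgue (\<lambda>z. indicator W z *\<^sub>R u z i)" by (intro component_integrable(1)) simp
    from AE_lebesgue_point_kernel[OF this]
    show "AE z in lebesgue. kernel_point (\<lambda>z. indicator W z *\<^sub>R u z i) (fst z) (snd z)"
      unfolding kernel_point_def by simp
  qed simp
  then show ?thesis by eventually_elim (auto simp: kernel_points_def)
qed

text \<open>For each unit vector \<open>e\<close>, the scalar estimate applies to \<open>v = e \<bullet> u\<close> with weak gradient \<open>V\<close> and flux \<open>G\<close>, whose
norms are at most \<open>|\<nabla>u|\<close> and \<open>(L + 1) (|\<nabla>u| + |F|)^(p-1)\<close>. The exceptional null set consists of points where a component
of \<open>u\<close> fails to be the limit of its averages, and so does not depend on \<open>e\<close>.\<close>
lemma time_difference_two_scales: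
  assumes pts: "(x, s) \<in> kernel_points N u W" "(x, t) \<in> kernel_points N u W"
    and x: "x \<in> ball x0 r" and st: "s \<in> time_interval t0 r" "t \<in> time_interval t0 r" "s < t"
    and H: "H = (\<lambda>z. indicator W z *\<^sub>R (vnorm N (Du z) + vnorm N (F z)) powr (p - 1))" "integrable lebesgue H"
    and M1: "cyl_avg_le (\<lambda>z. indicator W z *\<^sub>R vnorm N (Du z)) x s M1" "cyl_avg_le (\<lambda>z. indicator W z *\<^sub>R vnorm N (Du z)) x t M1"
    and M2: "cyl_avg_le H x t M2" and R: "0 < R" "R \<le> r"
  shows "vnorm N (\<lambda>i. u (x, t) i - u (x, s) i) \<le> 4 * C * C' * (R * M1) + C * ((t - s) / R * ((L + 1) * M2))"
proof -
  define Q where "Q = (\<lambda>z i. A z (Du z) i - vnorm N (F z) powr (p - 2) *\<^sub>R F z i)"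
  let ?B = "ball x0 (2 * r)" and ?J = "time_interval t0 (2 * r)"
  have L: "0 < L" using sys by (simp add: parabolic_system_def)
  have WBJ: "W = ?B \<times> ?J" by (simp add: W par_cyl_def)
  have r4: "r\<^sup>2 \<le> (2 * r)\<^sup>2" using r by (intro power_mono) auto
  have inW: "(x, s) \<in> W" "(x, t) \<in> W"
    using x st r r4 by (auto simp: WBJ)
  have M1_0: "0 \<le> M1" using cyl_avg_le_nonneg[OF M1(1)] by simp
  have M2_0: "0 \<le> M2" using cyl_avg_le_nonneg[OF M2] by (simp add: H)
  show ?thesis
  proof (rule vnorm_le_dual)
    show "0 \<le> 4 * C * C' * (R * M1) + C * ((t - s) / R * ((L + 1) * M2))"
      using C(2) C'(2) M1_0 M2_0 R st L by (intro add_nonneg_nonneg mult_nonneg_nonneg divide_nonneg_nonneg) auto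
    fix e :: "nat \<Rightarrow> real" assume e: "vnorm N e = 1"
    define v where "v z = (\<Sum>i<N. e i *\<^sub>R (indicator W z *\<^sub>R u z i))" for z
    define V where "V z = (\<Sum>i<N. e i *\<^sub>R (indicator W z *\<^sub>R Du z i))" for z
    define G where "G z = (\<Sum>i<N. e i *\<^sub>R (indicator W z *\<^sub>R Q z i))" for z
    have v_int: "integrable lebesgue v" unfolding v_def[abs_def]
      by (intro Bochner_Integration.integrable_sum integrable_scaleR_right component_integrable) auto
    have V_int: "integrable lebesgue V" unfolding V_def[abs_def]
      by (intro Bochner_Integration.integrable_sum integrable_scaleR_right component_integrable) auto
    note flux_integrable = flux_integrable[OF sys p WBJ cyl_subset cyl_sets component_integrable(1) H Q_def]
    have flux_bound: "AE z in lebesgue. indicator W z * vnorm N (Q z) \<le> (L + 1) * H z"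
      by (rule flux_bound[OF sys p WBJ cyl_subset cyl_sets component_integrable(1) H Q_def])
    note flux = flux_identity[OF sys p WBJ cyl_subset cyl_sets component_integrable(1) H Q_def]
    have G_int: "integrable lebesgue G" unfolding G_def[abs_def]
      by (intro Bochner_Integration.integrable_sum integrable_scaleR_right flux_integrable) auto
    have weak: "(LINT z|lebesgue. v z * (frechet_derivative \<eta> (at (fst z)) b * \<theta> (snd z)))
        = - (LINT z|lebesgue. (V z \<bullet> b) * (\<eta> (fst z) * \<theta> (snd z)))"
      if \<eta>: "\<eta> \<in> test_functions ?B" and \<theta>: "\<theta> \<in> test_functions ?J" and b: "b \<in> Basis" for \<eta> \<theta> b
    proof -
      have comp: "(LINT z|lebesgue. (indicator W z *\<^sub>R u z i) * (frechet_derivative \<eta> (at (fst z)) b * \<theta> (snd z)))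
        = - (LINT z|lebesgue. ((indicator W z *\<^sub>R Du z i) \<bullet> b) * (\<eta> (fst z) * \<theta> (snd z)))" if i: "i < N" for i
        unfolding WBJ
      proof (rule space_time_weak_gradient[OF _ _ _ \<eta> \<theta> b])
        have "AE t\<in>?J in lebesgue. sobolev_W1 N (p * q / 2) ?B (\<lambda>x. u (x, t)) (\<lambda>x. Du (x, t))"
          using sys B_cc J_cc r unfolding parabolic_system_def Lm_loc_W1m_loc_def by auto
        then show "AE t\<in>?J in lebesgue. weak_gradient_on ?B (\<lambda>x. u (x, t) i) (\<lambda>x. Du (x, t) i)"
          by eventually_elim (use i in \<open>auto simp: sobolev_W1_def\<close>)
      qed (use component_integrable[OF i] in \<open>simp_all add: WBJ\<close>)
      have i1: "integrable lebesgue (\<lambda>z. (indicator W z *\<^sub>R u z i) * (frechet_derivative \<eta> (at (fst z)) b * \<theta> (snd z)))" if "i < N" for i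
        by (rule integrable_mult_test_functions[OF component_integrable(1)[OF that] test_function_partial[OF \<eta> b] \<theta>])
      have i2: "integrable lebesgue (\<lambda>z. ((indicator W z *\<^sub>R Du z i) \<bullet> b) * (\<eta> (fst z) * \<theta> (snd z)))" if "i < N" for i
        by (rule integrable_mult_test_functions[OF integrable_bounded_linear[OF bounded_linear_inner_left component_integrable(2)[OF that]] \<eta> \<theta>])
      have "(LINT z|lebesgue. v z * (frechet_derivative \<eta> (at (fst z)) b * \<theta> (snd z)))
        = (LINT z|lebesgue. (\<Sum>i<N. e i * ((indicator W z *\<^sub>R u z i) * (frechet_derivative \<eta> (at (fst z)) b * \<theta> (snd z)))))"
        unfolding v_def by (intro Bochner_Integration.integral_cong refl) (simp add: sum_distrib_right mult.assoc)
      also have "\<dots> = (\<Sum>i<N. e i * (LINT z|lebesgue. (indicator W z *\<^sub>R u z i) * (frechet_derivative \<eta> (at (fst z)) b * \<theta> (snd z))))"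
        by (subst Bochner_Integration.integral_sum, use i1 in simp, subst integral_mult_right_zero, rule refl)
      also have "\<dots> = (\<Sum>i<N. - (e i * (LINT z|lebesgue. ((indicator W z *\<^sub>R Du z i) \<bullet> b) * (\<eta> (fst z) * \<theta> (snd z)))))"
        using comp by (intro sum.cong refl) (simp only: lessThan_iff mult_minus_right)
      also have "\<dots> = - (LINT z|lebesgue. (\<Sum>i<N. e i * (((indicator W z *\<^sub>R Du z i) \<bullet> b) * (\<eta> (fst z) * \<theta> (snd z)))))"
        unfolding sum_negf by (subst Bochner_Integration.integral_sum, use i2 in simp, subst integral_mult_right_zero, rule refl)
      also have "\<dots> = - (LINT z|lebesgue. (V z \<bullet> b) * (\<eta> (fst z) * \<theta> (snd z)))"
        unfolding V_def by (intro arg_cong[of _ _ uminus] Bochner_Integration.integral_cong refl)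
          (simp add: inner_sum_left sum_distrib_right mult.assoc)
      finally show ?thesis .
    qed
    have eq: "(LINT z|lebesgue. v z * (\<eta> (fst z) * frechet_derivative \<zeta> (at (snd z)) 1))
        = (LINT z|lebesgue. frechet_derivative \<eta> (at (fst z)) (G z) * \<zeta> (snd z))"
      if "\<eta> \<in> test_functions ?B" "\<zeta> \<in> test_functions ?J" for \<eta> \<zeta>
      unfolding v_def G_def by (rule flux[OF _ that])
    have V_le: "norm (V z) \<le> indicator W z *\<^sub>R vnorm N (Du z)" for z
      using norm_sum_scaleR_le_vnorm[of e "Du z" N] e by (simp add: V_def indicator_def)
    have G_le: "AE z in lebesgue. norm (G z) \<le> (L + 1) * H z"
      using flux_bound
    proof eventually_elim
      case (elim z)
      show ?case using norm_sum_scaleR_le_vnorm[of e "Q z" N] e elim by (auto simp: G_def indicator_def split: if_splits)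
    qed
    have V_avg: "cyl_avg_le (\<lambda>z. norm (V z)) x \<tau> M1"
      if "cyl_avg_le (\<lambda>z. indicator W z *\<^sub>R vnorm N (Du z)) x \<tau> M1" for \<tau>
      by (rule cyl_avg_le_mono_AE[OF that]) (use V_int vnorm_integrable V_le in auto)
    have G_avg: "cyl_avg_le (\<lambda>z. norm (G z)) x t ((L + 1) * M2)"
      by (rule cyl_avg_le_mono_AE[OF cyl_avg_le_mult[OF M2]]) (use G_int H(2) G_le L in auto)
    have kp: "kernel_point v x \<tau>" if "(x, \<tau>) \<in> kernel_points N u W" for \<tau>
      unfolding v_def[abs_def]
      by (rule kernel_point_sum) (use that component_integrable(1) in \<open>auto simp: kernel_points_def\<close>)
    have ball: "cball x R \<subseteq> ?B"
    proof
      fix y assume "y \<in> cball x R"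
      then show "y \<in> ?B" using x R dist_triangle[of x0 y x] by simp
    qed
    have "s \<in> ?J" "t \<in> ?J" using inW by (auto simp: WBJ)
    note est = kernel_point_time_difference[OF v_int V_int G_int weak eq refl \<open>s \<in> ?J\<close> \<open>t \<in> ?J\<close> st(3) R(1) ball
        V_avg[OF M1(1)] V_avg[OF M1(2)] G_avg kp[OF pts(1)] kp[OF pts(2)] C C']
    have "(\<Sum>i<N. e i * (u (x, t) i - u (x, s) i)) = v (x, t) - v (x, s)"
      using inW by (simp add: v_def right_diff_distrib sum_subtractf)
    also have "\<dots> \<le> 4 * C * C' * (R * M1) + C * ((t - s) / R * ((L + 1) * M2))"
      using est by linarith
    finally show "(\<Sum>i<N. e i * (u (x, t) i - u (x, s) i)) \<le> 4 * C * C' * (R * M1) + C * ((t - s) / R * ((L + 1) * M2))" .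
  qed
qed

lemma value_bound:
  assumes pt: "(x, t) \<in> kernel_points N u W" and x: "(x, t) \<in> W"
    and M: "cyl_avg_le (\<lambda>z. indicator W z *\<^sub>R vnorm N (u z)) x t M"
  shows "vnorm N (u (x, t)) \<le> 2 * C * C' * M"
proof (rule vnorm_le_dual)
  have "0 \<le> M" using cyl_avg_le_nonneg[OF M] by simp
  then show "0 \<le> 2 * C * C' * M" using C C' by simp
  fix e :: "nat \<Rightarrow> real" assume e: "vnorm N e = 1"
  define v where "v z = (\<Sum>i<N. e i *\<^sub>R (indicator W z *\<^sub>R u z i))" for z
  have v_int: "integrable lebesgue v" unfolding v_def[abs_def]
    by (intro Bochner_Integration.integrable_sum integrable_scaleR_right component_integrable) auto
  have v_le: "\<bar>v z\<bar> \<le> indicator W z *\<^sub>R vnorm N (u z)" for z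
    using norm_sum_scaleR_le_vnorm[of e "u z" N] e by (simp add: v_def indicator_def)
  have "cyl_avg_le (\<lambda>z. \<bar>v z\<bar>) x t M"
    by (rule cyl_avg_le_mono_AE[OF M]) (use v_int vnorm_integrable v_le in auto)
  moreover have "kernel_point v x t" unfolding v_def[abs_def]
    by (rule kernel_point_sum) (use pt component_integrable(1) in \<open>auto simp: kernel_points_def\<close>)
  ultimately have "\<bar>v (x, t)\<bar> \<le> 2 * C * C' * M" by (rule kernel_point_bound[OF v_int _ _ C(1,2) C'])
  moreover have "(\<Sum>i<N. e i * u (x, t) i) = v (x, t)" using x by (simp add: v_def)
  ultimately show "(\<Sum>i<N. e i * u (x, t) i) \<le> 2 * C * C' * M" by linarith
qed

text \<open>With the optimal radius if it is at most \<open>r\<close>. Otherwise necessarily \<open>p \<ge> 2\<close>, and the trivial bound by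
\<open>r * M \<le> R * M\<close> is already of the right order.\<close>
lemma time_difference_optimised:
  assumes pts: "(x, s) \<in> kernel_points N u W" "(x, t) \<in> kernel_points N u W"
    and x: "x \<in> ball x0 r" and st: "s \<in> time_interval t0 r" "t \<in> time_interval t0 r" "s < t"
    and H: "H = (\<lambda>z. indicator W z *\<^sub>R (vnorm N (Du z) + vnorm N (F z)) powr (p - 1))" "integrable lebesgue H"
    and M1: "cyl_avg_le (\<lambda>z. indicator W z *\<^sub>R vnorm N (Du z)) x s (M * \<omega>)"
      "cyl_avg_le (\<lambda>z. indicator W z *\<^sub>R vnorm N (Du z)) x t (M * \<omega>)"
    and M2: "cyl_avg_le H x t (M powr (p - 1) * \<omega>)" and M: "1 \<le> M"
    and u: "p < 2 \<or> cyl_avg_le (\<lambda>z. indicator W z *\<^sub>R vnorm N (u z)) x s (r * (M * \<omega>)) \<and>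
                      cyl_avg_le (\<lambda>z. indicator W z *\<^sub>R vnorm N (u z)) x t (r * (M * \<omega>))"
  shows "vnorm N (\<lambda>i. u (x, t) i - u (x, s) i) \<le> (4 * C * C' * \<omega> + 2 * C * (L + 1) * \<omega>) * (sqrt (t - s) * M powr (p / 2))"
proof -
  define R where "R = sqrt ((t - s) / 2) * M powr ((p - 2) / 2)"
  have h: "0 < t - s" using st by simp
  note opt = optimal_radius[OF h M R_def]
  have L: "0 < L" using sys by (simp add: parabolic_system_def)
  have \<omega>0: "0 \<le> \<omega>" by (simp add: \<omega> unit_ball_vol_nonneg)
  let ?Y = "sqrt (t - s) * M powr (p / 2)"
  have Y0: "0 \<le> ?Y" using h by simp
  have final: "4 * C * C' * (\<omega> * ?Y) \<le> (4 * C * C' * \<omega> + 2 * C * (L + 1) * \<omega>) * ?Y"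
    using C C' L \<omega>0 Y0 by (simp add: distrib_right mult.assoc)
  show ?thesis
  proof (cases "R \<le> r")
    case True
    have "vnorm N (\<lambda>i. u (x, t) i - u (x, s) i)
        \<le> 4 * C * C' * (R * (M * \<omega>)) + C * ((t - s) / R * ((L + 1) * (M powr (p - 1) * \<omega>)))"
      by (rule time_difference_two_scales[OF pts x st H M1 M2 opt(1) True])
    also have "\<dots> = 4 * C * C' * \<omega> * (R * M) + C * (L + 1) * \<omega> * ((t - s) / R * M powr (p - 1))"
      by (simp add: mult_ac)
    also have "\<dots> \<le> 4 * C * C' * \<omega> * ?Y + C * (L + 1) * \<omega> * (2 * ?Y)"
      using opt C C' L \<omega>0 by (intro add_mono mult_left_mono) auto
    also have "\<dots> = (4 * C * C' * \<omega> + 2 * C * (L + 1) * \<omega>) * ?Y" by (simp add: algebra_simps)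
    finally show ?thesis .
  next
    case False
    \<comment> \<open>For \<open>p < 2\<close> and \<open>M \<ge> 1\<close> the radius is less than \<open>r\<close>, as both times lie in an interval of length \<open>2 * r\<^sup>2\<close>.\<close>
    have "2 \<le> p"
    proof (rule ccontr)
      assume "\<not> 2 \<le> p"
      then have "M powr ((p - 2) / 2) \<le> 1" using M powr_mono[of "(p - 2) / 2" 0 M] by simp
      then have "R \<le> sqrt ((t - s) / 2)" unfolding R_def using h by (simp add: mult_left_le)
      also have "\<dots> \<le> sqrt (r\<^sup>2)" using st by (intro real_sqrt_le_mono) auto
      finally show False using False r by simp
    qed
    with u have u: "cyl_avg_le (\<lambda>z. indicator W z *\<^sub>R vnorm N (u z)) x s (r * (M * \<omega>))"
      "cyl_avg_le (\<lambda>z. indicator W z *\<^sub>R vnorm N (u z)) x t (r * (M * \<omega>))" by auto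
    have r4: "r\<^sup>2 \<le> (2 * r)\<^sup>2" using r by (intro power_mono) auto
    have inW: "(x, s) \<in> W" "(x, t) \<in> W" using x st r r4 by (auto simp: W par_cyl_def)
    have "vnorm N (\<lambda>i. u (x, t) i - u (x, s) i) \<le> vnorm N (u (x, t)) + vnorm N (\<lambda>i. - u (x, s) i)"
      using vnorm_triangle[of N "u (x, t)" "\<lambda>i. - u (x, s) i"] by simp
    also have "vnorm N (\<lambda>i. - u (x, s) i) = vnorm N (u (x, s))" by (simp add: vnorm_def)
    also have "vnorm N (u (x, t)) + vnorm N (u (x, s)) \<le> 2 * C * C' * (r * (M * \<omega>)) + 2 * C * C' * (r * (M * \<omega>))"
      by (intro add_mono value_bound pts inW u)
    also have "\<dots> = 4 * C * C' * \<omega> * (r * M)" by simp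
    also have "\<dots> \<le> 4 * C * C' * \<omega> * (R * M)"
      using False M C C' \<omega>0 by (intro mult_left_mono mult_right_mono) auto
    also have "\<dots> \<le> 4 * C * C' * \<omega> * ?Y" using opt(2) C C' \<omega>0 by (intro mult_left_mono) auto
    finally show ?thesis using final by (simp add: mult.assoc)
  qed
qed

text \<open>The cylinder \<open>W\<close> itself competes in the supremum, so finiteness of the maximal function at a single point of
\<open>W\<close> implies integrability.\<close>
lemma strong_maximal_finite_integrable:
  assumes f: "f \<in> borel_measurable lebesgue" "\<And>z. 0 \<le> f z" "\<And>z. z \<notin> W \<Longrightarrow> f z = 0"
    and fin: "strong_maximal f (x, t) < \<infinity>" "(x, t) \<in> W"
  shows "integrable lebesgue f"
proof (rule integrableI_bounded[OF f(1)])
  have W_eq: "W = ball x0 (2 * r) \<times> {t0 - (2 * r)\<^sup>2<..<t0 + (2 * r)\<^sup>2}" by (simp add: W par_cyl_def)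
  have "strong_maximal f (x, t) \<le> ennreal (enn2real (strong_maximal f (x, t)))" using fin(1) by simp
  from strong_maximal_cylinder[OF this, of x0 "2 * r" "t0 - (2 * r)\<^sup>2" "t0 + (2 * r)\<^sup>2"] fin(2)
  have "(\<integral>\<^sup>+z\<in>W. ennreal \<bar>f z\<bar> \<partial>lebesgue)
      \<le> ennreal (enn2real (strong_maximal f (x, t))) * ennreal (unit_ball_vol CARD('n) * ((2 * r) ^ CARD('n) * ((t0 + (2 * r)\<^sup>2) - (t0 - (2 * r)\<^sup>2))))"
    unfolding W_eq by auto
  also have "\<dots> < \<infinity>" by (simp add: ennreal_mult_less_top)
  also have "(\<integral>\<^sup>+z\<in>W. ennreal \<bar>f z\<bar> \<partial>lebesgue) = (\<integral>\<^sup>+z. ennreal (norm (f z)) \<partial>lebesgue)"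
    using f(3) by (intro nn_integral_cong) (auto simp: indicator_def)
  finally show "(\<integral>\<^sup>+z. ennreal (norm (f z)) \<partial>lebesgue) < \<infinity>" .
qed

text \<open>The definition of \<open>max_control\<close> translated into averages. For \<open>p < 2\<close> the maximal function bounds averages of
\<open>|\<nabla>u| + |F|\<close>, and Jensen's inequality gives those of its power \<open>p - 1 < 1\<close>; for \<open>p > 2\<close> it bounds averages of
the power \<open>p - 1 > 1\<close>, and Jensen's inequality gives those of \<open>|u| / r + |\<nabla>u| + |F|\<close>. In both
cases \<open>M powr (p / 2)\<close> is the larger one of the two values of \<open>g\<close>.\<close>
lemma max_control_pair:
  assumes p2: "p \<noteq> 2" and g: "g = max_control N p u Du F x0 t0 r"
    and fin: "g (x, s) < \<infinity>" "g (x, t) < \<infinity>" and inW: "(x, s) \<in> W" "(x, t) \<in> W"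
    and H: "H = (\<lambda>z. indicator W z *\<^sub>R (vnorm N (Du z) + vnorm N (F z)) powr (p - 1))"
  obtains M where "1 \<le> M" "M powr (p / 2) \<le> enn2real (g (x, s)) + enn2real (g (x, t))" "integrable lebesgue H"
    "\<And>\<tau>. \<tau> = s \<or> \<tau> = t \<Longrightarrow> cyl_avg_le (\<lambda>z. indicator W z *\<^sub>R vnorm N (Du z)) x \<tau> (M * \<omega>)"
    "\<And>\<tau>. \<tau> = s \<or> \<tau> = t \<Longrightarrow> cyl_avg_le H x \<tau> (M powr (p - 1) * \<omega>)"
    "\<And>\<tau>. \<tau> = s \<or> \<tau> = t \<Longrightarrow> p < 2 \<or> cyl_avg_le (\<lambda>z. indicator W z *\<^sub>R vnorm N (u z)) x \<tau> (r * (M * \<omega>))"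
proof -
  note Wm = cyl_sets cyl_finite
  note int = vnorm_integrable
  note meas = vnorm_measurable
  have H_meas: "H \<in> borel_measurable lebesgue"
    unfolding H by (rule cut_off_measurable) (use meas in measurable)
  show thesis
  proof (cases "p < 2")
    case True
    define f where "f = (\<lambda>\<zeta>. (vnorm N (Du \<zeta>) + vnorm N (F \<zeta>)) * indicator W \<zeta>)"
    have g_eq: "g z = epowr (strong_maximal f z + 1) (p / 2)" for z
      unfolding g max_control_def f_def W using True by simp
    have fm: "f \<in> borel_measurable lebesgue"
    proof -
      have "(\<lambda>z. indicator W z *\<^sub>R (vnorm N (Du z) + vnorm N (F z))) \<in> borel_measurable lebesgue"
        by (rule cut_off_measurable) (intro borel_measurable_add meas)
      then show ?thesis by (simp add: f_def mult.commute)
    qed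
    have f0: "0 \<le> f z" "z \<notin> W \<Longrightarrow> f z = 0" for z by (auto simp: f_def)
    have sfin: "strong_maximal f (x, \<tau>) < \<infinity>" if "\<tau> = s \<or> \<tau> = t" for \<tau>
      using fin that epowr_finite_iff[THEN iffD1, of "strong_maximal f (x, \<tau>) + 1" "p / 2"] unfolding g_eq by auto
    define a where "a \<tau> = enn2real (strong_maximal f (x, \<tau>) + 1)" for \<tau>
    define M where "M = max (a s) (a t)"
    have M1: "1 \<le> M" using enn2real_plus_one(2)[OF sfin, of s] by (simp add: M_def a_def le_max_iff_disj)
    have sM: "strong_maximal f (x, \<tau>) \<le> ennreal M" if "\<tau> = s \<or> \<tau> = t" for \<tau>
    proof -
      have "a \<tau> \<le> M" using that by (auto simp: M_def)
      then show ?thesis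
        using enn2real_plus_one(1)[OF sfin[OF that]] order_trans[OF _ ennreal_leI] unfolding a_def by blast
    qed
    have g_a: "enn2real (g (x, \<tau>)) = a \<tau> powr (p / 2)" if "\<tau> = s \<or> \<tau> = t" for \<tau>
      unfolding g_eq a_def using sfin[OF that] by (simp add: enn2real_epowr)
    have f_int: "integrable lebesgue f"
      by (rule strong_maximal_finite_integrable[OF fm f0 sfin inW(1)]) auto
    have H_f: "H = (\<lambda>z. f z powr (p - 1))"
      unfolding H f_def by (auto simp: indicator_def fun_eq_iff)
    have avg: "cyl_avg_le f x \<tau> (M * \<omega>)" if "\<tau> = s \<or> \<tau> = t" for \<tau>
      unfolding \<omega> by (rule strong_maximal_cyl_avg_le[OF sM[OF that] _ f0(1)]) (use M1 in simp)
    show thesis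
    proof (rule that[OF M1])
      show "M powr (p / 2) \<le> enn2real (g (x, s)) + enn2real (g (x, t))"
        using g_a[of s] g_a[of t] by (auto simp: M_def max_def)
      show "integrable lebesgue H"
        unfolding H_f by (rule integrable_powr_le_1[OF f_int f0 Wm]) (use p True in auto)
      show "cyl_avg_le (\<lambda>z. indicator W z *\<^sub>R vnorm N (Du z)) x \<tau> (M * \<omega>)" if "\<tau> = s \<or> \<tau> = t" for \<tau>
        by (rule cyl_avg_le_mono_AE[OF avg[OF that] int(2) f_int]) (simp add: f_def indicator_def)
      show "cyl_avg_le H x \<tau> (M powr (p - 1) * \<omega>)" if "\<tau> = s \<or> \<tau> = t" for \<tau>
        unfolding H_f \<omega>
        by (rule cyl_avg_le_powr[OF avg[OF that, unfolded \<omega>] _ f_int f0(1)]) (use M1 p True in auto)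
    qed (use True in auto)
  next
    case False
    then have p2: "2 < p" using p2 by simp
    define f where "f = (\<lambda>\<zeta>. (vnorm N (u \<zeta>) / r + vnorm N (Du \<zeta>) + vnorm N (F \<zeta>)) powr (p - 1) * indicator W \<zeta>)"
    define k where "k = (\<lambda>z. indicator W z *\<^sub>R (vnorm N (u z) / r + vnorm N (Du z) + vnorm N (F z)))"
    have g_eq: "g z = epowr (strong_maximal f z + 1) (p / (2 * (p - 1)))" for z
      unfolding g max_control_def f_def W using False by simp
    have fm: "f \<in> borel_measurable lebesgue"
    proof -
      have "(\<lambda>z. indicator W z *\<^sub>R (vnorm N (u z) / r + vnorm N (Du z) + vnorm N (F z)) powr (p - 1)) \<in> borel_measurable lebesgue"
        by (rule cut_off_measurable) (use meas in measurable)
      then show ?thesis by (simp add: f_def mult.commute)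
    qed
    have f0: "0 \<le> f z" "z \<notin> W \<Longrightarrow> f z = 0" for z by (auto simp: f_def)
    have sfin: "strong_maximal f (x, \<tau>) < \<infinity>" if "\<tau> = s \<or> \<tau> = t" for \<tau>
      using fin that epowr_finite_iff[THEN iffD1, of "strong_maximal f (x, \<tau>) + 1" "p / (2 * (p - 1))"] unfolding g_eq by auto
    define a where "a \<tau> = enn2real (strong_maximal f (x, \<tau>) + 1)" for \<tau>
    define K where "K = max (a s) (a t)"
    define M where "M = K powr (1 / (p - 1))"
    have K1: "1 \<le> K" using enn2real_plus_one(2)[OF sfin, of s] by (simp add: K_def a_def le_max_iff_disj)
    have M1: "1 \<le> M" unfolding M_def using K1 p by (intro ge_one_powr_ge_zero) auto
    have M_K: "M powr (p - 1) = K" unfolding M_def using K1 p by (simp add: powr_powr)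
    have sM: "strong_maximal f (x, \<tau>) \<le> ennreal K" if "\<tau> = s \<or> \<tau> = t" for \<tau>
    proof -
      have "a \<tau> \<le> K" using that by (auto simp: K_def)
      then show ?thesis
        using enn2real_plus_one(1)[OF sfin[OF that]] order_trans[OF _ ennreal_leI] unfolding a_def by blast
    qed
    have g_a: "enn2real (g (x, \<tau>)) = a \<tau> powr (p / (2 * (p - 1)))" if "\<tau> = s \<or> \<tau> = t" for \<tau>
      unfolding g_eq a_def using sfin[OF that] by (simp add: enn2real_epowr)
    have f_int: "integrable lebesgue f"
      by (rule strong_maximal_finite_integrable[OF fm f0 sfin inW(1)]) auto
    have avg: "cyl_avg_le f x \<tau> (K * \<omega>)" if "\<tau> = s \<or> \<tau> = t" for \<tau>
      unfolding \<omega> by (rule strong_maximal_cyl_avg_le[OF sM[OF that] _ f0(1)]) (use K1 in simp)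
    have H_f: "0 \<le> H z" "H z \<le> f z" for z
      unfolding H f_def using p r by (auto simp: indicator_def intro!: powr_mono2)
    have H_int: "integrable lebesgue H"
      by (rule integrable_dominated_AE[OF f_int H_meas]) (use H_f in simp)
    have k_f: "k = (\<lambda>z. f z powr (1 / (p - 1)))"
      unfolding k_def f_def using p r by (auto simp: indicator_def fun_eq_iff powr_powr)
    have k_int: "integrable lebesgue k"
      unfolding k_f by (rule integrable_powr_le_1[OF f_int f0 Wm]) (use p2 in auto)
    have k_avg: "cyl_avg_le k x \<tau> (M * \<omega>)" if "\<tau> = s \<or> \<tau> = t" for \<tau>
      unfolding k_f M_def \<omega>
      by (rule cyl_avg_le_powr[OF avg[OF that, unfolded \<omega>] _ f_int f0(1)]) (use K1 p2 in auto)
    show thesis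
    proof (rule that[OF M1])
      have e: "1 / (p - 1) * (p / 2) = p / (2 * (p - 1))"
        by (simp only: times_divide_times_eq mult_1 mult.commute)
      have "M powr (p / 2) = K powr (p / (2 * (p - 1)))" unfolding M_def powr_powr e ..
      then show "M powr (p / 2) \<le> enn2real (g (x, s)) + enn2real (g (x, t))"
        using g_a[of s] g_a[of t] by (auto simp: K_def max_def)
      show "integrable lebesgue H" by (rule H_int)
      show "cyl_avg_le (\<lambda>z. indicator W z *\<^sub>R vnorm N (Du z)) x \<tau> (M * \<omega>)" if "\<tau> = s \<or> \<tau> = t" for \<tau>
        by (rule cyl_avg_le_mono_AE[OF k_avg[OF that] int(2) k_int]) (use r in \<open>simp add: k_def indicator_def\<close>)
      show "cyl_avg_le H x \<tau> (M powr (p - 1) * \<omega>)" if "\<tau> = s \<or> \<tau> = t" for \<tau>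
        unfolding M_K by (rule cyl_avg_le_mono_AE[OF avg[OF that] H_int f_int]) (use H_f in simp)
      show "p < 2 \<or> cyl_avg_le (\<lambda>z. indicator W z *\<^sub>R vnorm N (u z)) x \<tau> (r * (M * \<omega>))" if "\<tau> = s \<or> \<tau> = t" for \<tau>
      proof (rule disjI2, rule cyl_avg_le_mono_AE[OF cyl_avg_le_mult[OF k_avg[OF that]] int(1)])
        show "0 \<le> r" using r by simp
        show "integrable lebesgue (\<lambda>z. r * k z)" using k_int by simp
        have "indicator W z *\<^sub>R vnorm N (u z) \<le> r * k z" for z
          using r by (simp add: k_def indicator_def distrib_left)
        then show "AE z in lebesgue. indicator W z *\<^sub>R vnorm N (u z) \<le> r * k z" by simp
      qed
    qed
  qed
qed

lemma pointwise_hajlasz: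
  assumes p2: "p \<noteq> 2" and g: "g = max_control N p u Du F x0 t0 r"
    and pts: "(x, s) \<in> kernel_points N u W" "(x, t) \<in> kernel_points N u W"
    and x: "x \<in> ball x0 r" and st: "s \<in> time_interval t0 r" "t \<in> time_interval t0 r"
    and fin: "g (x, s) < \<infinity>" "g (x, t) < \<infinity>"
  shows "vnorm N (\<lambda>i. u (x, t) i - u (x, s) i)
    \<le> (4 * C * C' * \<omega> + 2 * C * (L + 1) * \<omega>) * sqrt \<bar>t - s\<bar> * (enn2real (g (x, t)) + enn2real (g (x, s)))"
proof -
  let ?K = "4 * C * C' * \<omega> + 2 * C * (L + 1) * \<omega>"
  have L: "0 < L" using sys by (simp add: parabolic_system_def)
  have \<omega>0: "0 \<le> \<omega>" by (simp add: \<omega> unit_ball_vol_nonneg)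
  have K0: "0 \<le> ?K" using C C' L \<omega>0 by simp
  have r4: "r\<^sup>2 \<le> (2 * r)\<^sup>2" using r by (intro power_mono) auto
  have main: "vnorm N (\<lambda>i. u (x, t) i - u (x, s) i)
    \<le> ?K * sqrt \<bar>t - s\<bar> * (enn2real (g (x, t)) + enn2real (g (x, s)))"
    if pts: "(x, s) \<in> kernel_points N u W" "(x, t) \<in> kernel_points N u W"
      and st: "s \<in> time_interval t0 r" "t \<in> time_interval t0 r" "s < t"
      and fin: "g (x, s) < \<infinity>" "g (x, t) < \<infinity>" for s t
  proof -
    define H where "H = (\<lambda>z. indicator W z *\<^sub>R (vnorm N (Du z) + vnorm N (F z)) powr (p - 1))"
    have inW: "(x, s) \<in> W" "(x, t) \<in> W" using x st r r4 by (auto simp: W par_cyl_def)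
    obtain M where M: "1 \<le> M" "M powr (p / 2) \<le> enn2real (g (x, s)) + enn2real (g (x, t))" "integrable lebesgue H"
      "\<And>\<tau>. \<tau> = s \<or> \<tau> = t \<Longrightarrow> cyl_avg_le (\<lambda>z. indicator W z *\<^sub>R vnorm N (Du z)) x \<tau> (M * \<omega>)"
      "\<And>\<tau>. \<tau> = s \<or> \<tau> = t \<Longrightarrow> cyl_avg_le H x \<tau> (M powr (p - 1) * \<omega>)"
      "\<And>\<tau>. \<tau> = s \<or> \<tau> = t \<Longrightarrow> p < 2 \<or> cyl_avg_le (\<lambda>z. indicator W z *\<^sub>R vnorm N (u z)) x \<tau> (r * (M * \<omega>))"
      by (rule max_control_pair[OF p2 g fin inW H_def]) (rule that)
    have "vnorm N (\<lambda>i. u (x, t) i - u (x, s) i) \<le> ?K * (sqrt (t - s) * M powr (p / 2))"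
      by (rule time_difference_optimised[OF pts x st H_def M(3) M(4) M(4) M(5) M(1)]) (use M(6) in auto)
    also have "\<dots> \<le> ?K * (sqrt (t - s) * (enn2real (g (x, s)) + enn2real (g (x, t))))"
      using K0 M(2) st(3) by (intro mult_left_mono) auto
    finally show ?thesis using st(3) by (simp add: mult.assoc add.commute)
  qed
  consider "s < t" | "t < s" | "s = t" by linarith
  then show ?thesis
  proof cases
    case 1
    then show ?thesis using main[OF pts st 1 fin] by simp
  next
    case 2
    have "vnorm N (\<lambda>i. u (x, t) i - u (x, s) i) = vnorm N (\<lambda>i. u (x, s) i - u (x, t) i)"
      unfolding vnorm_def by (simp add: abs_minus_commute)
    then show ?thesis using main[OF pts(2,1) st(2,1) 2 fin(2,1)] by (simp add: abs_minus_commute add.commute)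
  next
    case 3
    then show ?thesis by (simp add: vnorm_def L2_set_def)
  qed
qed

end

section \<open>Chaining through level sets in one dimension\<close>

lemma superlevel_sets:
  assumes "G \<in> borel_measurable lebesgue"
  shows "{t \<in> {a<..<b::real}. (y::real) < G t} \<in> sets lebesgue"
proof -
  have "G -` {y<..} \<inter> space lebesgue \<in> sets lebesgue"
    using assms by (rule measurable_sets) simp
  then have "{a<..<b} \<inter> (G -` {y<..}) \<in> sets lebesgue" by (intro sets.Int) auto
  then show ?thesis by (rule back_subst[of "\<lambda>S. S \<in> sets lebesgue"]) auto
qed

text \<open>Every point of the interval has, within distance \<open>l * \<epsilon> k\<close>, a point of \<open>E\<close> where \<open>G \<le> 2 ^ Suc k\<close>: otherwise the
superlevel set, of measure less than \<open>l * \<epsilon> k\<close>, would contain almost all of an interval of that length. Descending one level at a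
time from \<open>k\<close> to 0 and adding up the Hoelder bounds between consecutive points gives the sum.\<close>
lemma hajlasz_chain:
  fixes d :: "real \<Rightarrow> real \<Rightarrow> real" and G :: "real \<Rightarrow> real"
  assumes ab: "a < b" and l: "l = b - a"
    and G: "G \<in> borel_measurable lebesgue"
    and E: "AE t in lebesgue. t \<in> {a<..<b} \<longrightarrow> t \<in> E" "E \<subseteq> {a<..<b}"
    and tri: "\<And>t s r. d t s \<le> d t r + d r s"
    and haj: "\<And>t s. t \<in> E \<Longrightarrow> s \<in> E \<Longrightarrow> d t s \<le> C * sqrt \<bar>t - s\<bar> * (G t + G s)" "0 \<le> C"
    and \<epsilon>: "\<And>k. emeasure lebesgue {t \<in> {a<..<b}. 2 ^ Suc k < G t} < ennreal (l * \<epsilon> k)"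
      "\<And>k. \<epsilon> k \<le> 1"
  shows "\<exists>t0\<in>E. \<forall>k. \<forall>t\<in>E. G t \<le> 2 ^ Suc k \<longrightarrow>
    d t t0 \<le> C * sqrt l * (4 + 6 * (\<Sum>j<k. 2 ^ j * sqrt (\<epsilon> j)))"
proof -
  have l0: "0 < l" using ab l by simp
  have \<epsilon>_pos: "0 < \<epsilon> k" for k
    using \<epsilon>(1)[of k] l0 by (metis ennreal_0 ennreal_neg gr_implies_not_zero linorder_not_le mult_nonneg_nonpos less_imp_le)
  have close: "\<exists>s\<in>E. G s \<le> 2 ^ Suc k \<and> \<bar>t - s\<bar> \<le> l * \<epsilon> k" if t: "t \<in> {a<..<b}" for t k
  proof (rule ccontr)
    assume neg: "\<not> ?thesis"
    let ?e = "l * \<epsilon> k"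
    let ?K = "{max a (t - ?e)<..<min b (t + ?e)}"
    have e: "0 < ?e" "?e \<le> l" using l0 \<epsilon>_pos[of k] \<epsilon>(2)[of k] by (auto simp: mult_le_cancel_left1)
    have "AE s in lebesgue. s \<in> ?K \<longrightarrow> s \<in> {t \<in> {a<..<b}. 2 ^ Suc k < G t}"
      using E(1)
    proof eventually_elim
      case (elim s)
      then show ?case using neg by (auto simp: abs_le_iff not_le)
    qed
    then have "emeasure lebesgue ?K \<le> emeasure lebesgue {t \<in> {a<..<b}. 2 ^ Suc k < G t}"
      by (rule emeasure_mono_AE[OF _ superlevel_sets[OF G]])
    also have "\<dots> < ennreal ?e" by (rule \<epsilon>(1))
    finally have "emeasure lebesgue ?K < ennreal ?e" .
    moreover have "?e \<le> min b (t + ?e) - max a (t - ?e)"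
      using t e l by (auto simp: min_def max_def)
    moreover have "emeasure lebesgue ?K = ennreal (min b (t + ?e) - max a (t - ?e))"
    proof -
      have "max a (t - ?e) \<le> min b (t + ?e)" using calculation(2) e by linarith
      from emeasure_lborel_Ioo[OF this] show ?thesis by simp
    qed
    ultimately show False using ennreal_leI leD by metis
  qed
  obtain t0 where t0: "t0 \<in> E" "G t0 \<le> 2"
    using close[of "(a + b) / 2" 0] ab by auto
  have "d t t0 \<le> C * sqrt l * (4 + 6 * (\<Sum>j<k. 2 ^ j * sqrt (\<epsilon> j)))"
    if "t \<in> E" "G t \<le> 2 ^ Suc k" for t k
    using that
  proof (induction k arbitrary: t)
    case 0
    have in_I: "t \<in> {a<..<b}" "t0 \<in> {a<..<b}" using 0 t0 E(2) by blast+
    have "sqrt \<bar>t - t0\<bar> * (G t + G t0) \<le> sqrt \<bar>t - t0\<bar> * 4"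
      using 0 t0 by (intro mult_left_mono) auto
    also have "\<dots> \<le> sqrt l * 4"
      using in_I l by (intro mult_right_mono real_sqrt_le_mono) (auto simp: abs_le_iff)
    finally have "C * (sqrt \<bar>t - t0\<bar> * (G t + G t0)) \<le> C * (sqrt l * 4)"
      using haj(2) by (intro mult_left_mono)
    then show ?case using haj(1)[OF 0(1) t0(1)] by (simp add: mult.assoc)
  next
    case (Suc k)
    obtain s where s: "s \<in> E" "G s \<le> 2 ^ Suc k" "\<bar>t - s\<bar> \<le> l * \<epsilon> k"
    proof -
      have "t \<in> {a<..<b}" using Suc.prems E(2) by blast
      from close[OF this, of k] show ?thesis using that by blast
    qed
    have "sqrt \<bar>t - s\<bar> * (G t + G s) \<le> sqrt \<bar>t - s\<bar> * (6 * 2 ^ k)"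
      using Suc.prems s by (intro mult_left_mono) auto
    also have "\<dots> \<le> sqrt (l * \<epsilon> k) * (6 * 2 ^ k)"
      using s by (intro mult_right_mono real_sqrt_le_mono) auto
    finally have "C * (sqrt \<bar>t - s\<bar> * (G t + G s)) \<le> C * (sqrt (l * \<epsilon> k) * (6 * 2 ^ k))"
      using haj(2) by (intro mult_left_mono)
    then have "d t s \<le> C * (sqrt (l * \<epsilon> k) * (6 * 2 ^ k))"
      using haj(1)[OF Suc.prems(1) s(1)] by (simp add: mult.assoc)
    then show ?case using Suc.IH[OF s(1,2)] tri[of t t0 s]
      by (simp add: real_sqrt_mult algebra_simps)
  qed
  then show ?thesis using t0(1) by blast
qed

lemma dyadic_level: "\<exists>k. (y::real) \<le> 2 ^ Suc k \<and> (k = 0 \<or> 2 ^ k < y)"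
proof -
  obtain n where n: "y < 2 ^ n" using real_arch_pow[of 2 y] by auto
  have "0 \<le> (2::real) ^ n" by simp
  then have ex: "y \<le> 2 ^ Suc n" using n unfolding power_Suc by linarith
  define k where "k = (LEAST k. y \<le> 2 ^ Suc k)"
  have 1: "y \<le> 2 ^ Suc k" unfolding k_def by (rule LeastI[of "\<lambda>k. y \<le> 2 ^ Suc k", OF ex])
  have 2: "2 ^ k < y" if k0: "k \<noteq> 0"
  proof -
    obtain m where m: "k = Suc m" using k0 by (cases k) auto
    have "\<not> y \<le> 2 ^ Suc m"
      using not_less_Least[of m "\<lambda>k. y \<le> 2 ^ Suc k"] m unfolding k_def by simp
    then show ?thesis by (simp add: m)
  qed
  show ?thesis by (rule exI[of _ k]) (use 1 2 in \<open>cases "k = 0"; simp\<close>)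
qed

text \<open>Chebyshev's inequality.\<close>
lemma superlevel_measure_le:
  assumes G: "G \<in> borel_measurable lebesgue"
    and int: "(\<integral>\<^sup>+t\<in>{a<..<b}. ennreal (G t powr q) \<partial>lebesgue) \<le> ennreal l" "0 < q" "0 < y" "0 \<le> l"
  shows "emeasure lebesgue {t \<in> {a<..<b::real}. y < G t} \<le> ennreal (l * y powr - q)"
proof -
  let ?S = "{t \<in> {a<..<b}. y < G t}"
  have "ennreal (y powr q) * emeasure lebesgue ?S = (\<integral>\<^sup>+t. ennreal (y powr q) * indicator ?S t \<partial>lebesgue)"
    by (rule nn_integral_cmult_indicator[OF superlevel_sets[OF G], symmetric])
  also have "\<dots> \<le> (\<integral>\<^sup>+t\<in>{a<..<b}. ennreal (G t powr q) \<partial>lebesgue)"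
    using int(2,3) by (intro nn_integral_mono) (auto simp: indicator_def intro!: ennreal_leI powr_mono2)
  also have "\<dots> \<le> ennreal l" by (rule int(1))
  finally have "ennreal (y powr - q) * (ennreal (y powr q) * emeasure lebesgue ?S) \<le> ennreal (y powr - q) * ennreal l"
    by (rule mult_left_mono) simp
  moreover have "ennreal (y powr - q) * ennreal (y powr q) = 1"
    using int(3) by (simp add: powr_minus flip: ennreal_mult)
  ultimately show ?thesis using int(4)
    by (simp add: mult.commute ennreal_mult mult.assoc[symmetric])
qed

lemma two_powr_nat: "(2::real) ^ k = 2 powr real k"
  by (simp add: powr_realpow)

lemma powr_power_real: "0 < (x::real) \<Longrightarrow> (x powr y) ^ k = x powr (y * real k)"
  by (subst powr_realpow[symmetric]) (simp_all add: powr_powr)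

context
  fixes d :: "real \<Rightarrow> real \<Rightarrow> real" and G :: "real \<Rightarrow> real" and a b l C :: real and E :: "real set"
  assumes ab: "a < b" and l: "l = b - a"
    and G: "G \<in> borel_measurable lebesgue"
    and E: "AE t in lebesgue. t \<in> {a<..<b} \<longrightarrow> t \<in> E" "E \<subseteq> {a<..<b}"
    and tri: "\<And>t s r. d t s \<le> d t r + d r s"
    and haj: "\<And>t s. t \<in> E \<Longrightarrow> s \<in> E \<Longrightarrow> d t s \<le> C * sqrt \<bar>t - s\<bar> * (G t + G s)" "0 \<le> C"
begin

lemma hajlasz_chain_power:
  assumes int: "(\<integral>\<^sup>+t\<in>{a<..<b}. ennreal (G t powr q) \<partial>lebesgue) \<le> ennreal l" "0 < q"
  shows "\<exists>t0\<in>E. \<forall>k. \<forall>t\<in>E. G t \<le> 2 ^ Suc k \<longrightarrow>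
    d t t0 \<le> C * sqrt l * (4 + 6 * (\<Sum>j<k. (2 powr (1 - q / 2)) ^ j))"
proof -
  have l0: "0 < l" using ab l by simp
  have *: "emeasure lebesgue {t \<in> {a<..<b}. 2 ^ Suc k < G t} < ennreal (l * 2 powr - (k * q))" for k
  proof -
    have "emeasure lebesgue {t \<in> {a<..<b}. 2 ^ Suc k < G t} \<le> ennreal (l * (2 ^ Suc k) powr - q)"
      using l0 by (intro superlevel_measure_le[OF G int]) auto
    also have "\<dots> < ennreal (l * 2 powr - (k * q))"
    proof (rule ennreal_lessI)
      have "(2 ^ Suc k) powr - q = 2 powr (- ((k + 1) * q))"
        unfolding two_powr_nat powr_powr by (simp add: algebra_simps)
      also have "\<dots> < 2 powr - (k * q)" using int(2) by (intro powr_less_mono) auto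
      finally show "l * (2 ^ Suc k) powr - q < l * 2 powr - (k * q)" using l0 by simp
    qed (use l0 in simp)
    finally show ?thesis .
  qed
  have **: "2 powr - (k * q) \<le> 1" for k :: nat
    using powr_mono[of "- (k * q)" 0 2] int(2) by simp
  have "2 ^ j * sqrt (2 powr - (real j * q)) = (2 powr (1 - q / 2)) ^ j" for j :: nat
  proof -
    have "sqrt (2 powr - (real j * q)) = 2 powr (- (real j * q) * (1 / 2))"
      by (simp only: powr_half_sqrt[symmetric] powr_ge_zero powr_powr)
    then have "2 ^ j * sqrt (2 powr - (real j * q)) = 2 powr (real j + - (real j * q) * (1 / 2))"
      by (simp only: two_powr_nat powr_add)
    also have "real j + - (real j * q) * (1 / 2) = (1 - q / 2) * real j" by (simp add: field_simps)
    finally show ?thesis by (simp add: powr_power_real)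
  qed
  then show ?thesis
    using hajlasz_chain[OF ab l G E tri haj * **] by simp
qed

lemma hajlasz_bound_subcritical:
  assumes int: "(\<integral>\<^sup>+t\<in>{a<..<b}. ennreal (G t powr q) \<partial>lebesgue) \<le> ennreal l" "0 < q" "q < 2"
  shows "\<exists>t0\<in>E. \<forall>t\<in>E. d t t0 \<le> C * sqrt l * ((4 + 6 / (2 powr (1 - q / 2) - 1)) * max 1 (G t) powr (1 - q / 2))"
proof -
  let ?\<beta> = "1 - q / 2"
  have \<beta>: "0 < ?\<beta>" using int by simp
  then have r: "1 < 2 powr ?\<beta>" using powr_less_mono[of 0 ?\<beta> 2] by simp
  obtain t0 where t0: "t0 \<in> E" "\<And>k t. t \<in> E \<Longrightarrow> G t \<le> 2 ^ Suc k \<Longrightarrow>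
     d t t0 \<le> C * sqrt l * (4 + 6 * (\<Sum>j<k. (2 powr ?\<beta>) ^ j))"
    using hajlasz_chain_power[OF int(1,2)] by blast
  have "d t t0 \<le> C * sqrt l * ((4 + 6 / (2 powr ?\<beta> - 1)) * max 1 (G t) powr ?\<beta>)" if t: "t \<in> E" for t
  proof -
    obtain k where k: "G t \<le> 2 ^ Suc k" "k = 0 \<or> 2 ^ k < G t" using dyadic_level by blast
    have m: "1 \<le> max 1 (G t) powr ?\<beta>" using \<beta> by (intro ge_one_powr_ge_zero) auto
    have "(2 powr ?\<beta>) ^ k \<le> max 1 (G t) powr ?\<beta>"
    proof -
      have "(2 powr ?\<beta>) ^ k = (2 ^ k) powr ?\<beta>"
        by (simp only: powr_power_real two_powr_nat powr_powr mult.commute zero_less_numeral)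
      also have "\<dots> \<le> max 1 (G t) powr ?\<beta>" using k(2) \<beta> by (intro powr_mono2) auto
      finally show ?thesis .
    qed
    moreover have "(\<Sum>j<k. (2 powr ?\<beta>) ^ j) = ((2 powr ?\<beta>) ^ k - 1) / (2 powr ?\<beta> - 1)"
      by (rule geometric_sum[OF less_imp_neq[OF r, symmetric]])
    ultimately have "(\<Sum>j<k. (2 powr ?\<beta>) ^ j) \<le> max 1 (G t) powr ?\<beta> / (2 powr ?\<beta> - 1)"
      using r by (simp add: divide_right_mono)
    then have "4 + 6 * (\<Sum>j<k. (2 powr ?\<beta>) ^ j) \<le> (4 + 6 / (2 powr ?\<beta> - 1)) * max 1 (G t) powr ?\<beta>"
      using m by (simp add: distrib_right)
    then have "C * sqrt l * (4 + 6 * (\<Sum>j<k. (2 powr ?\<beta>) ^ j))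
      \<le> C * sqrt l * ((4 + 6 / (2 powr ?\<beta> - 1)) * max 1 (G t) powr ?\<beta>)"
      using haj(2) ab l by (intro mult_left_mono) auto
    then show ?thesis using t0(2)[OF t k(1)] by simp
  qed
  then show ?thesis using t0(1) by blast
qed

lemma hajlasz_bound_supercritical:
  assumes int: "(\<integral>\<^sup>+t\<in>{a<..<b}. ennreal (G t powr q) \<partial>lebesgue) \<le> ennreal l" "2 < q"
  shows "\<exists>t0\<in>E. \<forall>t\<in>E. d t t0 \<le> C * sqrt l * (4 + 6 / (1 - 2 powr (1 - q / 2)))"
proof -
  let ?r = "2 powr (1 - q / 2)"
  have r: "0 < ?r" "?r < 1" using powr_less_mono[of "1 - q / 2" 0 2] int by auto
  have q: "0 < q" using int by simp
  obtain t0 where t0: "t0 \<in> E" "\<And>k t. t \<in> E \<Longrightarrow> G t \<le> 2 ^ Suc k \<Longrightarrow>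
     d t t0 \<le> C * sqrt l * (4 + 6 * (\<Sum>j<k. ?r ^ j))"
    using hajlasz_chain_power[OF int(1) q] by blast
  have "d t t0 \<le> C * sqrt l * (4 + 6 / (1 - ?r))" if t: "t \<in> E" for t
  proof -
    obtain k where k: "G t \<le> 2 ^ Suc k" using dyadic_level by blast
    have "(\<Sum>j<k. ?r ^ j) = (1 - ?r ^ k) / (1 - ?r)"
      using geometric_sum[OF less_imp_neq[OF r(2)], of k] minus_divide_divide[of "1 - ?r ^ k" "1 - ?r"]
      by (simp only: minus_diff_eq)
    also have "\<dots> \<le> 1 / (1 - ?r)" using r by (intro divide_right_mono) auto
    finally have "4 + 6 * (\<Sum>j<k. ?r ^ j) \<le> 4 + 6 / (1 - ?r)" by simp
    then have "C * sqrt l * (4 + 6 * (\<Sum>j<k. ?r ^ j)) \<le> C * sqrt l * (4 + 6 / (1 - ?r))"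
      using haj(2) ab l by (intro mult_left_mono) auto
    then show ?thesis using t0(2)[OF t k(1)] by simp
  qed
  then show ?thesis using t0(1) by blast
qed

text \<open>The choice \<open>\<epsilon> k = |{G > 2 ^ Suc k}| / l + 8^(-k) / 2\<close> retains the actual measures of the superlevel sets. By
the layer-cake sum, \<open>4^k \<epsilon> k\<close> is summable with a bound independent of \<open>G\<close>, so the sum of \<open>k\<close> terms
\<open>2^j \<epsilon> j^(1/2)\<close> is of order \<open>k^(1/2)\<close>, and \<open>2^k < G t\<close> bounds \<open>k\<close> by a multiple of \<open>ln (G t)\<close>.\<close>
lemma hajlasz_bound_critical:
  assumes int: "(\<integral>\<^sup>+t\<in>{a<..<b}. ennreal (G t powr 2) \<partial>lebesgue) \<le> ennreal l"
  shows "\<exists>t0\<in>E. \<forall>t\<in>E. d t t0 \<le> C * sqrt l * (16 * sqrt (1 + 2 * ln (max 1 (G t))))"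
proof -
  have l0: "0 < l" using ab l by simp
  define S where "S k = {t \<in> {a<..<b}. 2 ^ Suc k < G t}" for k
  have S: "S k \<in> sets lebesgue" for k unfolding S_def by (rule superlevel_sets[OF G])
  have S_le: "emeasure lebesgue (S k) \<le> ennreal (l * (1 / 4))" for k
  proof -
    have "emeasure lebesgue (S k) \<le> ennreal (l * (2 ^ Suc k) powr - 2)"
      unfolding S_def using l0 by (intro superlevel_measure_le[OF G int]) auto
    also have "\<dots> \<le> ennreal (l * (1 / 4))"
    proof (intro ennreal_leI mult_left_mono)
      have "(2 ^ Suc k) powr - 2 \<le> (2 :: real) powr - 2"
        by (rule powr_mono2') (simp_all add: self_le_power)
      then show "(2 ^ Suc k) powr - 2 \<le> 1 / (4 :: real)" by (simp add: powr_minus)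
    qed (use l0 in simp)
    finally show ?thesis .
  qed
  define w where "w k = measure lebesgue (S k) / l" for k
  have em: "emeasure lebesgue (S k) = ennreal (l * w k)" for k
  proof -
    have "emeasure lebesgue (S k) \<noteq> \<infinity>" using S_le[of k] by (auto simp: top_unique)
    then show ?thesis using l0 by (simp add: w_def emeasure_eq_ennreal_measure)
  qed
  have w0: "0 \<le> w k" for k using l0 by (simp add: w_def)
  have w4: "w k \<le> 1 / 4" for k
    using S_le[of k] l0 w0[of k] unfolding em by (subst (asm) ennreal_le_iff) auto
  \<comment> \<open>The second summand makes \<open>\<epsilon> k\<close> strictly larger than the relative measure, as the chain requires.\<close>
  define \<epsilon> where "\<epsilon> k = w k + (1 / 8) ^ k / 2" for k :: nat
  have *: "emeasure lebesgue {t \<in> {a<..<b}. 2 ^ Suc k < G t} < ennreal (l * \<epsilon> k)" for k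
  proof -
    have lt: "w k < \<epsilon> k" by (simp add: \<epsilon>_def)
    then have "ennreal (l * w k) < ennreal (l * \<epsilon> k)"
      using l0 order_le_less_trans[OF w0 lt]
      by (intro ennreal_lessI mult_strict_left_mono mult_pos_pos) simp_all
    then show ?thesis using em[of k] unfolding S_def by simp
  qed
  have **: "\<epsilon> k \<le> 1" for k
    using w4[of k] power_le_one[of "1 / 8 :: real" k] by (simp add: \<epsilon>_def)
  obtain t0 where t0: "t0 \<in> E" "\<And>k t. t \<in> E \<Longrightarrow> G t \<le> 2 ^ Suc k \<Longrightarrow>
     d t t0 \<le> C * sqrt l * (4 + 6 * (\<Sum>j<k. 2 ^ j * sqrt (\<epsilon> j)))"
    using hajlasz_chain[OF ab l G E tri haj * **] by blast
  have layer: "(\<Sum>j<k. 4 ^ j * indicator {t. 2 ^ Suc j < G t} t) \<le> (G t)\<^sup>2" for k t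
  proof (induction k)
    case (Suc k)
    show ?case
    proof (cases "2 ^ Suc k < G t")
      case True
      have "(\<Sum>j<Suc k. 4 ^ j * indicator {t. 2 ^ Suc j < G t} t) \<le> (\<Sum>j<Suc k. (4::real) ^ j)"
        by (intro sum_mono) (auto simp: indicator_def)
      also have "\<dots> \<le> (2 ^ Suc k)\<^sup>2"
      proof -
        have "((2::real) ^ k)\<^sup>2 = 4 ^ k" by (simp add: power2_eq_square flip: power_mult_distrib)
        then have e1: "((2::real) ^ Suc k)\<^sup>2 = 4 * 4 ^ k" by (simp add: power_mult_distrib)
        have e2: "(\<Sum>j<Suc k. (4::real) ^ j) = (4 * 4 ^ k - 1) / 3"
          by (subst geometric_sum) simp_all
        have "(4 * y - 1) / 3 \<le> 4 * y" if "0 \<le> y" for y :: real using that by simp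
        from this[of "4 ^ k"] show ?thesis unfolding e1 e2 by simp
      qed
      also have "\<dots> \<le> (G t)\<^sup>2" using True by (intro power_mono) auto
      finally show ?thesis .
    next
      case False
      then show ?thesis using Suc by simp
    qed
  qed simp
  have sum_w: "(\<Sum>j<k. 4 ^ j * w j) \<le> 1" for k
  proof -
    have "ennreal (l * (\<Sum>j<k. 4 ^ j * w j)) = (\<Sum>j<k. ennreal (4 ^ j) * emeasure lebesgue (S j))"
      using l0 w0 by (simp add: em sum_distrib_left sum_ennreal mult_ac flip: ennreal_mult)
    also have "\<dots> = (\<Sum>j<k. \<integral>\<^sup>+t. ennreal (4 ^ j) * indicator (S j) t \<partial>lebesgue)"
      using S by (simp add: nn_integral_cmult)
    also have "\<dots> = (\<integral>\<^sup>+t. (\<Sum>j<k. ennreal (4 ^ j) * indicator (S j) t) \<partial>lebesgue)"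
      using S by (subst nn_integral_sum) auto
    also have "\<dots> \<le> (\<integral>\<^sup>+t\<in>{a<..<b}. ennreal (G t powr 2) \<partial>lebesgue)"
    proof (rule nn_integral_mono)
      fix t
      show "(\<Sum>j<k. ennreal (4 ^ j) * indicator (S j) t) \<le> ennreal (G t powr 2) * indicator {a<..<b} t"
      proof (cases "t \<in> {a<..<b}")
        case True
        have "(\<Sum>j<k. ennreal (4 ^ j) * indicator (S j) t)
          = ennreal (\<Sum>j<k. 4 ^ j * indicator {t. 2 ^ Suc j < G t} t)"
          using True by (subst sum_ennreal[symmetric]) (auto simp: S_def indicator_def intro!: sum.cong)
        also have "\<dots> \<le> ennreal (G t powr 2)"
        proof (cases "0 < G t")
          case True
          then show ?thesis using layer[of t k] by (intro ennreal_leI) simp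
        next
          case False
          have "\<not> 2 ^ Suc j < G t" for j
            using False zero_less_power[of "2::real" "Suc j"] by linarith
          then show ?thesis by simp
        qed
        finally show ?thesis using True by simp
      next
        case False
        then have "t \<notin> S j" for j by (auto simp: S_def)
        then show ?thesis by simp
      qed
    qed
    also have "\<dots> \<le> ennreal l" by (rule int)
    finally have "l * (\<Sum>j<k. 4 ^ j * w j) \<le> l * 1" using l0 by (simp add: ennreal_le_iff)
    then show ?thesis using l0 by simp
  qed
  have sum_e: "(\<Sum>j<k. 2 ^ j * sqrt (\<epsilon> j)) \<le> sqrt (2 * k)" for k
  proof -
    have "(\<Sum>j<k. 2 ^ j * sqrt (\<epsilon> j))\<^sup>2 \<le> (\<Sum>j<k. 1\<^sup>2) * (\<Sum>j<k. (2 ^ j * sqrt (\<epsilon> j))\<^sup>2)"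
      using Cauchy_Schwarz_ineq_sum[of "\<lambda>_. 1" "\<lambda>j. 2 ^ j * sqrt (\<epsilon> j)" "{..<k}"] by simp
    also have "(\<Sum>j<k. (2 ^ j * sqrt (\<epsilon> j))\<^sup>2) = (\<Sum>j<k. 4 ^ j * w j) + (\<Sum>j<k. (1 / 2) ^ j) / 2"
    proof -
      have "(2 ^ j * sqrt (\<epsilon> j))\<^sup>2 = 4 ^ j * w j + (1 / 2) ^ j / 2" for j
      proof -
        have "(2 ^ j)\<^sup>2 = (4::real) ^ j" by (simp add: power2_eq_square flip: power_mult_distrib)
        moreover have "0 \<le> \<epsilon> j" using w0 by (simp add: \<epsilon>_def)
        moreover have "4 ^ j * (1 / 8) ^ j = (1 / 2 :: real) ^ j" by (simp flip: power_mult_distrib)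
        ultimately show ?thesis by (simp add: power_mult_distrib \<epsilon>_def distrib_left)
      qed
      then show ?thesis by (simp add: sum.distrib sum_divide_distrib)
    qed
    also have "(\<Sum>j<k. (1 / 2 :: real) ^ j) \<le> 2"
      by (simp add: geometric_sum)
    then have "(\<Sum>j<k. 1\<^sup>2) * ((\<Sum>j<k. 4 ^ j * w j) + (\<Sum>j<k. (1 / 2 :: real) ^ j) / 2) \<le> k * (1 + 1)"
    proof -
      have "(\<Sum>j<k. 4 ^ j * w j) + (\<Sum>j<k. (1 / 2 :: real) ^ j) / 2 \<le> 1 + 1"
        using sum_w[of k] \<open>(\<Sum>j<k. (1 / 2 :: real) ^ j) \<le> 2\<close> by linarith
      from mult_left_mono[OF this, of "real k"] show ?thesis by simp
    qed
    finally have "(\<Sum>j<k. 2 ^ j * sqrt (\<epsilon> j))\<^sup>2 \<le> 2 * k" by simp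
    then show ?thesis by (rule real_le_rsqrt)
  qed
  have "d t t0 \<le> C * sqrt l * (16 * sqrt (1 + 2 * ln (max 1 (G t))))" if t: "t \<in> E" for t
  proof -
    obtain k where k: "G t \<le> 2 ^ Suc k" "k = 0 \<or> 2 ^ k < G t" using dyadic_level by blast
    have "k * ln 2 \<le> ln (max 1 (G t))"
    proof -
      have "ln (2 ^ k) \<le> ln (max 1 (G t))" using k(2) by (subst ln_le_cancel_iff) auto
      then show ?thesis by (simp add: ln_realpow)
    qed
    moreover have "k * (1 / 2) \<le> k * ln (2::real)"
      using ln2_ge_two_thirds by (intro mult_left_mono) auto
    ultimately have k_le: "k \<le> 2 * ln (max 1 (G t))" by simp
    have "6 * sqrt (2 * k) \<le> 12 * sqrt (1 + 2 * ln (max 1 (G t)))"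
    proof -
      have "sqrt (2 * k) \<le> sqrt (4 * (1 + 2 * ln (max 1 (G t))))"
        using k_le by (intro real_sqrt_le_mono) auto
      then show ?thesis unfolding real_sqrt_mult[of 4] real_sqrt_four by linarith
    qed
    moreover have "1 \<le> sqrt (1 + 2 * ln (max 1 (G t)))" by simp
    ultimately have "4 + 6 * (\<Sum>j<k. 2 ^ j * sqrt (\<epsilon> j)) \<le> 16 * sqrt (1 + 2 * ln (max 1 (G t)))"
      using sum_e[of k] by linarith
    then have "C * sqrt l * (4 + 6 * (\<Sum>j<k. 2 ^ j * sqrt (\<epsilon> j))) \<le> C * sqrt l * (16 * sqrt (1 + 2 * ln (max 1 (G t))))"
      using haj(2) ab l by (intro mult_left_mono) auto
    then show ?thesis using t0(2)[OF t k(1)] by linarith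
  qed
  then show ?thesis using t0(1) by blast
qed

end

section \<open>From lines to time oscillations\<close>

lemma open_strong_maximal_superlevel: "open {z. y < strong_maximal f z}"
proof -
  let ?q = "\<lambda>(y, \<rho>, a, b). (\<integral>\<^sup>+\<zeta>\<in>ball y \<rho> \<times> {a<..<b}. ennreal \<bar>f \<zeta>\<bar> \<partial>lebesgue)
          / emeasure lebesgue (ball y \<rho> \<times> {a<..<b})"
  have "{z. y < strong_maximal f z} = (\<Union>(c, \<rho>, a, b) \<in> {k. y < ?q k}. ball c \<rho> \<times> {a<..<b})"
    unfolding strong_maximal_def less_SUP_iff by (auto, blast)
  moreover have "open (\<Union>(c, \<rho>, a, b) \<in> {k. y < ?q k}. ball c \<rho> \<times> {a<..<b})"
    by (intro open_UN) (auto intro!: open_Times)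
  ultimately show ?thesis by simp
qed

text \<open>A supremum over open cylinders is lower semicontinuous.\<close>
lemma borel_measurable_strong_maximal: "strong_maximal f \<in> borel_measurable borel"
  by (rule borel_measurableI_greater) (simp add: open_strong_maximal_superlevel borel_open)

lemma borel_measurable_epowr: "X \<in> borel_measurable M \<Longrightarrow> (\<lambda>z. epowr (X z) a) \<in> borel_measurable M"
  unfolding epowr_def
proof (rule measurable_If)
  assume X: "X \<in> borel_measurable M"
  have "(\<lambda>z. enn2real (X z)) \<in> borel_measurable M"
    by (rule borel_measurable_enn2real[OF X])
  then have "(\<lambda>z. enn2real (X z) powr a) \<in> borel_measurable M" by measurable
  then show "(\<lambda>z. ennreal (enn2real (X z) powr a)) \<in> borel_measurable M"
    by (rule measurable_compose[OF _ measurable_ennreal])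
  have "X -` {\<infinity>} \<inter> space M \<in> sets M" by (rule measurable_sets[OF X]) (intro borel_closed closed_singleton)
  then show "{z \<in> space M. X z = \<infinity>} \<in> sets M" by (rule back_subst[of "\<lambda>S. S \<in> sets M"]) auto
qed simp

lemma borel_measurable_max_control: "max_control N p u Du F x0 t0 r \<in> borel_measurable borel"
proof -
  have m: "(\<lambda>z. epowr (strong_maximal f z + 1) a) \<in> borel_measurable borel" for f :: "(real^'n) \<times> real \<Rightarrow> real" and a
    by (intro borel_measurable_epowr borel_measurable_add borel_measurable_strong_maximal borel_measurable_const)
  show ?thesis
    by (cases "p < 2") (simp_all add: max_control_def[abs_def] m)
qed

lemma borel_measurable_slice_time:
  fixes g :: "(real^'n) \<times> real \<Rightarrow> ennreal"
  assumes "g \<in> borel_measurable borel"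
  shows "(\<lambda>t. g (x, t)) \<in> borel_measurable borel"
  by (rule measurable_compose[OF _ assms]) (intro borel_measurable_continuous_onI continuous_intros)

lemma epowr_ge_1: "1 \<le> X \<Longrightarrow> 0 \<le> a \<Longrightarrow> 1 \<le> epowr X a"
proof (cases "X = \<infinity>")
  case False
  assume "1 \<le> X" "0 \<le> a"
  then have "enn2real 1 \<le> enn2real X" using False by (intro enn2real_mono) (auto simp: top.not_eq_extremum)
  then have "1 \<le> enn2real X powr a" using \<open>0 \<le> a\<close> by (intro ge_one_powr_ge_zero) auto
  then show ?thesis using False by (simp add: epowr_def)
qed (simp add: epowr_def)

lemma max_control_ge_1: "1 < p \<Longrightarrow> 1 \<le> max_control N p u Du F x0 t0 r z"
  by (auto simp: max_control_def intro!: epowr_ge_1)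

text \<open>Division by the \<open>q\<close>-th mean \<open>m\<close> reduces the embedding to functions of mean at most 1. The mean is positive because
\<open>g \<ge> 1\<close>.\<close>
lemma normalised_control:
  fixes g :: "real \<Rightarrow> ennreal"
  assumes ab: "a < b" and l: "l = b - a" and g: "g \<in> borel_measurable lebesgue" "\<And>t. 1 \<le> g t" and q: "0 < q"
    and fin: "nn_average {a<..<b} (\<lambda>t. epowr (g t) q) < \<infinity>"
  defines "m \<equiv> enn2real (nn_average {a<..<b} (\<lambda>t. epowr (g t) q)) powr (1 / q)"
  shows "0 < m" "AE t in lebesgue. t \<in> {a<..<b} \<longrightarrow> g t < \<infinity>"
    "(\<integral>\<^sup>+t\<in>{a<..<b}. ennreal ((enn2real (g t) / m) powr q) \<partial>lebesgue) \<le> ennreal l"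
    "epowr (nn_average {a<..<b} (\<lambda>t. epowr (g t) q)) (1 / q) = ennreal m"
proof -
  let ?I = "{a<..<b}"
  let ?A = "nn_average ?I (\<lambda>t. epowr (g t) q)"
  let ?J = "\<integral>\<^sup>+t\<in>?I. epowr (g t) q \<partial>lebesgue"
  have l0: "0 < l" using ab l by simp
  have em: "emeasure lebesgue ?I = ennreal l" using ab l by simp
  have A: "?A = ?J / ennreal l" by (simp add: nn_average_def em)
  have J: "?J = ?A * ennreal l"
    unfolding A using l0 by (simp add: ennreal_divide_times ennreal_divide_self)
  have gm: "(\<lambda>t. epowr (g t) q * indicator ?I t) \<in> borel_measurable lebesgue"
    using borel_measurable_epowr[OF g(1)] by (intro borel_measurable_times_ennreal borel_measurable_indicator) auto
  have J_fin: "?J < \<infinity>" using fin unfolding J by (simp add: ennreal_mult_less_top)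
  have "1 * ennreal l \<le> ?J"
  proof -
    have "1 * ennreal l = (\<integral>\<^sup>+t\<in>?I. 1 \<partial>lebesgue)" using em by simp
    also have "\<dots> \<le> ?J" using epowr_ge_1[OF g(2)] q by (intro nn_integral_mono mult_right_mono) auto
    finally show ?thesis .
  qed
  define A' where "A' = enn2real ?A"
  have A': "?A = ennreal A'" "0 \<le> A'" unfolding A'_def using fin by simp_all
  have "0 < A'"
  proof (rule ccontr)
    assume "\<not> 0 < A'"
    then have "?J = 0" using A' J by simp
    then show False using \<open>1 * ennreal l \<le> ?J\<close> l0 by simp
  qed
  then show m0: "0 < m" by (simp add: m_def A'_def)
  have mq: "m powr q = A'" using q \<open>0 < A'\<close> by (simp add: m_def powr_powr flip: A'_def)
  show "epowr ?A (1 / q) = ennreal m" using fin by (auto simp: epowr_def m_def)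
  have "AE t in lebesgue. epowr (g t) q * indicator ?I t \<noteq> \<infinity>"
    using J_fin by (intro nn_integral_PInf_AE[OF gm]) auto
  then show g_fin: "AE t in lebesgue. t \<in> ?I \<longrightarrow> g t < \<infinity>"
  proof eventually_elim
    case (elim t)
    then show ?case using epowr_finite_iff[of "g t" q] by (auto simp: top.not_eq_extremum)
  qed
  have "(\<integral>\<^sup>+t\<in>?I. ennreal ((enn2real (g t) / m) powr q) \<partial>lebesgue)
      = (\<integral>\<^sup>+t. ennreal (1 / A') * (epowr (g t) q * indicator ?I t) \<partial>lebesgue)"
  proof (rule nn_integral_cong_AE)
    show "AE t in lebesgue. ennreal ((enn2real (g t) / m) powr q) * indicator ?I t
        = ennreal (1 / A') * (epowr (g t) q * indicator ?I t)"
      using g_fin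
    proof eventually_elim
      case (elim t)
      show ?case
      proof (cases "t \<in> ?I")
        case True
        have "ennreal ((enn2real (g t) / m) powr q) = ennreal (1 / A' * enn2real (g t) powr q)"
          using m0 by (simp add: powr_divide mq)
        also have "\<dots> = ennreal (1 / A') * epowr (g t) q"
          using elim True \<open>0 < A'\<close> by (subst ennreal_mult) (auto simp: epowr_def)
        finally show ?thesis using True by simp
      qed simp
    qed
  qed
  also have "\<dots> = ennreal (1 / A') * (ennreal A' * ennreal l)"
    unfolding nn_integral_cmult[OF gm] J A'(1) ..
  also have "\<dots> = ennreal l"
    using \<open>0 < A'\<close> l0 by (simp flip: ennreal_mult)
  finally show "(\<integral>\<^sup>+t\<in>?I. ennreal ((enn2real (g t) / m) powr q) \<partial>lebesgue) \<le> ennreal l" by simp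
qed

lemma average_le_two:
  fixes D G :: "real \<Rightarrow> real"
  assumes ab: "a < b" and l: "l = b - a" and D: "D \<in> borel_measurable lebesgue" "\<And>t. 0 \<le> D t"
    and le: "\<And>t. D t \<le> Y * (1 + G t powr q)" and Y: "0 \<le> Y"
    and int: "(\<integral>\<^sup>+t\<in>{a<..<b}. ennreal (G t powr q) \<partial>lebesgue) \<le> ennreal l" and G: "G \<in> borel_measurable lebesgue"
  shows "(\<integral>\<^sup>+t\<in>{a<..<b}. ennreal (D t) \<partial>lebesgue) \<le> ennreal (2 * Y * l)"
    "set_integrable lebesgue {a<..<b} D" "(LINT t:{a<..<b}|lebesgue. D t) / l \<le> 2 * Y"
proof -
  let ?I = "{a<..<b}"
  have l0: "0 < l" using ab l by simp
  have em: "emeasure lebesgue ?I = ennreal l" using ab l by simp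
  have Gm: "(\<lambda>t. ennreal (G t powr q) * indicator ?I t) \<in> borel_measurable lebesgue"
  proof -
    have "(\<lambda>t. G t powr q) \<in> borel_measurable lebesgue" using G by measurable
    then show ?thesis by (intro borel_measurable_times_ennreal borel_measurable_indicator measurable_compose[OF _ measurable_ennreal]) auto
  qed
  have "(\<integral>\<^sup>+t\<in>?I. ennreal (D t) \<partial>lebesgue)
      \<le> (\<integral>\<^sup>+t. ennreal Y * (indicator ?I t + ennreal (G t powr q) * indicator ?I t) \<partial>lebesgue)"
  proof (rule nn_integral_mono)
    fix t
    have "ennreal (D t) \<le> ennreal (Y * (1 + G t powr q))" by (rule ennreal_leI[OF le])
    also have "\<dots> = ennreal Y * (1 + ennreal (G t powr q))" using Y ennreal_plus[of 1 "G t powr q"] by (simp add: ennreal_mult)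
    finally show "ennreal (D t) * indicator ?I t \<le> ennreal Y * (indicator ?I t + ennreal (G t powr q) * indicator ?I t)"
      by (simp add: indicator_def)
  qed
  also have "\<dots> = ennreal Y * (ennreal l + (\<integral>\<^sup>+t\<in>?I. ennreal (G t powr q) \<partial>lebesgue))"
  proof -
    have Im: "(indicator ?I :: real \<Rightarrow> ennreal) \<in> borel_measurable lebesgue"
      by (rule borel_measurable_indicator) simp
    have "(\<integral>\<^sup>+t. indicator ?I t \<partial>lebesgue) = ennreal l" using em by simp
    then show ?thesis
      unfolding nn_integral_cmult[OF borel_measurable_add[OF Im Gm]] nn_integral_add[OF Im Gm] by simp
  qed
  also have "\<dots> \<le> ennreal Y * (ennreal l + ennreal l)"
    using int by (intro mult_left_mono add_left_mono) auto
  also have "\<dots> = ennreal (2 * Y * l)"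
    using Y l0 by (simp add: ennreal_mult[symmetric] ennreal_plus[symmetric] del: ennreal_plus)
  finally show nn: "(\<integral>\<^sup>+t\<in>?I. ennreal (D t) \<partial>lebesgue) \<le> ennreal (2 * Y * l)" .
  have eq: "ennreal (norm (indicator ?I t *\<^sub>R D t)) = ennreal (D t) * indicator ?I t" for t
    using D(2)[of t] by (simp add: indicator_def)
  have Dm: "(\<lambda>t. indicator ?I t *\<^sub>R D t) \<in> borel_measurable lebesgue"
    using D(1) by (intro borel_measurable_scaleR borel_measurable_indicator) auto
  show i: "set_integrable lebesgue ?I D"
    unfolding set_integrable_def
    by (rule integrableI_bounded[OF Dm]) (unfold eq, rule order_le_less_trans[OF nn], simp)
  have "ennreal (LINT t:?I|lebesgue. D t) = (\<integral>\<^sup>+t. ennreal (indicator ?I t *\<^sub>R D t) \<partial>lebesgue)"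
    unfolding set_lebesgue_integral_def
    by (rule nn_integral_eq_integral[symmetric, OF i[unfolded set_integrable_def]]) (use D(2) in simp)
  also have "\<dots> = (\<integral>\<^sup>+t\<in>?I. ennreal (D t) \<partial>lebesgue)"
    by (intro nn_integral_cong) (simp add: indicator_def)
  also have "\<dots> \<le> ennreal (2 * Y * l)" by (rule nn)
  finally have "(LINT t:?I|lebesgue. D t) \<le> 2 * Y * l" using Y l0 by (simp add: ennreal_le_iff)
  then show "(LINT t:?I|lebesgue. D t) / l \<le> 2 * Y" using l0 by (simp add: divide_le_eq)
qed

text \<open>The distance of the mean from \<open>u(x,t1)\<close> is at most the mean of the distances. By duality this is an inequality between scalar
integrals.\<close>
lemma time_osc_le:
  fixes u :: "(real^'n) \<times> real \<Rightarrow> nat \<Rightarrow> real"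
  assumes ab: "a < b" and l: "l = b - a"
    and E: "AE t in lebesgue. t \<in> {a<..<b} \<longrightarrow> t \<in> E" and t1: "t1 \<in> E"
    and D: "\<And>t. t \<in> E \<Longrightarrow> vnorm N (\<lambda>i. u (x, t) i - u (x, t1) i) \<le> D t" "set_integrable lebesgue {a<..<b} D"
    and um: "\<And>i. i < N \<Longrightarrow> (\<lambda>t. indicator {a<..<b} t *\<^sub>R u (x, t) i) \<in> borel_measurable lebesgue"
    and Y: "(LINT t:{a<..<b}|lebesgue. D t) / l \<le> Y" "0 \<le> Y"
    and t: "t \<in> E"
  shows "time_osc N {a<..<b} u x t \<le> D t + Y"
proof -
  let ?I = "{a<..<b}"
  have l0: "0 < l" using ab l by simp
  have ml: "measure lebesgue ?I = l" using ab l by simp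
  have Im: "integrable lebesgue (\<lambda>s. indicator ?I s *\<^sub>R c)" for c :: real
    using ab by (intro integrable_scaleR_left integrable_real_indicator) (auto simp: emeasure_lborel_Ioo)
  have diff_int: "integrable lebesgue (\<lambda>s. indicator ?I s *\<^sub>R (u (x, s) i - u (x, t1) i))" if i: "i < N" for i
  proof (rule integrable_dominated_AE[OF D(2)[unfolded set_integrable_def]])
    show "(\<lambda>s. indicator ?I s *\<^sub>R (u (x, s) i - u (x, t1) i)) \<in> borel_measurable lebesgue"
      using um[OF i] borel_measurable_integrable[OF Im[of "u (x, t1) i"]] by (simp add: right_diff_distrib)
    show "AE s in lebesgue. norm (indicator ?I s *\<^sub>R (u (x, s) i - u (x, t1) i)) \<le> indicator ?I s *\<^sub>R D s"
      using E
    proof eventually_elim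
      case (elim s)
      then show ?case
        using D(1)[of s] norm_le_vnorm[OF i, of "\<lambda>i. u (x, s) i - u (x, t1) i"] by (auto simp: indicator_def)
    qed
  qed
  have mean: "time_mean ?I u x i - u (x, t1) i = (LINT s|lebesgue. indicator ?I s *\<^sub>R (u (x, s) i - u (x, t1) i)) / l" if i: "i < N" for i
  proof -
    have "(LINT s:?I|lebesgue. u (x, s) i) = (LINT s|lebesgue. indicator ?I s *\<^sub>R (u (x, s) i - u (x, t1) i) + indicator ?I s *\<^sub>R u (x, t1) i)"
      unfolding set_lebesgue_integral_def
      by (intro Bochner_Integration.integral_cong refl) (simp add: indicator_def)
    also have "\<dots> = (LINT s|lebesgue. indicator ?I s *\<^sub>R (u (x, s) i - u (x, t1) i)) + l * u (x, t1) i"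
      using diff_int[OF i] Im[of "u (x, t1) i"] ml by (subst Bochner_Integration.integral_add) auto
    finally show ?thesis using l0 by (simp add: time_mean_def ml add_divide_distrib)
  qed
  have "vnorm N (\<lambda>i. time_mean ?I u x i - u (x, t1) i) \<le> Y"
  proof (rule vnorm_le_dual[OF _ Y(2)])
    fix e :: "nat \<Rightarrow> real" assume e: "vnorm N e = 1"
    have "(\<Sum>i<N. e i * (time_mean ?I u x i - u (x, t1) i))
        = (\<Sum>i<N. e i * (LINT s|lebesgue. indicator ?I s *\<^sub>R (u (x, s) i - u (x, t1) i))) / l"
      unfolding sum_divide_distrib by (intro sum.cong refl) (simp add: mean)
    also have "(\<Sum>i<N. e i * (LINT s|lebesgue. indicator ?I s *\<^sub>R (u (x, s) i - u (x, t1) i)))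
        = (LINT s|lebesgue. (\<Sum>i<N. e i * (indicator ?I s *\<^sub>R (u (x, s) i - u (x, t1) i))))"
      by (subst Bochner_Integration.integral_sum, use diff_int in simp, subst integral_mult_right_zero, rule refl)
    also have "\<dots> / l \<le> (LINT t:?I|lebesgue. D t) / l"
      unfolding set_lebesgue_integral_def
    proof (rule divide_right_mono[OF integral_mono_AE])
      show "integrable lebesgue (\<lambda>s. \<Sum>i<N. e i * (indicator ?I s *\<^sub>R (u (x, s) i - u (x, t1) i)))"
        using diff_int by (intro Bochner_Integration.integrable_sum integrable_mult_right) auto
      show "integrable lebesgue (\<lambda>s. indicator ?I s *\<^sub>R D s)" using D(2) by (simp add: set_integrable_def)
      show "AE s in lebesgue. (\<Sum>i<N. e i * (indicator ?I s *\<^sub>R (u (x, s) i - u (x, t1) i))) \<le> indicator ?I s *\<^sub>R D s"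
        using E
      proof eventually_elim
        case (elim s)
        show ?case
        proof (cases "s \<in> ?I")
          case True
          have "(\<Sum>i<N. e i * (u (x, s) i - u (x, t1) i)) \<le> vnorm N e * vnorm N (\<lambda>i. u (x, s) i - u (x, t1) i)"
            using norm_sum_scaleR_le_vnorm[of e "\<lambda>i. u (x, s) i - u (x, t1) i" N] by simp
          also have "\<dots> \<le> D s" using e D(1) elim True by simp
          finally show ?thesis using True by simp
        qed simp
      qed
    qed (use l0 in simp)
    also have "\<dots> \<le> Y" by (rule Y(1))
    finally show "(\<Sum>i<N. e i * (time_mean ?I u x i - u (x, t1) i)) \<le> Y" .
  qed
  moreover have "time_osc N ?I u x t \<le> vnorm N (\<lambda>i. u (x, t) i - u (x, t1) i) + vnorm N (\<lambda>i. - (time_mean ?I u x i - u (x, t1) i))"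
    unfolding time_osc_def
    using vnorm_triangle[of N "\<lambda>i. u (x, t) i - u (x, t1) i" "\<lambda>i. - (time_mean ?I u x i - u (x, t1) i)"] by simp
  moreover have "vnorm N (\<lambda>i. - (time_mean ?I u x i - u (x, t1) i)) = vnorm N (\<lambda>i. time_mean ?I u x i - u (x, t1) i)"
    unfolding vnorm_def by (simp add: abs_minus_commute)
  ultimately show ?thesis using D(1)[OF t] by simp
qed

lemma epowr_le:
  assumes "X \<le> ennreal y" "0 \<le> y" "0 \<le> a" shows "epowr X a \<le> ennreal (y powr a)"
proof -
  have fin: "X \<noteq> \<infinity>" using assms(1) by (auto simp: top_unique)
  have "enn2real X \<le> y" using enn2real_mono[OF assms(1)] assms(2) by simp
  then show ?thesis using fin assms(3) by (auto simp: epowr_def intro!: ennreal_leI powr_mono2)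
qed

lemma max_powr_le: "0 \<le> \<gamma> \<Longrightarrow> \<gamma> \<le> q \<Longrightarrow> max 1 y powr \<gamma> \<le> 1 + y powr q" for y :: real
  by (cases "y \<le> 1") (auto simp: max_def intro: powr_mono add_increasing)

lemma nn_average_le:
  assumes "a < b" "l = b - a" "(\<integral>\<^sup>+t\<in>{a<..<b}. f t \<partial>lebesgue) \<le> ennreal (c * l)" "0 \<le> c"
  shows "nn_average {a<..<b} f \<le> ennreal c"
proof -
  have l0: "0 < l" using assms by simp
  have em: "emeasure lebesgue {a<..<b} = ennreal l" using assms by simp
  have "nn_average {a<..<b} f \<le> ennreal (c * l) / ennreal l"
    unfolding nn_average_def em by (rule divide_right_mono_ennreal[OF assms(3)])
  also have "\<dots> = ennreal c" using l0 assms(4) by (simp add: divide_ennreal)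
  finally show ?thesis .
qed

lemma subcritical_constant_pos: "q < 2 \<Longrightarrow> 0 < 4 + 6 / (2 powr (1 - q / 2) - (1::real))"
proof -
  assume "q < 2"
  then have "1 < 2 powr (1 - q / 2)" using powr_less_mono[of 0 "1 - q / 2" 2] by simp
  then have "0 \<le> 6 / (2 powr (1 - q / 2) - 1)" by (intro divide_nonneg_nonneg) linarith+
  then show ?thesis by linarith
qed

lemma supercritical_constant_pos: "2 < q \<Longrightarrow> 0 < 4 + 6 / (1 - 2 powr (1 - q / 2) :: real)"
proof -
  assume "2 < q"
  then have "2 powr (1 - q / 2) < 1" using powr_less_mono[of "1 - q / 2" 0 2] by simp
  then have "0 \<le> 6 / (1 - 2 powr (1 - q / 2))" by (intro divide_nonneg_nonneg) linarith+
  then show ?thesis by linarith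
qed

context
  fixes u :: "(real^'n) \<times> real \<Rightarrow> nat \<Rightarrow> real" and x :: "real^'n" and g :: "real \<Rightarrow> ennreal" and a b l K :: real
    and E0 :: "real set" and N :: nat
  assumes ab: "a < b" and l: "l = b - a"
    and g: "g \<in> borel_measurable lebesgue" "\<And>t. 1 \<le> g t" and K: "0 < K"
    and E0: "AE t in lebesgue. t \<in> {a<..<b} \<longrightarrow> t \<in> E0" "E0 \<subseteq> {a<..<b}"
    and haj: "\<And>s t. s \<in> E0 \<Longrightarrow> t \<in> E0 \<Longrightarrow> g s < \<infinity> \<Longrightarrow> g t < \<infinity> \<Longrightarrow>
      vnorm N (\<lambda>i. u (x, t) i - u (x, s) i) \<le> K * sqrt \<bar>t - s\<bar> * (enn2real (g t) + enn2real (g s))"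
    and um: "\<And>i. i < N \<Longrightarrow> (\<lambda>t. indicator {a<..<b} t *\<^sub>R u (x, t) i) \<in> borel_measurable lebesgue"
begin

lemma normalised_hajlasz:
  assumes q: "0 < q" and fin: "nn_average {a<..<b} (\<lambda>t. epowr (g t) q) < \<infinity>"
  obtains m G E where "0 < m" "epowr (nn_average {a<..<b} (\<lambda>t. epowr (g t) q)) (1 / q) = ennreal m"
    "G \<in> borel_measurable lebesgue" "(\<integral>\<^sup>+t\<in>{a<..<b}. ennreal (G t powr q) \<partial>lebesgue) \<le> ennreal l"
    "AE t in lebesgue. t \<in> {a<..<b} \<longrightarrow> t \<in> E" "E \<subseteq> {a<..<b}"
    "\<And>t s. t \<in> E \<Longrightarrow> s \<in> E \<Longrightarrow> vnorm N (\<lambda>i. u (x, t) i - u (x, s) i) \<le> K * m * sqrt \<bar>t - s\<bar> * (G t + G s)"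
proof -
  define m where "m = enn2real (nn_average {a<..<b} (\<lambda>t. epowr (g t) q)) powr (1 / q)"
  note nc = normalised_control[OF ab l g q fin, folded m_def]
  define G where "G t = enn2real (g t) / m" for t
  define E where "E = {t \<in> E0. g t < \<infinity>}"
  show thesis
  proof (rule that[of m G E])
    show "G \<in> borel_measurable lebesgue"
      unfolding G_def[abs_def] by (intro borel_measurable_divide borel_measurable_enn2real g(1) borel_measurable_const)
    show "(\<integral>\<^sup>+t\<in>{a<..<b}. ennreal (G t powr q) \<partial>lebesgue) \<le> ennreal l" unfolding G_def by (rule nc(3))
    show "AE t in lebesgue. t \<in> {a<..<b} \<longrightarrow> t \<in> E"
      using E0(1) nc(2) by eventually_elim (auto simp: E_def)
    show "E \<subseteq> {a<..<b}" using E0(2) by (auto simp: E_def)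
    show "vnorm N (\<lambda>i. u (x, t) i - u (x, s) i) \<le> K * m * sqrt \<bar>t - s\<bar> * (G t + G s)" if "t \<in> E" "s \<in> E" for t s
    proof -
      have e: "m * (G t + G s) = enn2real (g t) + enn2real (g s)"
        using nc(1) by (simp add: G_def distrib_left)
      have e': "K * m * sqrt \<bar>t - s\<bar> * (G t + G s) = K * sqrt \<bar>t - s\<bar> * (enn2real (g t) + enn2real (g s))"
        unfolding e[symmetric] by (simp only: mult_ac)
      show ?thesis unfolding e' by (rule haj) (use that in \<open>auto simp: E_def\<close>)
    qed
  qed (use nc in auto)
qed

lemma vnorm_diff_triangle: "vnorm N (\<lambda>i. u (x, t) i - u (x, s) i)
   \<le> vnorm N (\<lambda>i. u (x, t) i - u (x, r) i) + vnorm N (\<lambda>i. u (x, r) i - u (x, s) i)"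
  using vnorm_triangle[of N "\<lambda>i. u (x, t) i - u (x, r) i" "\<lambda>i. u (x, r) i - u (x, s) i"] by simp

text \<open>The oscillation is bounded by a multiple of \<open>m l^(1/2) max 1 G ^ (1 - q/2)\<close>, and \<open>(1 - q/2) q' \<le> q\<close>, so its \<open>q'\<close>-th
power is at most a multiple of \<open>1 + G^q\<close>, whose mean is at most 2.\<close>
lemma time_osc_subcritical:
  assumes q: "1 < q" "q < 2" "q \<le> q'" "q' < 2 * q / (2 - q)"
  shows "epowr (nn_average {a<..<b} (\<lambda>t. ennreal (time_osc N {a<..<b} u x t powr q' / measure lebesgue {a<..<b} powr (q' / 2)))) (1 / q')
    \<le> ennreal (6 * K * (4 + 6 / (2 powr (1 - q / 2) - 1))) * epowr (nn_average {a<..<b} (\<lambda>t. epowr (g t) q)) (1 / q)"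
proof (cases "nn_average {a<..<b} (\<lambda>t. epowr (g t) q) < \<infinity>")
  case True
  let ?I = "{a<..<b}" and ?\<beta> = "1 - q / 2" and ?c = "4 + 6 / (2 powr (1 - q / 2) - 1)"
  have q0: "0 < q" "0 < q'" and \<beta>: "0 < ?\<beta>" "?\<beta> \<le> q" and \<beta>q': "?\<beta> * q' \<le> q" using q by (auto simp: field_simps)
  have c: "0 < ?c" by (rule subcritical_constant_pos[OF q(2)])
  have l0: "0 < l" using ab l by simp
  have ml: "measure lebesgue ?I = l" using ab l by simp
  obtain m G E where m: "0 < m" "epowr (nn_average ?I (\<lambda>t. epowr (g t) q)) (1 / q) = ennreal m"
    and G: "G \<in> borel_measurable lebesgue" "(\<integral>\<^sup>+t\<in>?I. ennreal (G t powr q) \<partial>lebesgue) \<le> ennreal l"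
    and E: "AE t in lebesgue. t \<in> ?I \<longrightarrow> t \<in> E" "E \<subseteq> ?I"
    and hajE: "\<And>t s. t \<in> E \<Longrightarrow> s \<in> E \<Longrightarrow> vnorm N (\<lambda>i. u (x, t) i - u (x, s) i) \<le> K * m * sqrt \<bar>t - s\<bar> * (G t + G s)"
    by (rule normalised_hajlasz[OF q0(1) True]) (rule that)
  have Km: "0 \<le> K * m" using K m by simp
  obtain t1 where t1: "t1 \<in> E" "\<forall>t\<in>E. vnorm N (\<lambda>i. u (x, t) i - u (x, t1) i) \<le> K * m * sqrt l * (?c * max 1 (G t) powr ?\<beta>)"
    using hajlasz_bound_subcritical[OF ab l G(1) E vnorm_diff_triangle hajE Km G(2) q0(1) q(2)] by blast
  define Y where "Y = K * m * sqrt l * ?c"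
  define D where "D t = Y * max 1 (G t) powr ?\<beta>" for t
  have Y: "0 \<le> Y" unfolding Y_def
    by (rule mult_nonneg_nonneg[OF mult_nonneg_nonneg[OF Km real_sqrt_ge_zero[OF less_imp_le[OF l0]]] less_imp_le[OF c]])
  have maxm: "(\<lambda>t. max 1 (G t) powr e) \<in> borel_measurable lebesgue" for e using G(1) by measurable
  have D: "D \<in> borel_measurable lebesgue" unfolding D_def[abs_def] by (intro borel_measurable_times borel_measurable_const maxm)
  have D0: "0 \<le> D t" for t using Y by (simp add: D_def)
  have D_le: "D t \<le> Y * (1 + G t powr q)" for t
    unfolding D_def using Y \<beta> by (intro mult_left_mono max_powr_le) auto
  note avg = average_le_two[OF ab l D D0 D_le Y G(2,1)]
  have osc: "time_osc N ?I u x t \<le> 3 * Y * max 1 (G t) powr ?\<beta>" if t: "t \<in> E" for t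
  proof -
    have "time_osc N ?I u x t \<le> D t + 2 * Y"
      by (rule time_osc_le[OF ab l E(1) t1(1) _ avg(2) um avg(3) _ t]) (use t1(2) Y in \<open>auto simp: D_def Y_def mult.assoc\<close>)
    moreover have "2 * Y * 1 \<le> 2 * Y * max 1 (G t) powr ?\<beta>"
      using Y \<beta> by (intro mult_left_mono ge_one_powr_ge_zero) auto
    ultimately show ?thesis by (simp add: D_def)
  qed
  define Z where "Z = (3 * K * m * ?c) powr q'"
  have Z0: "0 \<le> Z" by (simp add: Z_def)
  have ratio: "time_osc N ?I u x t powr q' / measure lebesgue ?I powr (q' / 2) \<le> Z * max 1 (G t) powr (?\<beta> * q')" if t: "t \<in> E" for t
  proof -
    have "time_osc N ?I u x t powr q' \<le> (3 * Y * max 1 (G t) powr ?\<beta>) powr q'"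
      using osc[OF t] q0 by (intro powr_mono2) (auto simp: time_osc_def)
    also have "3 * Y * max 1 (G t) powr ?\<beta> = (3 * K * m * ?c) * l powr (1 / 2) * max 1 (G t) powr ?\<beta>"
      using l0 by (simp add: Y_def powr_half_sqrt)
    also have "\<dots> powr q' = Z * l powr (q' / 2) * max 1 (G t) powr (?\<beta> * q')"
      using K m c by (simp add: powr_mult powr_powr Z_def)
    finally show ?thesis using l0 unfolding ml by (simp add: divide_le_eq mult_ac)
  qed
  have "(\<integral>\<^sup>+t\<in>?I. ennreal (time_osc N ?I u x t powr q' / measure lebesgue ?I powr (q' / 2)) \<partial>lebesgue)
      \<le> (\<integral>\<^sup>+t\<in>?I. ennreal (Z * max 1 (G t) powr (?\<beta> * q')) \<partial>lebesgue)"
  proof (rule nn_integral_mono_AE, use E(1) in eventually_elim)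
    case (elim t)
    show ?case
    proof (cases "t \<in> ?I")
      case True
      with elim have "t \<in> E" by blast
      then show ?thesis by (intro mult_right_mono ennreal_leI ratio) simp_all
    qed simp
  qed
  also have "\<dots> \<le> ennreal (2 * Z * l)"
  proof (rule average_le_two(1)[OF ab l _ _ _ Z0 G(2,1)])
    show "(\<lambda>t. Z * max 1 (G t) powr (?\<beta> * q')) \<in> borel_measurable lebesgue"
      by (intro borel_measurable_times borel_measurable_const maxm)
    show "Z * max 1 (G t) powr (?\<beta> * q') \<le> Z * (1 + G t powr q)" for t
      using Z0 \<beta> \<beta>q' q0 by (intro mult_left_mono max_powr_le) auto
  qed (use Z0 in simp)
  finally have "nn_average ?I (\<lambda>t. ennreal (time_osc N ?I u x t powr q' / measure lebesgue ?I powr (q' / 2))) \<le> ennreal (2 * Z)"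
    using Z0 by (intro nn_average_le[OF ab l]) auto
  then have "epowr (nn_average ?I (\<lambda>t. ennreal (time_osc N ?I u x t powr q' / measure lebesgue ?I powr (q' / 2)))) (1 / q')
      \<le> ennreal ((2 * Z) powr (1 / q'))"
    using Z0 q0 by (intro epowr_le) auto
  also have "(2 * Z) powr (1 / q') \<le> 2 * (3 * K * m * ?c)"
  proof -
    have "(2 * Z) powr (1 / q') = 2 powr (1 / q') * (3 * K * m * ?c)"
      using q0 K m c by (simp add: powr_mult Z_def powr_powr)
    also have "\<dots> \<le> 2 powr 1 * (3 * K * m * ?c)"
      using q K m c by (intro mult_right_mono powr_mono) auto
    finally show ?thesis by simp
  qed
  then have "ennreal ((2 * Z) powr (1 / q')) \<le> ennreal (6 * K * ?c * m)" by (intro ennreal_leI) (simp add: mult_ac)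
  also have "ennreal (6 * K * ?c * m) = ennreal (6 * K * ?c) * ennreal m"
    using K c m by (intro ennreal_mult) auto
  finally show ?thesis unfolding m(2) .
next
  case False
  then have top: "nn_average {a<..<b} (\<lambda>t. epowr (g t) q) = \<infinity>" by (simp flip: less_top)
  have "0 < 4 + 6 / (2 powr (1 - q / 2) - (1::real))"
    by (rule subcritical_constant_pos[OF q(2)])
  then show ?thesis unfolding top using K by (simp add: epowr_def ennreal_mult_top)
qed

lemma time_osc_supercritical:
  assumes q: "2 < q"
  shows "esssup (lebesgue_on {a<..<b}) (\<lambda>t. ennreal (time_osc N {a<..<b} u x t / measure lebesgue {a<..<b} powr (1 / 2)))
    \<le> ennreal (3 * K * (4 + 6 / (1 - 2 powr (1 - q / 2)))) * epowr (nn_average {a<..<b} (\<lambda>t. epowr (g t) q)) (1 / q)"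
proof (cases "nn_average {a<..<b} (\<lambda>t. epowr (g t) q) < \<infinity>")
  case True
  let ?I = "{a<..<b}" and ?c = "4 + 6 / (1 - 2 powr (1 - q / 2))"
  have q0: "0 < q" using q by simp
  have c: "0 < ?c" by (rule supercritical_constant_pos[OF q])
  have l0: "0 < l" using ab l by simp
  have ml: "measure lebesgue ?I = l" using ab l by simp
  obtain m G E where m: "0 < m" "epowr (nn_average ?I (\<lambda>t. epowr (g t) q)) (1 / q) = ennreal m"
    and G: "G \<in> borel_measurable lebesgue" "(\<integral>\<^sup>+t\<in>?I. ennreal (G t powr q) \<partial>lebesgue) \<le> ennreal l"
    and E: "AE t in lebesgue. t \<in> ?I \<longrightarrow> t \<in> E" "E \<subseteq> ?I"
    and hajE: "\<And>t s. t \<in> E \<Longrightarrow> s \<in> E \<Longrightarrow> vnorm N (\<lambda>i. u (x, t) i - u (x, s) i) \<le> K * m * sqrt \<bar>t - s\<bar> * (G t + G s)"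
    by (rule normalised_hajlasz[OF q0 True]) (rule that)
  have Km: "0 \<le> K * m" using K m by simp
  define Y where "Y = K * m * sqrt l * ?c"
  have Y: "0 \<le> Y" unfolding Y_def
    by (rule mult_nonneg_nonneg[OF mult_nonneg_nonneg[OF Km real_sqrt_ge_zero[OF less_imp_le[OF l0]]] less_imp_le[OF c]])
  obtain t1 where t1: "t1 \<in> E" "\<forall>t\<in>E. vnorm N (\<lambda>i. u (x, t) i - u (x, t1) i) \<le> Y"
    using hajlasz_bound_supercritical[OF ab l G(1) E vnorm_diff_triangle hajE Km G(2) q] unfolding Y_def by blast
  have Y_le: "Y \<le> Y * (1 + G t powr q)" for t using Y by (simp add: distrib_left)
  note avg = average_le_two[OF ab l borel_measurable_const Y Y_le Y G(2,1)]
  have osc: "time_osc N ?I u x t \<le> 3 * Y" if t: "t \<in> E" for t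
  proof -
    have "time_osc N ?I u x t \<le> Y + 2 * Y"
      by (rule time_osc_le[OF ab l E(1) t1(1) _ avg(2) um avg(3) _ t]) (use t1(2) Y in auto)
    then show ?thesis by simp
  qed
  have bound: "ennreal (time_osc N ?I u x t / measure lebesgue ?I powr (1 / 2)) \<le> ennreal (3 * K * ?c) * ennreal m" if t: "t \<in> E" for t
  proof -
    have "time_osc N ?I u x t / measure lebesgue ?I powr (1 / 2) \<le> 3 * Y / sqrt l"
      unfolding ml using osc[OF t] l0 by (simp add: powr_half_sqrt divide_right_mono)
    also have "\<dots> = 3 * K * ?c * m" using l0 by (simp add: Y_def)
    finally have "ennreal (time_osc N ?I u x t / measure lebesgue ?I powr (1 / 2)) \<le> ennreal (3 * K * ?c * m)"
      by (rule ennreal_leI)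
    also have "\<dots> = ennreal (3 * K * ?c) * ennreal m" using K c m by (intro ennreal_mult) auto
    finally show ?thesis .
  qed
  have meas: "(\<lambda>t. ennreal (time_osc N ?I u x t / measure lebesgue ?I powr (1 / 2))) \<in> borel_measurable (lebesgue_on ?I)"
  proof -
    have "(\<lambda>t. u (x, t) i) \<in> borel_measurable (lebesgue_on ?I)" if i: "i < N" for i
    proof -
      have "(\<lambda>t. indicator ?I t *\<^sub>R u (x, t) i) = (\<lambda>t. if t \<in> ?I then u (x, t) i else 0)" by (auto simp: indicator_def)
      from um[OF i, unfolded this] show ?thesis by (rule borel_measurable_if_D)
    qed
    then have "(\<lambda>t. time_osc N ?I u x t) \<in> borel_measurable (lebesgue_on ?I)"
      unfolding time_osc_def by (intro borel_measurable_vnorm borel_measurable_diff borel_measurable_const)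
    then show ?thesis
      by (intro measurable_compose[OF _ measurable_ennreal] borel_measurable_divide borel_measurable_const)
  qed
  have "AE t in lebesgue_on ?I. ennreal (time_osc N ?I u x t / measure lebesgue ?I powr (1 / 2)) \<le> ennreal (3 * K * ?c) * ennreal m"
  proof (subst AE_restrict_space_iff)
    show "AE t in lebesgue. t \<in> ?I \<longrightarrow>
        ennreal (time_osc N ?I u x t / measure lebesgue ?I powr (1 / 2)) \<le> ennreal (3 * K * ?c) * ennreal m"
      using E(1) by eventually_elim (use bound in blast)
  qed simp
  then have "esssup (lebesgue_on ?I) (\<lambda>t. ennreal (time_osc N ?I u x t / measure lebesgue ?I powr (1 / 2))) \<le> ennreal (3 * K * ?c) * ennreal m"
    using meas by (simp add: esssup_eq_AE Inf_lower)
  then show ?thesis unfolding m(2) .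
next
  case False
  then have top: "nn_average {a<..<b} (\<lambda>t. epowr (g t) q) = \<infinity>" by (simp flip: less_top)
  have "0 < 4 + 6 / (1 - 2 powr (1 - q / 2) :: real)"
    by (rule supercritical_constant_pos[OF q])
  then show ?thesis unfolding top using K by (simp add: epowr_def ennreal_mult_top)
qed

text \<open>The squared oscillation is at most a multiple of \<open>m\<^sup>2 l (1 + 2 ln (max 1 G))\<close>. After division by the constant the
exponential is at most \<open>3 (max 1 G)\<^sup>2\<close>, whose mean is at most 6. If \<open>g\<close> is not square integrable, the quotient in the
exponent is 0.\<close>
lemma time_osc_critical:
  "nn_average {a<..<b} (\<lambda>t. ennreal (exp ((enn2real (ennreal (time_osc N {a<..<b} u x t)
      / (ennreal ((48 * K + 8) * measure lebesgue {a<..<b} powr (1 / 2))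
         * epowr (nn_average {a<..<b} (\<lambda>s. epowr (g s) 2)) (1 / 2))))\<^sup>2))) \<le> ennreal (48 * K + 8)"
proof (cases "nn_average {a<..<b} (\<lambda>t. epowr (g t) 2) < \<infinity>")
  case True
  let ?I = "{a<..<b}" and ?c = "48 * K + 8"
  have l0: "0 < l" using ab l by simp
  have ml: "measure lebesgue ?I = l" using ab l by simp
  obtain m G E where m: "0 < m" "epowr (nn_average ?I (\<lambda>t. epowr (g t) 2)) (1 / 2) = ennreal m"
    and G: "G \<in> borel_measurable lebesgue" "(\<integral>\<^sup>+t\<in>?I. ennreal (G t powr 2) \<partial>lebesgue) \<le> ennreal l"
    and E: "AE t in lebesgue. t \<in> ?I \<longrightarrow> t \<in> E" "E \<subseteq> ?I"
    and hajE: "\<And>t s. t \<in> E \<Longrightarrow> s \<in> E \<Longrightarrow> vnorm N (\<lambda>i. u (x, t) i - u (x, s) i) \<le> K * m * sqrt \<bar>t - s\<bar> * (G t + G s)"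
    by (rule normalised_hajlasz[of 2, OF _ True]) (simp, rule that)
  have Km: "0 \<le> K * m" using K m by simp
  define S where "S t = sqrt (1 + 2 * ln (max 1 (G t)))" for t
  have S1: "1 \<le> S t" for t by (simp add: S_def)
  have ln_le: "1 + 2 * ln (max 1 (G t)) \<le> max 1 (G t) powr 2" for t
  proof -
    have "2 * ln (max 1 (G t)) = ln (max 1 (G t) powr 2)" by (subst ln_powr) simp_all
    also have "\<dots> \<le> max 1 (G t) powr 2 - 1" by (rule ln_le_minus_one) simp
    finally show ?thesis by simp
  qed
  have S_le: "S t \<le> 1 + G t powr 2" for t
  proof -
    have "S t \<le> S t * S t" using S1[of t] by simp
    also have "\<dots> = 1 + 2 * ln (max 1 (G t))" by (simp add: S_def)
    also have "\<dots> \<le> 1 + G t powr 2" using ln_le[of t] max_powr_le[of 2 2 "G t"] by simp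
    finally show ?thesis .
  qed
  obtain t1 where t1: "t1 \<in> E" "\<forall>t\<in>E. vnorm N (\<lambda>i. u (x, t) i - u (x, t1) i) \<le> K * m * sqrt l * (16 * S t)"
    using hajlasz_bound_critical[OF ab l G(1) E vnorm_diff_triangle hajE Km G(2)] unfolding S_def by blast
  define Y where "Y = K * m * sqrt l * 16"
  have Y: "0 \<le> Y" unfolding Y_def using Km l0 by simp
  have Sm: "S \<in> borel_measurable lebesgue" unfolding S_def[abs_def] using G(1) by measurable
  have D: "(\<lambda>t. Y * S t) \<in> borel_measurable lebesgue" using Sm by simp
  have D0: "0 \<le> Y * S t" for t using Y S1[of t] by simp
  have D_le: "Y * S t \<le> Y * (1 + G t powr 2)" for t using Y S_le by (intro mult_left_mono)
  note avg = average_le_two[OF ab l D D0 D_le Y G(2,1)]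
  have osc: "time_osc N ?I u x t \<le> 3 * Y * S t" if t: "t \<in> E" for t
  proof -
    have "time_osc N ?I u x t \<le> Y * S t + 2 * Y"
      by (rule time_osc_le[OF ab l E(1) t1(1) _ avg(2) um avg(3) _ t]) (use t1(2) Y in \<open>auto simp: Y_def\<close>)
    moreover have "2 * Y * 1 \<le> 2 * Y * S t" using Y S1 by (intro mult_left_mono) auto
    ultimately show ?thesis by simp
  qed
  let ?r = "\<lambda>t. enn2real (ennreal (time_osc N ?I u x t) / (ennreal (?c * measure lebesgue ?I powr (1 / 2)) * ennreal m))"
  have exp_le: "exp ((?r t)\<^sup>2) \<le> 3 * max 1 (G t) powr 2" if t: "t \<in> E" for t
  proof -
    have pos: "0 < ?c * sqrt l * m" using K l0 m by simp
    have "ennreal (?c * measure lebesgue ?I powr (1 / 2)) * ennreal m = ennreal (?c * sqrt l * m)"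
      using K l0 m by (simp add: ml powr_half_sqrt ennreal_mult)
    then have "?r t = time_osc N ?I u x t / (?c * sqrt l * m)"
      using pos by (simp add: divide_ennreal time_osc_def)
    also have "\<dots> \<le> 3 * Y * S t / (?c * sqrt l * m)"
      using osc[OF t] pos by (intro divide_right_mono) auto
    also have "\<dots> = 48 * K / ?c * S t" using l0 m by (simp add: Y_def)
    also have "\<dots> \<le> 1 * S t" using K S1[of t] by (intro mult_right_mono) auto
    finally have "?r t \<le> S t" by simp
    then have "(?r t)\<^sup>2 \<le> (S t)\<^sup>2" by (intro power_mono) auto
    then have "exp ((?r t)\<^sup>2) \<le> exp (1 + 2 * ln (max 1 (G t)))" by (simp add: S_def)
    also have "\<dots> = exp 1 * max 1 (G t) powr 2" by (simp add: exp_add powr_def)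
    also have "\<dots> \<le> 3 * max 1 (G t) powr 2" using exp_le by (intro mult_right_mono) auto
    finally show ?thesis .
  qed
  have "(\<integral>\<^sup>+t\<in>?I. ennreal (exp ((?r t)\<^sup>2)) \<partial>lebesgue) \<le> (\<integral>\<^sup>+t\<in>?I. ennreal (3 * max 1 (G t) powr 2) \<partial>lebesgue)"
  proof (rule nn_integral_mono_AE, use E(1) in eventually_elim)
    case (elim t)
    show ?case
    proof (cases "t \<in> ?I")
      case True
      with elim have "t \<in> E" by blast
      then show ?thesis by (intro mult_right_mono ennreal_leI exp_le) simp_all
    qed simp
  qed
  also have "\<dots> \<le> ennreal (2 * 3 * l)"
  proof (rule average_le_two(1)[OF ab l _ _ _ _ G(2,1)])
    show "(\<lambda>t. 3 * max 1 (G t) powr 2) \<in> borel_measurable lebesgue" using G(1) by measurable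
    show "3 * max 1 (G t) powr 2 \<le> 3 * (1 + G t powr 2)" for t by (intro mult_left_mono max_powr_le) auto
  qed auto
  finally have "nn_average ?I (\<lambda>t. ennreal (exp ((?r t)\<^sup>2))) \<le> ennreal 6"
    by (intro nn_average_le[OF ab l]) auto
  also have "\<dots> \<le> ennreal ?c" using K by (intro ennreal_leI) simp
  finally show ?thesis unfolding m(2) .
next
  case False
  then have top: "nn_average {a<..<b} (\<lambda>t. epowr (g t) 2) = \<infinity>" by (simp flip: less_top)
  have l0: "0 < l" using ab l by simp
  have "(\<integral>\<^sup>+t\<in>{a<..<b}. 1 \<partial>lebesgue) \<le> ennreal (1 * l)" using ab l by simp
  from nn_average_le[OF ab l this] have "nn_average {a<..<b} (\<lambda>t. 1) \<le> ennreal 1" by simp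
  also have "ennreal 1 \<le> ennreal (48 * K + 8)" using K by (intro ennreal_leI) simp
  finally show ?thesis unfolding top using K ab by (simp add: epowr_def ennreal_mult_top)
qed

end

section \<open>Regularity in time\<close>

definition line_hajlasz ::
    "nat \<Rightarrow> real \<Rightarrow> real set \<Rightarrow> ((real^'n) \<times> real \<Rightarrow> nat \<Rightarrow> real) \<Rightarrow> ((real^'n) \<times> real \<Rightarrow> ennreal) \<Rightarrow> real^'n \<Rightarrow> bool" where
  "line_hajlasz N K I u g x \<longleftrightarrow> (\<exists>E0. (AE t in lebesgue. t \<in> I \<longrightarrow> t \<in> E0) \<and> E0 \<subseteq> I \<and>
    (\<forall>s\<in>E0. \<forall>t\<in>E0. g (x, s) < \<infinity> \<longrightarrow> g (x, t) < \<infinity> \<longrightarrow>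
      vnorm N (\<lambda>i. u (x, t) i - u (x, s) i) \<le> K * sqrt \<bar>t - s\<bar> * (enn2real (g (x, t)) + enn2real (g (x, s)))) \<and>
    (\<forall>i<N. (\<lambda>t. indicator I t *\<^sub>R u (x, t) i) \<in> borel_measurable lebesgue))"

lemma line_hajlasz_estimates:
  fixes u :: "(real^'n) \<times> real \<Rightarrow> nat \<Rightarrow> real" and t0 r K :: real
  defines "I \<equiv> time_interval t0 r"
  assumes line: "line_hajlasz N K I u g x" and r: "0 < r" and K: "0 < K"
    and g: "g \<in> borel_measurable borel" "\<And>z. 1 \<le> g z"
  shows "1 < q \<Longrightarrow> q < 2 \<Longrightarrow> q \<le> q' \<Longrightarrow> q' < 2 * q / (2 - q) \<Longrightarrow>
      epowr (nn_average I (\<lambda>t. ennreal (time_osc N I u x t powr q' / measure lebesgue I powr (q' / 2)))) (1 / q')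
      \<le> ennreal (6 * K * (4 + 6 / (2 powr (1 - q / 2) - 1))) * epowr (nn_average I (\<lambda>t. epowr (g (x, t)) q)) (1 / q)"
    and "nn_average I (\<lambda>t. ennreal (exp ((enn2real (ennreal (time_osc N I u x t)
        / (ennreal ((48 * K + 8) * measure lebesgue I powr (1 / 2))
           * epowr (nn_average I (\<lambda>s. epowr (g (x, s)) 2)) (1 / 2))))\<^sup>2))) \<le> ennreal (48 * K + 8)"
    and "2 < q \<Longrightarrow> esssup (lebesgue_on I) (\<lambda>t. ennreal (time_osc N I u x t / measure lebesgue I powr (1 / 2)))
      \<le> ennreal (3 * K * (4 + 6 / (1 - 2 powr (1 - q / 2)))) * epowr (nn_average I (\<lambda>t. epowr (g (x, t)) q)) (1 / q)"
proof -
  obtain E0 where E0: "AE t in lebesgue. t \<in> I \<longrightarrow> t \<in> E0" "E0 \<subseteq> I"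
    "\<forall>s\<in>E0. \<forall>t\<in>E0. g (x, s) < \<infinity> \<longrightarrow> g (x, t) < \<infinity> \<longrightarrow>
      vnorm N (\<lambda>i. u (x, t) i - u (x, s) i) \<le> K * sqrt \<bar>t - s\<bar> * (enn2real (g (x, t)) + enn2real (g (x, s)))"
    "\<forall>i<N. (\<lambda>t. indicator I t *\<^sub>R u (x, t) i) \<in> borel_measurable lebesgue"
    using line unfolding line_hajlasz_def by blast
  have I: "t0 - r\<^sup>2 < t0 + r\<^sup>2" using r by simp
  note ctx = I refl borel_measurable_lebesgueI[OF borel_measurable_slice_time[OF g(1)]] g(2) K E0(1,2)[unfolded I_def]
    E0(3)[rule_format] E0(4)[rule_format, unfolded I_def]
  note subcritical = time_osc_subcritical[OF ctx] and critical = time_osc_critical[OF ctx]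
    and supercritical = time_osc_supercritical[OF ctx]
  show "epowr (nn_average I (\<lambda>t. ennreal (time_osc N I u x t powr q' / measure lebesgue I powr (q' / 2)))) (1 / q')
      \<le> ennreal (6 * K * (4 + 6 / (2 powr (1 - q / 2) - 1))) * epowr (nn_average I (\<lambda>t. epowr (g (x, t)) q)) (1 / q)"
    if "1 < q" "q < 2" "q \<le> q'" "q' < 2 * q / (2 - q)"
    unfolding I_def by (rule subcritical) (use that in simp_all)
  show "nn_average I (\<lambda>t. ennreal (exp ((enn2real (ennreal (time_osc N I u x t)
        / (ennreal ((48 * K + 8) * measure lebesgue I powr (1 / 2))
           * epowr (nn_average I (\<lambda>s. epowr (g (x, s)) 2)) (1 / 2))))\<^sup>2))) \<le> ennreal (48 * K + 8)"
    unfolding I_def by (rule critical)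
  show "esssup (lebesgue_on I) (\<lambda>t. ennreal (time_osc N I u x t / measure lebesgue I powr (1 / 2)))
      \<le> ennreal (3 * K * (4 + 6 / (1 - 2 powr (1 - q / 2)))) * epowr (nn_average I (\<lambda>t. epowr (g (x, t)) q)) (1 / q)"
    if "2 < q"
    unfolding I_def by (rule supercritical) (use that in simp_all)
qed

text \<open>By Fubini almost every vertical line meets the good points of the pointwise estimate in a set of full
measure, and \<open>u\<close> is measurable on it.\<close>
lemma AE_line_hajlasz:
  fixes x0 :: "real^'n"
  assumes sys: "parabolic_system p q L \<Omega> T N \<nu> A F u Du" and p: "1 < p" "p \<noteq> 2" and pq: "1 \<le> p * q / 2"
    and r: "0 < r" and cc: "compactly_contained (par_cyl x0 t0 (2 * r)) (space_time \<Omega> T)"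
    and C: "\<And>y::real^'n. bump y \<le> C" "0 < C" "\<And>(y::real^'n) w. \<bar>frechet_derivative bump (at y) w\<bar> \<le> C * norm w"
    and C': "\<And>y::real. bump y \<le> C'" "0 < C'"
    and K: "4 * C * C' * unit_ball_vol CARD('n) + 2 * C * (L + 1) * unit_ball_vol CARD('n) \<le> K"
    and g: "g = max_control N p u Du F x0 t0 r"
  shows "AE x\<in>ball x0 r in lebesgue. line_hajlasz N K (time_interval t0 r) u g x"
proof -
  define W where "W = par_cyl x0 t0 (2 * r)"
  let ?I = "time_interval t0 r"
  note ctx = sys p(1) pq r cc W_def C C' refl
  have r4: "r\<^sup>2 \<le> (2 * r)\<^sup>2" using r by (intro power_mono) auto
  have "AE x in lebesgue. \<forall>i\<in>{..<N}. (\<lambda>t. indicator W (x, t) *\<^sub>R u (x, t) i) \<in> borel_measurable lebesgue"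
  proof (rule AE_finite_allI)
    fix i assume "i \<in> {..<N}"
    then have "integrable lebesgue (\<lambda>z. indicator W z *\<^sub>R u z i)"
      by (intro component_integrable(1)[OF ctx]) simp
    from AE_slice_measurable[OF borel_measurable_integrable[OF this]]
    show "AE x in lebesgue. (\<lambda>t. indicator W (x, t) *\<^sub>R u (x, t) i) \<in> borel_measurable lebesgue" .
  qed simp
  with AE_lebesgue_slices(1)[OF AE_kernel_points[OF ctx]] show ?thesis
  proof eventually_elim
    case (elim x)
    show ?case
    proof
      assume x: "x \<in> ball x0 r"
      define E0 where "E0 = {t \<in> ?I. (x, t) \<in> kernel_points N u W}"
      have 1: "AE t in lebesgue. t \<in> ?I \<longrightarrow> t \<in> E0"
        using elim(1) by eventually_elim (simp add: E0_def)
      have 2: "vnorm N (\<lambda>i. u (x, t) i - u (x, s) i) \<le> K * sqrt \<bar>t - s\<bar> * (enn2real (g (x, t)) + enn2real (g (x, s)))"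
        if "s \<in> E0" "t \<in> E0" "g (x, s) < \<infinity>" "g (x, t) < \<infinity>" for s t
      proof -
        have "vnorm N (\<lambda>i. u (x, t) i - u (x, s) i)
          \<le> (4 * C * C' * unit_ball_vol CARD('n) + 2 * C * (L + 1) * unit_ball_vol CARD('n)) * sqrt \<bar>t - s\<bar> * (enn2real (g (x, t)) + enn2real (g (x, s)))"
          by (rule pointwise_hajlasz[OF ctx p(2) g]) (use that x in \<open>auto simp: E0_def\<close>)
        also have "\<dots> \<le> K * sqrt \<bar>t - s\<bar> * (enn2real (g (x, t)) + enn2real (g (x, s)))"
          using K by (intro mult_right_mono) auto
        finally show ?thesis .
      qed
      have 3: "(\<lambda>t. indicator ?I t *\<^sub>R u (x, t) i) \<in> borel_measurable lebesgue" if "i < N" for i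
      proof -
        have "(\<lambda>t. indicator ?I t *\<^sub>R (indicator W (x, t) *\<^sub>R u (x, t) i)) \<in> borel_measurable lebesgue"
        proof (rule borel_measurable_scaleR[OF borel_measurable_indicator])
          show "(\<lambda>t. indicator W (x, t) *\<^sub>R u (x, t) i) \<in> borel_measurable lebesgue"
            using elim(2) that by blast
        qed simp
        moreover have "indicator ?I t *\<^sub>R (indicator W (x, t) *\<^sub>R u (x, t) i) = indicator ?I t *\<^sub>R u (x, t) i" for t
        proof (cases "t \<in> ?I")
          case True
          then have "(x, t) \<in> W" using x r r4 by (auto simp: W_def par_cyl_def)
          then show ?thesis by simp
        qed simp
        ultimately show ?thesis by (simp only:)
      qed
      show "line_hajlasz N K ?I u g x"
        unfolding line_hajlasz_def
        by (rule exI[of _ E0], intro conjI ballI allI impI 1 2 3) (auto simp: E0_def)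
    qed
  qed
qed

theorem theorem8p7:
  fixes p q L :: real
  assumes "1 < p" and "p \<noteq> 2" and "max 1 (p - 1) < q" and "1 \<le> p * q / 2"
  shows
    "(q < 2 \<longrightarrow> (\<forall>q'. 1 < q \<and> q \<le> q' \<and> q' < 2 * q / (2 - q) \<longrightarrow>
       (\<exists>c::real. 0 < c \<and>
         (\<forall>(\<Omega> :: (real^'n) set) T N \<nu> A F u Du. parabolic_system p q L \<Omega> T N \<nu> A F u Du \<longrightarrow>
           (\<forall>x0 t0 r. 0 < r \<and> compactly_contained (par_cyl x0 t0 (2 * r)) (space_time \<Omega> T) \<longrightarrow>
             (let I = time_interval t0 r; g = max_control N p u Du F x0 t0 r in
               AE x\<in>ball x0 r in lebesgue.
                 epowr (nn_average I (\<lambda>t. ennreal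
                     (time_osc N I u x t powr q' / measure lebesgue I powr (q' / 2)))) (1 / q')
                 \<le> ennreal c * epowr (nn_average I (\<lambda>t. epowr (g (x, t)) q)) (1 / q)))))))
     \<and>
     (q = 2 \<longrightarrow>
       (\<exists>c::real. 0 < c \<and>
         (\<forall>(\<Omega> :: (real^'n) set) T N \<nu> A F u Du. parabolic_system p q L \<Omega> T N \<nu> A F u Du \<longrightarrow>
           (\<forall>x0 t0 r. 0 < r \<and> compactly_contained (par_cyl x0 t0 (2 * r)) (space_time \<Omega> T) \<longrightarrow>
             (let I = time_interval t0 r; g = max_control N p u Du F x0 t0 r in
               AE x\<in>ball x0 r in lebesgue.
                 nn_average I (\<lambda>t. ennreal (exp ((enn2real
                     (ennreal (time_osc N I u x t)
                       / (ennreal (c * measure lebesgue I powr (1 / 2))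
                          * epowr (nn_average I (\<lambda>s. epowr (g (x, s)) 2)) (1 / 2))))\<^sup>2)))
                 \<le> ennreal c)))))
     \<and>
     (2 < q \<longrightarrow>
       (\<exists>c::real. 0 < c \<and>
         (\<forall>(\<Omega> :: (real^'n) set) T N \<nu> A F u Du. parabolic_system p q L \<Omega> T N \<nu> A F u Du \<longrightarrow>
           (\<forall>x0 t0 r. 0 < r \<and> compactly_contained (par_cyl x0 t0 (2 * r)) (space_time \<Omega> T) \<longrightarrow>
             (let I = time_interval t0 r; g = max_control N p u Du F x0 t0 r in
               AE x\<in>ball x0 r in lebesgue.
                 esssup (lebesgue_on I)
                   (\<lambda>t. ennreal (time_osc N I u x t / measure lebesgue I powr (1 / 2)))
                 \<le> ennreal c * epowr (nn_average I (\<lambda>t. epowr (g (x, t)) q)) (1 / q))))))"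
proof -
  have p: "1 < p" "p \<noteq> 2" and pq: "1 \<le> p * q / 2" using assms by auto
  obtain C where C: "0 < C" "\<And>y::real^'n. bump y \<le> C"
    "\<And>(y::real^'n) (w::real^'n). \<bar>frechet_derivative bump (at y) w\<bar> \<le> C * norm w"
    by (rule bump_bounds[where 'a="real^'n"]) blast
  obtain C' where C': "0 < C'" "\<And>y::real. bump y \<le> C'"
    "\<And>(y::real) (w::real). \<bar>frechet_derivative bump (at y) w\<bar> \<le> C' * norm w"
    by (rule bump_bounds[where 'a=real]) blast
  \<comment> \<open>The absolute value and the summand 1 keep \<open>K\<close> positive for every real \<open>L\<close>.\<close>
  define K where "K = \<bar>4 * C * C' * unit_ball_vol CARD('n) + 2 * C * (L + 1) * unit_ball_vol CARD('n)\<bar> + 1"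
  have K: "0 < K" "4 * C * C' * unit_ball_vol CARD('n) + 2 * C * (L + 1) * unit_ball_vol CARD('n) \<le> K"
    by (auto simp: K_def)
  have lines: "AE x\<in>ball x0 r in lebesgue. line_hajlasz N K (time_interval t0 r) u (max_control N p u Du F x0 t0 r) x"
    if "parabolic_system p q L \<Omega> T N \<nu> A F u Du" "0 < r \<and> compactly_contained (par_cyl x0 t0 (2 * r)) (space_time \<Omega> T)"
    for \<Omega> :: "(real^'n) set" and T N \<nu> A F u Du x0 t0 r
    by (rule AE_line_hajlasz[OF that(1) p pq that(2)[THEN conjunct1] that(2)[THEN conjunct2] C(2,1,3) C'(2,1) K(2) refl])
  note estimates = line_hajlasz_estimates[OF _ _ K(1) borel_measurable_max_control max_control_ge_1[OF p(1)]]
  show ?thesis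
    unfolding Let_def
  proof (intro conjI impI allI, goal_cases)
    case (1 q')
    let ?c = "6 * K * (4 + 6 / (2 powr (1 - q / 2) - 1))"
    have "0 < ?c" by (rule mult_pos_pos[OF mult_pos_pos[OF _ K(1)] subcritical_constant_pos[OF 1(1)]]) simp
    then show ?case
    proof (intro exI[of _ ?c] conjI allI impI, goal_cases)
      case (2 \<Omega> T N \<nu> A F u Du x0 t0 r)
      from lines[OF 2(2,3)] show ?case
        by eventually_elim (use 1 2(3) estimates(1) in blast)
    qed
  next
    case 2
    have "0 < 48 * K + 8" using K(1) by simp
    then show ?case
    proof (intro exI[of _ "48 * K + 8"] conjI allI impI, goal_cases)
      case (2 \<Omega> T N \<nu> A F u Du x0 t0 r)
      from lines[OF 2(2,3)] show ?case
        by eventually_elim (use 2(3) estimates(2) in blast)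
    qed
  next
    case 3
    let ?c = "3 * K * (4 + 6 / (1 - 2 powr (1 - q / 2)))"
    have "0 < ?c" by (rule mult_pos_pos[OF mult_pos_pos[OF _ K(1)] supercritical_constant_pos[OF 3]]) simp
    then show ?case
    proof (intro exI[of _ ?c] conjI allI impI, goal_cases)
      case (2 \<Omega> T N \<nu> A F u Du x0 t0 r)
      from lines[OF 2(2,3)] show ?case
        by eventually_elim (use 3 2(3) estimates(3) in blast)
    qed
  qed
qed

end
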